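(* Let $\sigma\in\mathbb{R}$, let $\epsilon_n\to0^+$, let $K_n\in C^0(\overline{B_1})$, $K_n\ge0$, with $K_n\to K$ uniformly in $\overline{B_1}$ and in $C^1_{loc}(B_1)$, and let $v_n$ be a sequence of solutions of $$-\Delta v_n=H_ne^{v_n}\ \text{ in }B_1,\qquad\int_{B_1}h_n^{2\alpha_n}e^{v_n}\le C,\qquad\lambda_n=\int_{B_1}H_ne^{v_n},$$ with $C$ independent of $n$. Assume that $\lambda_n\to\lambda_\infty>0$, that for every $r\in(0,1)$ there is $C_r>0$ with $\max_{\overline{B_1\setminus B_r}}v_n\le C_r$ for all $n$, while $\max_{\overline{B_r}}v_n\to\infty$, and that either $\sigma<0$ and $\lambda_\infty<\frac{4\pi}{|\sigma|}$, or $\sigma>0$ and $\lambda_\infty\le\frac{4\pi}{\sigma}$. Suppose in addition that $$\max_{\partial B_1}v_n-\min_{\partial B_1}v_n\le C .$$ Let $\beta$ be the mass for which, along a subsequence, $H_ne^{v_n}\rightharpoonup\beta\,\delta_{p=0}$ weakly in the sense of measures in $B_1$. Then $\beta=\lambda_\infty$ and: (a) if $\sigma<0$, then $8\pi+2\sigma\lambda_\infty=8\pi(1+\alpha_\infty)\le\beta\le8\pi$, and in particular $\frac{8\pi}{1+2|\sigma|}\le\lambda_\infty\le8\pi$; (b) if $\sigma>0$, then $0<\sigma\le\frac12$, $8\pi\le\beta\le8\pi(1+\alpha_\infty)=8\pi+2\sigma\lambda_\infty$, and in particular $$8\pi\le\lambda_\infty\le\min\left\{\frac{8\pi}{1-2\sigma},\frac{4\pi}{\sigma}\right\}$$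 (where $\frac{8\pi}{1-2\sigma}$ is read as $+\infty$ if $\sigma=\frac12$).
   Context: $B_r=B_r(0)\subset\mathbb{R}^2$. $h_n(x)=(\epsilon_n^2+|x|^2)^{1/2}$, $\alpha_n:=\frac{\lambda_n}{4\pi}\sigma$, $\alpha_\infty:=\frac{\lambda_\infty}{4\pi}\sigma$, $H_n(x)=h_n(x)^{2\alpha_n}K_n(x)$. $\delta_{p=0}$ is the Dirac mass at the origin. Under the assumptions preceding the boundary oscillation condition it is known that, along a subsequence, $v_n\to-\infty$ uniformly on compact sets of $B_1\setminus\{0\}$ and $H_ne^{v_n}\rightharpoonup\beta\,\delta_{p=0}$ weakly in the sense of measures in $B_1$, for some $\beta>0$; this is the $\beta$ of the statement. *)

theory Defs
  imports "HOL-Probability.Probability"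
begin

definition partial_deriv :: "'a::euclidean_space \<Rightarrow> ('a \<Rightarrow> real) \<Rightarrow> 'a \<Rightarrow> real" where
  "partial_deriv b f x = frechet_derivative f (at x) b"

text \<open>Class \<open>C\<^sup>k\<close> on an open set.\<close>

primrec Ck_on :: "nat \<Rightarrow> 'a::euclidean_space set \<Rightarrow> ('a \<Rightarrow> real) \<Rightarrow> bool" where
  "Ck_on 0 U f \<longleftrightarrow> continuous_on U f"
| "Ck_on (Suc k) U f \<longleftrightarrow>
     (\<forall>x\<in>U. f differentiable (at x)) \<and> (\<forall>b\<in>Basis. Ck_on k U (partial_deriv b f))"

definition laplacian :: "('a::euclidean_space \<Rightarrow> real) \<Rightarrow> 'a \<Rightarrow> real" where
  "laplacian f x = (\<Sum>b\<in>Basis. partial_deriv b (partial_deriv b f) x)"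

definition compactly_supported_in :: "'a::euclidean_space set \<Rightarrow> ('a \<Rightarrow> real) \<Rightarrow> bool" where
  "compactly_supported_in U \<phi> \<longleftrightarrow>
     compact (closure {x. \<phi> x \<noteq> 0}) \<and> closure {x. \<phi> x \<noteq> 0} \<subseteq> U"

text \<open>\<open>-\<Delta> v = f\<close> in the sense of distributions on the open set \<open>U\<close>; it is meant for
  functions \<open>v\<close> and \<open>f\<close> that are continuous on \<open>U\<close>.\<close>

definition poisson_solution_on ::
    "'a::euclidean_space set \<Rightarrow> ('a \<Rightarrow> real) \<Rightarrow> ('a \<Rightarrow> real) \<Rightarrow> bool" where
  "poisson_solution_on U v f \<longleftrightarrow>
     (\<forall>\<phi>. (\<forall>k. Ck_on k UNIV \<phi>) \<and> compactly_supported_in U \<phi> \<longrightarrow>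
        - (LINT x:U|lborel. v x * laplacian \<phi> x) = (LINT x:U|lborel. f x * \<phi> x))"

definition C1_loc_converges ::
    "'a::euclidean_space set \<Rightarrow> (nat \<Rightarrow> 'a \<Rightarrow> real) \<Rightarrow> ('a \<Rightarrow> real) \<Rightarrow> bool" where
  "C1_loc_converges U f g \<longleftrightarrow>
     (\<forall>n. Ck_on 1 U (f n)) \<and> Ck_on 1 U g \<and>
     (\<forall>A. compact A \<and> A \<subseteq> U \<longrightarrow>
        uniform_limit A f g sequentially \<and>
        (\<forall>b\<in>Basis. uniform_limit A (\<lambda>n. partial_deriv b (f n)) (partial_deriv b g) sequentially))"

text \<open>Weak convergence in the sense of measures in \<open>U\<close>: the test functions are the continuous
  functions with compact support in \<open>U\<close>.\<close>

definition weakly_converges_in ::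
    "'a::euclidean_space set \<Rightarrow> (nat \<Rightarrow> 'a measure) \<Rightarrow> 'a measure \<Rightarrow> bool" where
  "weakly_converges_in U M N \<longleftrightarrow>
     (\<forall>\<psi>. continuous_on UNIV \<psi> \<and> compactly_supported_in U \<psi> \<longrightarrow>
        (\<lambda>n. integral\<^sup>L (M n) \<psi>) \<longlonglongrightarrow> integral\<^sup>L N \<psi>)"

text \<open>The measure \<open>f dx\<close> on \<open>U\<close> and the Dirac mass; \<open>f\<close> is taken nonnegative on \<open>U\<close>.\<close>

definition density_on :: "'a::euclidean_space set \<Rightarrow> ('a \<Rightarrow> real) \<Rightarrow> 'a measure" where
  "density_on U f = density lborel (\<lambda>x. ennreal (indicator U x * f x))"

definition dirac :: "'a::euclidean_space \<Rightarrow> 'a measure" where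
  "dirac p = return borel p"

definition alpha :: "real \<Rightarrow> real \<Rightarrow> real" where
  "alpha \<sigma> lam = lam / (4 * pi) * \<sigma>"

definition h_weight :: "real \<Rightarrow> real^2 \<Rightarrow> real" where
  "h_weight e x = sqrt (e\<^sup>2 + (norm x)\<^sup>2)"

definition H_weight :: "real \<Rightarrow> real \<Rightarrow> real \<Rightarrow> (real^2 \<Rightarrow> real) \<Rightarrow> real^2 \<Rightarrow> real" where
  "H_weight \<sigma> e lam k x = h_weight e x powr (2 * alpha \<sigma> lam) * k x"

end

theory Submission
  imports Defs
begin

text \<open>
  The bounds are the two extreme cases of a Pohozaev identity in the limit. Formally, write
  \<open>f = H e\<^sup>v\<close> and \<open>v = u + w\<close>, where \<open>u\<close> is the logarithmic potential of \<open>f\<close> and \<open>w\<close> is harmonic.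
  For a cutoff \<open>\<psi>\<close> that is 1 near the origin, integration by parts gives
  \<open>\<integral> \<psi> f (x \<bullet> \<nabla>v) = - \<integral> e\<^sup>v (2 \<psi> H + x \<bullet> \<nabla>(\<psi> H))\<close>.

  On the left, \<open>u\<close> contributes \<open>- (1/2\<pi>) \<integral>\<integral> f(x) f(y) \<psi>(x) x \<bullet> (x - y) / |x - y|\<^sup>2\<close>. Exchanging \<open>x\<close> and
  \<open>y\<close> and averaging replaces the singular kernel by
  \<open>(\<psi>(x) x - \<psi>(y) y) \<bullet> (x - y) / (2 |x - y|\<^sup>2)\<close>, which is bounded and equals \<open>1/2\<close> near the origin
  (\<open>symmetrized_energy_estimate\<close>). Concentration of \<open>f\<close> at the origin with mass \<open>\<beta>\<close> therefore makes
  this term tend to \<open>- \<beta>\<^sup>2 / (4\<pi>)\<close>. The contribution of \<open>w\<close> tends to zero as soon as \<open>\<nabla>w\<close> is bounded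
  near the origin, because of the factor \<open>x\<close>. On the right, \<open>x \<bullet> \<nabla>h\<^sup>2\<^sup>\<alpha> = 2\<alpha> (|x|\<^sup>2 / h\<^sup>2) h\<^sup>2\<^sup>\<alpha>\<close> with
  \<open>0 \<le> |x|\<^sup>2 / h\<^sup>2 \<le> 1\<close>, while the terms with \<open>\<nabla>K\<close> and \<open>\<nabla>\<psi>\<close> vanish in the limit. Hence
  \<open>\<beta>\<^sup>2 / (4\<pi>) = 2\<beta> + 2\<alpha> I\<close> for some \<open>I\<close> between 0 and \<open>\<beta>\<close>, and \<open>I = 0\<close>, \<open>I = \<beta>\<close> are the
  two bounds \<open>8\<pi>\<close> and \<open>8\<pi>(1 + \<alpha>)\<close>. That \<open>\<beta>\<close> is the whole mass \<open>lam_inf\<close> follows from the upper bound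
  on \<open>v\<close> near the unit circle, which lets no mass accumulate there; the rest is arithmetic.

  The oscillation condition enters through the bound on \<open>\<nabla>w\<close> (\<open>w_grad_bound\<close>). Let \<open>c\<close> be the
  minimum of \<open>v\<close> on the circle. As \<open>v\<close> is superharmonic, \<open>v \<ge> c\<close> (\<open>minimum_principle\<close>). Testing the
  equation with \<open>\<theta>(1 - |x|\<^sup>2)\<close>, where \<open>\<theta>\<close> is a smoothed positive part, bounds the integral of
  \<open>v - c\<close> over a smaller disc by the total mass and the oscillation
  (\<open>integral_above_boundary_min\<close>), and interior gradients of \<open>w\<close> are controlled by that integral.

  The solutions are only continuous and satisfy the equation in the sense of distributions, so the
  argument is carried out at a scale \<open>\<delta> > 0\<close>. Let \<open>\<phi>\<^sub>\<delta>\<close> be a smooth radial function that equals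
  \<open>log |x| / (2\<pi>)\<close> for \<open>|x| \<ge> \<delta>\<close>, and let \<open>\<rho>\<^sub>\<delta>\<close> be its Laplacian, a mollifier. The difference of
  two such logarithms is a test function. It shows that \<open>v * \<rho>\<^sub>\<delta> + f * \<phi>\<^sub>\<delta>\<close> does not depend on \<open>\<delta>\<close>
  (\<open>mollified_representation\<close>), and this function is \<open>w\<close>. The smooth functions \<open>w - f * \<phi>\<^sub>\<delta>\<close> converge
  to \<open>v\<close> uniformly near the origin; the Pohozaev identity is proved for them and passes to the limit
  \<open>\<delta> \<rightarrow> 0\<close> (\<open>pohozaev_estimate\<close>).
\<close>

section \<open>Smooth functions of one variable\<close>

text \<open>The derivative of \<open>exp (- 1 / t)\<close>, extended by 0 to \<open>t \<le> 0\<close>, has additional factors \<open>1 / t\<close>. The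
  whole family in \<open>m\<close> is, up to linear combinations, closed under differentiation.\<close>

definition flat_exp :: "nat \<Rightarrow> real \<Rightarrow> real" where
  "flat_exp m t = (if t > 0 then inverse t ^ m * exp (- inverse t) else 0)"

lemma DERIV_flat_exp:
  "(flat_exp m has_real_derivative flat_exp (m + 2) t - m * flat_exp (m + 1) t) (at t)"
proof -
  consider "t > 0" | "t < 0" | "t = 0" by linarith
  then show ?thesis
  proof cases
    case 1
    have "((\<lambda>t. inverse t ^ m * exp (- inverse t)) has_real_derivative
        real m * inverse t ^ (m - 1) * (- (inverse t * inverse t)) * exp (- inverse t)
        + exp (- inverse t) * (inverse t * inverse t) * inverse t ^ m) (at t)"
      using 1 by (auto intro!: derivative_eq_intros)
    also have "real m * inverse t ^ (m - 1) * (- (inverse t * inverse t)) * exp (- inverse t)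
        + exp (- inverse t) * (inverse t * inverse t) * inverse t ^ m
        = flat_exp (m + 2) t - m * flat_exp (m + 1) t"
      using 1 by (cases m) (simp_all add: flat_exp_def)
    finally have "((\<lambda>t. inverse t ^ m * exp (- inverse t)) has_real_derivative
            flat_exp (m + 2) t - m * flat_exp (m + 1) t) (at t)" .
    moreover have "\<forall>\<^sub>F u in nhds t. inverse u ^ m * exp (- inverse u) = flat_exp m u"
      using eventually_nhds_in_open[of "{0<..}" t] 1
      by (auto elim!: eventually_mono simp: flat_exp_def)
    ultimately show ?thesis by (subst (asm) DERIV_cong_ev) auto
  next
    case 2
    have "\<forall>\<^sub>F u in nhds t. 0 = flat_exp m u"
      using eventually_nhds_in_open[of "{..<0}" t] 2
      by (auto elim!: eventually_mono simp: flat_exp_def)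
    moreover have "((\<lambda>_. 0) has_real_derivative 0) (at t)" by simp
    ultimately have "(flat_exp m has_real_derivative 0) (at t)" by (subst (asm) DERIV_cong_ev) auto
    then show ?thesis using 2 by (simp add: flat_exp_def)
  next
    case 3
    \<comment> \<open>at the origin, since the exponential beats all powers\<close>
    have "((\<lambda>u. u ^ Suc m / exp u) \<longlongrightarrow> (0::real)) at_top" by (rule tendsto_power_div_exp_0)
    from filterlim_compose[OF this filterlim_inverse_at_top_right]
    have *: "((\<lambda>h. inverse h ^ Suc m / exp (inverse h)) \<longlongrightarrow> (0::real)) (at_right 0)" .
    have "((\<lambda>h. flat_exp m h / h) \<longlongrightarrow> 0) (at_right 0)"
      by (rule Lim_transform_eventually[OF *])
         (auto simp: eventually_at_filter flat_exp_def exp_minus field_simps)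
    moreover have "((\<lambda>h. flat_exp m h / h) \<longlongrightarrow> 0) (at_left 0)"
      by (rule Lim_transform_eventually[OF tendsto_const])
         (auto simp: eventually_at_filter flat_exp_def)
    ultimately have "((\<lambda>h. flat_exp m h / h) \<longlongrightarrow> 0) (at 0)"
      by (simp add: filterlim_split_at)
    then show ?thesis using 3 by (simp add: DERIV_def flat_exp_def)
  qed
qed

text \<open>Every rule is compatible with differentiation, so that the derivative of a member is a member
  again; membership thus stands for the existence of all derivatives without bookkeeping of their
  order. The division rule produces the factor \<open>1 / t\<close> in the derivative of a logarithm, away from
  its singularity.\<close>

inductive_set smooth1 :: "(real \<Rightarrow> real) set" where
  smooth1_const: "(\<lambda>_. c) \<in> smooth1"
| smooth1_flat: "flat_exp m \<in> smooth1"
| smooth1_add: "f \<in> smooth1 \<Longrightarrow> g \<in> smooth1 \<Longrightarrow> (\<lambda>t. f t + g t) \<in> smooth1"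
| smooth1_mult: "f \<in> smooth1 \<Longrightarrow> g \<in> smooth1 \<Longrightarrow> (\<lambda>t. f t * g t) \<in> smooth1"
| smooth1_affine: "f \<in> smooth1 \<Longrightarrow> (\<lambda>t. f (a * t + b)) \<in> smooth1"
| smooth1_inverse: "f \<in> smooth1 \<Longrightarrow> (\<And>t. f t \<noteq> 0) \<Longrightarrow> (\<lambda>t. inverse (f t)) \<in> smooth1"
| smooth1_div_id: "f \<in> smooth1 \<Longrightarrow> c > 0 \<Longrightarrow> (\<And>t. t < c \<Longrightarrow> f t = 0) \<Longrightarrow>
    (\<lambda>t. f t * inverse t) \<in> smooth1"
| smooth1_antideriv: "f \<in> smooth1 \<Longrightarrow> (\<And>t. (g has_real_derivative f t) (at t)) \<Longrightarrow> g \<in> smooth1"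

lemma DERIV_zero_if_locally_zero:
  fixes f :: "real \<Rightarrow> real"
  assumes "(f has_real_derivative d) (at t)" and "\<And>u. u < c \<Longrightarrow> f u = 0" and "t < c"
  shows "d = 0"
proof -
  have "\<forall>\<^sub>F u in nhds t. 0 = f u"
    using eventually_nhds_in_open[of "{..<c}" t] assms(2,3) by (auto elim!: eventually_mono)
  moreover have "((\<lambda>_. 0) has_real_derivative 0) (at t)" by simp
  ultimately have "(f has_real_derivative 0) (at t)" by (subst (asm) DERIV_cong_ev) auto
  with assms(1) show ?thesis by (rule DERIV_unique)
qed

lemma smooth1_deriv:
  assumes "f \<in> smooth1"
  shows "\<exists>f'\<in>smooth1. \<forall>t. (f has_real_derivative f' t) (at t)"
  using assms
proof induction
  case (smooth1_const c)
  show ?case by (rule bexI[of _ "\<lambda>_. 0"]) (auto intro: smooth1.intros)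
next
  case (smooth1_flat m)
  have "(\<lambda>t. flat_exp (m + 2) t + (- real m) * flat_exp (m + 1) t) \<in> smooth1"
    by (intro smooth1.intros)
  then show ?case
    by (rule bexI[rotated]) (use DERIV_flat_exp[of m] in auto)
next
  case (smooth1_add f g)
  then obtain f' g' where *: "f' \<in> smooth1" "g' \<in> smooth1"
    "\<And>t. (f has_real_derivative f' t) (at t)" "\<And>t. (g has_real_derivative g' t) (at t)" by blast
  show ?case
    by (rule bexI[of _ "\<lambda>t. f' t + g' t"]) (use * in \<open>auto intro!: smooth1.intros(3) DERIV_add\<close>)
next
  case (smooth1_mult f g)
  then obtain f' g' where *: "f' \<in> smooth1" "g' \<in> smooth1"
    "\<And>t. (f has_real_derivative f' t) (at t)" "\<And>t. (g has_real_derivative g' t) (at t)" by blast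
  show ?case
    by (rule bexI[of _ "\<lambda>t. f' t * g t + g' t * f t"])
       (use * smooth1_mult.hyps in \<open>auto intro!: smooth1.intros(3,4) DERIV_mult\<close>)
next
  case (smooth1_affine f a b)
  then obtain f' where *: "f' \<in> smooth1" "\<And>t. (f has_real_derivative f' t) (at t)" by blast
  have "((\<lambda>t. f (a * t + b)) has_real_derivative f' (a * t + b) * a) (at t)" for t
    by (rule DERIV_chain2[OF *(2)]) (auto intro!: derivative_eq_intros)
  moreover have "(\<lambda>t. f' (a * t + b) * a) \<in> smooth1"
    by (intro smooth1.intros(1,4,5) *)
  ultimately show ?case by (intro bexI[of _ "\<lambda>t. f' (a * t + b) * a"]) auto
next
  case (smooth1_inverse f)
  then obtain f' where *: "f' \<in> smooth1" "\<And>t. (f has_real_derivative f' t) (at t)" by blast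
  have "((\<lambda>t. inverse (f t)) has_real_derivative (- 1) * (inverse (f t) * f' t * inverse (f t))) (at t)" for t
    using DERIV_inverse'[OF *(2) smooth1_inverse.hyps(2)] by simp
  moreover have "(\<lambda>t. (- 1) * (inverse (f t) * f' t * inverse (f t))) \<in> smooth1"
    by (intro smooth1.intros(1,4,6) * smooth1_inverse.hyps)
  ultimately show ?case
    by (intro bexI[of _ "\<lambda>t. (- 1) * (inverse (f t) * f' t * inverse (f t))"]) auto
next
  case (smooth1_div_id f c)
  then obtain f' where *: "f' \<in> smooth1" "\<And>t. (f has_real_derivative f' t) (at t)" by blast
  have f'0: "f' t = 0" if "t < c" for t
    using DERIV_zero_if_locally_zero[OF *(2)] smooth1_div_id.hyps(3) that by blast
  let ?D = "\<lambda>t. f' t * inverse t + (- 1) * ((f t * inverse t) * inverse t)"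
  have "((\<lambda>t. f t * inverse t) has_real_derivative ?D t) (at t)" for t
  proof (cases "t = 0")
    case True
    have "\<forall>\<^sub>F u in nhds 0. 0 = f u * inverse u"
      using eventually_nhds_in_open[of "{..<c}" 0] smooth1_div_id.hyps(2,3)
      by (auto elim!: eventually_mono)
    moreover have "((\<lambda>_. 0) has_real_derivative 0) (at (0::real))" by simp
    ultimately have "((\<lambda>t. f t * inverse t) has_real_derivative 0) (at 0)"
      by (subst (asm) DERIV_cong_ev) auto
    then show ?thesis using True by simp
  next
    case False
    then show ?thesis
      by (auto intro!: derivative_eq_intros *(2))
  qed
  moreover have "?D \<in> smooth1"
    by (intro smooth1.intros(1,3,4) smooth1.smooth1_div_id[where c = c] * smooth1_div_id.hyps)
       (use f'0 smooth1_div_id.hyps(3) in auto)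
  ultimately show ?case by (intro bexI[of _ ?D]) auto
next
  case (smooth1_antideriv f g)
  then show ?case by blast
qed

lemma smooth1_isCont: "f \<in> smooth1 \<Longrightarrow> isCont f t"
  using smooth1_deriv DERIV_isCont by blast

lemma smooth1_continuous_on: "f \<in> smooth1 \<Longrightarrow> continuous_on A f"
  using smooth1_isCont continuous_at_imp_continuous_on by blast

lemma smooth1_deriv_mem: "f \<in> smooth1 \<Longrightarrow> deriv f \<in> smooth1"
  and smooth1_DERIV: "f \<in> smooth1 \<Longrightarrow> (f has_real_derivative deriv f t) (at t)"
proof -
  assume "f \<in> smooth1"
  then obtain f' where *: "f' \<in> smooth1" "\<And>t. (f has_real_derivative f' t) (at t)"
    using smooth1_deriv by blast
  then have "deriv f = f'" using DERIV_imp_deriv by blast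
  with * show "deriv f \<in> smooth1" and "(f has_real_derivative deriv f t) (at t)" by simp_all
qed

text \<open>As \<open>f\<close> vanishes on the negative axis, near any \<open>t\<close> the integral from 0 agrees with an integral
  from a point to the left of \<open>t\<close>, for which the fundamental theorem of calculus is two-sided.\<close>

lemma DERIV_integral_from_zero:
  fixes f :: "real \<Rightarrow> real"
  assumes cont: "continuous_on UNIV f" and zero: "\<And>t. t \<le> 0 \<Longrightarrow> f t = 0"
  shows "((\<lambda>t. integral {0..t} f) has_real_derivative f t) (at t)"
proof -
  define F where "F t = integral {0..t} f" for t
  have F0: "F t = 0" if "t \<le> 0" for t
    using that by (cases "t = 0") (auto simp: F_def)
  have "(F has_real_derivative f t) (at t)"
  proof -
    define a where "a = min t 0 - 1"
    have "((\<lambda>u. integral {a..u} f) has_real_derivative f t) (at t within {a..t + 1})"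
      by (rule integral_has_real_derivative)
         (auto intro: continuous_on_subset[OF cont] simp: a_def)
    moreover have "at t within {a..t + 1} = at t"
      by (rule at_within_interior) (auto simp: a_def)
    ultimately have *: "((\<lambda>u. integral {a..u} f) has_real_derivative f t) (at t)"
      by (simp only:)
    have eq: "integral {a..u} f = F u" if "u > a" for u
    proof (cases "u \<le> 0")
      case True
      have "integral {a..u} f = integral {a..u} (\<lambda>_. 0)"
        by (rule integral_cong) (use True zero in auto)
      then show ?thesis using F0[OF True] by simp
    next
      case False
      have "integral {a..0} f + integral {0..u} f = integral {a..u} f"
        by (rule Henstock_Kurzweil_Integration.integral_combine)
           (use False in \<open>auto simp: a_def intro!: integrable_continuous_real continuous_on_subset[OF cont]\<close>)
      moreover have "integral {a..0} f = integral {a..0} (\<lambda>_. 0)"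
        by (rule integral_cong) (use zero in auto)
      ultimately show ?thesis by (simp add: F_def)
    qed
    have "t \<in> {a<..}" by (auto simp: a_def)
    then have "\<forall>\<^sub>F u in nhds t. u \<in> {a<..}"
      by (intro eventually_nhds_in_open) auto
    then have "\<forall>\<^sub>F u in nhds t. integral {a..u} f = F u"
      by eventually_elim (use eq in auto)
    then show ?thesis using * by (subst (asm) DERIV_cong_ev) auto
  qed
  then show ?thesis by (simp add: F_def[abs_def])
qed

text \<open>The usual transition between the constants 0 and 1, built from \<open>exp (- 1 / t)\<close> and its mirror
  image.\<close>

definition smooth_step :: "real \<Rightarrow> real" where
  "smooth_step t = flat_exp 0 t * inverse (flat_exp 0 t + flat_exp 0 ((- 1) * t + 1))"

lemma smooth_step_denominator_pos: "flat_exp 0 t + flat_exp 0 ((- 1) * t + 1) > 0"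
proof -
  have "flat_exp 0 t \<ge> 0" "flat_exp 0 ((- 1) * t + 1) \<ge> 0"
    "flat_exp 0 t > 0 \<or> flat_exp 0 ((- 1) * t + 1) > 0"
    by (auto simp: flat_exp_def)
  then show ?thesis by linarith
qed

lemma smooth1_smooth_step: "smooth_step \<in> smooth1"
  unfolding smooth_step_def[abs_def] using smooth_step_denominator_pos
  by (intro smooth1.intros) (metis less_irrefl)

lemma smooth_step_eq_0: "t \<le> 0 \<Longrightarrow> smooth_step t = 0"
  and smooth_step_eq_1: "t \<ge> 1 \<Longrightarrow> smooth_step t = 1"
  by (auto simp: smooth_step_def flat_exp_def)

lemma deriv_smooth_step_nonneg: "deriv smooth_step t \<ge> 0"
proof -
  let ?E = "flat_exp 0" and ?F = "flat_exp 2"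
  let ?N = "\<lambda>t. ?E t + ?E ((- 1) * t + 1)"
  have d1: "(?E has_real_derivative ?F t) (at t)" for t
    using DERIV_flat_exp[of 0 t] by (simp add: numeral_2_eq_2)
  have d2: "((\<lambda>t. ?E ((- 1) * t + 1)) has_real_derivative ?F ((- 1) * t + 1) * (- 1)) (at t)"
    by (rule DERIV_chain2[OF d1]) (auto intro!: derivative_eq_intros)
  have "((\<lambda>t. ?E t / ?N t) has_real_derivative
      (?F t * ?N t - ?E t * (?F t + ?F ((- 1) * t + 1) * (- 1))) / (?N t * ?N t)) (at t)"
    by (rule DERIV_divide[OF d1 DERIV_add[OF d1 d2]]) (use smooth_step_denominator_pos[of t] in simp)
  moreover have "smooth_step = (\<lambda>t. ?E t / ?N t)" by (auto simp: smooth_step_def divide_inverse)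
  ultimately have "(smooth_step has_real_derivative
      (?F t * ?N t - ?E t * (?F t + ?F ((- 1) * t + 1) * (- 1))) / (?N t * ?N t)) (at t)"
    by (simp only:)
  then have "deriv smooth_step t = (?F t * ?N t - ?E t * (?F t + ?F ((- 1) * t + 1) * (- 1))) / (?N t * ?N t)"
    by (rule DERIV_imp_deriv)
  also have "\<dots> = (?F t * ?E ((- 1) * t + 1) + ?E t * ?F ((- 1) * t + 1)) / (?N t * ?N t)"
    by (simp add: algebra_simps)
  also have "\<dots> \<ge> 0"
    by (intro divide_nonneg_nonneg add_nonneg_nonneg mult_nonneg_nonneg) (auto simp: flat_exp_def)
  finally show ?thesis .
qed

lemma smooth_step_nonneg: "smooth_step t \<ge> 0" and smooth_step_le_1: "smooth_step t \<le> 1"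
proof -
  have mono: "smooth_step s \<le> smooth_step t" if "s \<le> t" for s t
    using DERIV_nonneg_imp_nondecreasing[OF that] smooth1_DERIV[OF smooth1_smooth_step] deriv_smooth_step_nonneg
    by blast
  show "smooth_step t \<ge> 0" using mono[of "min t 0" t] smooth_step_eq_0[of "min t 0"] by simp
  show "smooth_step t \<le> 1" using mono[of t "max t 1"] smooth_step_eq_1[of "max t 1"] by simp
qed

section \<open>Radial test functions\<close>

text \<open>A class that contains the radial functions about \<open>a\<close> and is closed under partial derivatives,
  which bring in the coordinate factors.\<close>

inductive_set smooth_about :: "'a::euclidean_space \<Rightarrow> ('a \<Rightarrow> real) set" for a :: 'a where
  smooth_about_const: "(\<lambda>_. c) \<in> smooth_about a"
| smooth_about_coord: "(\<lambda>x. (x - a) \<bullet> b) \<in> smooth_about a"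
| smooth_about_radial: "Q \<in> smooth1 \<Longrightarrow> (\<lambda>x. Q ((norm (x - a))\<^sup>2)) \<in> smooth_about a"
| smooth_about_add: "f \<in> smooth_about a \<Longrightarrow> g \<in> smooth_about a \<Longrightarrow> (\<lambda>x. f x + g x) \<in> smooth_about a"
| smooth_about_mult: "f \<in> smooth_about a \<Longrightarrow> g \<in> smooth_about a \<Longrightarrow> (\<lambda>x. f x * g x) \<in> smooth_about a"

lemma has_derivative_radial:
  fixes a :: "'a::euclidean_space"
  assumes "(Q has_real_derivative q) (at ((norm (x - a))\<^sup>2))"
  shows "((\<lambda>x. Q ((norm (x - a))\<^sup>2)) has_derivative (\<lambda>h. 2 * ((x - a) \<bullet> h) * q)) (at x)"
proof -
  have "((\<lambda>x. (norm (x - a))\<^sup>2) has_derivative (\<lambda>h. 2 * ((x - a) \<bullet> h))) (at x)"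
    unfolding power2_norm_eq_inner
    by (auto intro!: derivative_eq_intros simp: inner_commute)
  moreover have "(Q has_derivative (\<lambda>h. h * q)) (at ((norm (x - a))\<^sup>2))"
    using assms by (simp add: has_field_derivative_def mult.commute[of _ q])
  ultimately show ?thesis using has_derivative_compose by fastforce
qed

text \<open>The directional derivative of a radial function is a coordinate times a radial function, so
  the class reproduces itself.\<close>

lemma smooth_about_derivative:
  assumes "f \<in> smooth_about a"
  shows "\<exists>D. (\<forall>x. (f has_derivative (\<lambda>h. D h x)) (at x)) \<and> (\<forall>h. D h \<in> smooth_about a)"
  using assms
proof induction
  case (smooth_about_const c)
  show ?case by (rule exI[of _ "\<lambda>_ _. 0"]) (auto intro: smooth_about.intros)
next
  case (smooth_about_coord b)
  show ?case by (rule exI[of _ "\<lambda>h _. h \<bullet> b"])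
     (auto intro!: smooth_about.intros derivative_eq_intros)
next
  case (smooth_about_radial Q)
  then obtain q where q: "q \<in> smooth1" "\<And>t. (Q has_real_derivative q t) (at t)"
    using smooth1_deriv by blast
  have "(\<lambda>x. 2 * ((x - a) \<bullet> h) * q ((norm (x - a))\<^sup>2)) \<in> smooth_about a" for h
    by (intro smooth_about.intros q)
  with has_derivative_radial[OF q(2)] show ?case
    by (intro exI[of _ "\<lambda>h x. 2 * ((x - a) \<bullet> h) * q ((norm (x - a))\<^sup>2)"]) blast
next
  case (smooth_about_add f g)
  then obtain D E where *: "\<And>x. (f has_derivative (\<lambda>h. D h x)) (at x)" "\<And>h. D h \<in> smooth_about a"
     "\<And>x. (g has_derivative (\<lambda>h. E h x)) (at x)" "\<And>h. E h \<in> smooth_about a" by blast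
  show ?case
    by (rule exI[of _ "\<lambda>h x. D h x + E h x"])
       (use * in \<open>auto intro!: smooth_about.intros(4) has_derivative_add\<close>)
next
  case (smooth_about_mult f g)
  then obtain D E where *: "\<And>x. (f has_derivative (\<lambda>h. D h x)) (at x)" "\<And>h. D h \<in> smooth_about a"
     "\<And>x. (g has_derivative (\<lambda>h. E h x)) (at x)" "\<And>h. E h \<in> smooth_about a" by blast
  show ?case
    by (rule exI[of _ "\<lambda>h x. f x * E h x + D h x * g x"])
       (use * smooth_about_mult.hyps in \<open>auto intro!: smooth_about.intros(4,5) has_derivative_mult\<close>)
qed

lemma smooth_about_Ck: "f \<in> smooth_about a \<Longrightarrow> Ck_on k UNIV f"
proof (induction k arbitrary: f)
  case 0
  then obtain D where "\<And>x. (f has_derivative (\<lambda>h. D h x)) (at x)"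
    using smooth_about_derivative by blast
  then have "continuous (at x) f" for x
    using has_derivative_continuous by blast
  then show ?case by (simp add: continuous_on_eq_continuous_at)
next
  case (Suc k)
  obtain D where D: "\<And>x. (f has_derivative (\<lambda>h. D h x)) (at x)" "\<And>h. D h \<in> smooth_about a"
    using smooth_about_derivative[OF Suc.prems] by blast
  have "partial_deriv b f = D b" for b
    using frechet_derivative_at[OF D(1)] by (auto simp: partial_deriv_def fun_eq_iff)
  then show ?case
    using D Suc.IH by (auto simp: differentiable_def)
qed

lemma laplacian_radial:
  fixes a :: "'a::euclidean_space" and Q Q' Q'' :: "real \<Rightarrow> real"
  assumes Q': "\<And>t. (Q has_real_derivative Q' t) (at t)" and Q'': "\<And>t. (Q' has_real_derivative Q'' t) (at t)"
  shows "laplacian (\<lambda>x. Q ((norm (x - a))\<^sup>2)) x =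
     2 * real DIM('a) * Q' ((norm (x - a))\<^sup>2) + 4 * (norm (x - a))\<^sup>2 * Q'' ((norm (x - a))\<^sup>2)"
proof -
  have 1: "partial_deriv b (\<lambda>x. Q ((norm (x - a))\<^sup>2)) = (\<lambda>x. 2 * ((x - a) \<bullet> b) * Q' ((norm (x - a))\<^sup>2))" for b
    by (rule ext) (simp add: partial_deriv_def frechet_derivative_at[OF has_derivative_radial[OF Q'], symmetric])
  have "((\<lambda>x. 2 * ((x - a) \<bullet> b) * Q' ((norm (x - a))\<^sup>2)) has_derivative
     (\<lambda>h. 2 * ((x - a) \<bullet> b) * (2 * ((x - a) \<bullet> h) * Q'' ((norm (x - a))\<^sup>2)) +
           2 * (h \<bullet> b) * Q' ((norm (x - a))\<^sup>2))) (at x)" for b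
    by (rule has_derivative_mult[OF _ has_derivative_radial[OF Q'']])
       (auto intro!: derivative_eq_intros)
  from frechet_derivative_at[OF this, symmetric]
  have 2: "partial_deriv b (\<lambda>x. 2 * ((x - a) \<bullet> b) * Q' ((norm (x - a))\<^sup>2)) x =
      4 * ((x - a) \<bullet> b)\<^sup>2 * Q'' ((norm (x - a))\<^sup>2) + 2 * (b \<bullet> b) * Q' ((norm (x - a))\<^sup>2)" for b
    by (simp add: partial_deriv_def power2_eq_square)
  have "laplacian (\<lambda>x. Q ((norm (x - a))\<^sup>2)) x =
      (\<Sum>b\<in>Basis. 4 * ((x - a) \<bullet> b)\<^sup>2 * Q'' ((norm (x - a))\<^sup>2) + 2 * (b \<bullet> b) * Q' ((norm (x - a))\<^sup>2))"
    unfolding laplacian_def 1 2 by (rule refl)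
  also have "\<dots> = 4 * (\<Sum>b\<in>Basis. ((x - a) \<bullet> b)\<^sup>2) * Q'' ((norm (x - a))\<^sup>2)
       + (\<Sum>b\<in>(Basis::'a set). 2 * (b \<bullet> b) * Q' ((norm (x - a))\<^sup>2))"
    by (simp add: sum.distrib sum_distrib_left sum_distrib_right)
  also have "(\<Sum>b\<in>Basis. ((x - a) \<bullet> b)\<^sup>2) = (norm (x - a))\<^sup>2"
    unfolding power2_norm_eq_inner by (subst euclidean_inner) (simp add: power2_eq_square)
  also have "(\<Sum>b\<in>(Basis::'a set). 2 * (b \<bullet> b) * Q' ((norm (x - a))\<^sup>2)) = 2 * real DIM('a) * Q' ((norm (x - a))\<^sup>2)"
    by (simp add: inner_Basis)
  finally show ?thesis by simp
qed

lemma compactly_supported_radial: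
  fixes a :: "'a::euclidean_space"
  assumes "R \<ge> 0" and "\<And>t. t \<ge> R\<^sup>2 \<Longrightarrow> Q t = 0" and "cball a R \<subseteq> U"
  shows "compactly_supported_in U (\<lambda>x. Q ((norm (x - a))\<^sup>2))"
proof -
  have "{x. Q ((norm (x - a))\<^sup>2) \<noteq> 0} \<subseteq> cball a R"
  proof
    fix x assume "x \<in> {x. Q ((norm (x - a))\<^sup>2) \<noteq> 0}"
    then have "(norm (x - a))\<^sup>2 < R\<^sup>2" using assms(2)[of "(norm (x - a))\<^sup>2"] by fastforce
    then have "norm (x - a) < R" using assms(1) power_less_imp_less_base by blast
    then show "x \<in> cball a R" by (simp add: dist_norm norm_minus_commute)
  qed
  then have "closure {x. Q ((norm (x - a))\<^sup>2) \<noteq> 0} \<subseteq> cball a R"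
    by (simp add: closure_minimal)
  moreover from this have "compact (closure {x. Q ((norm (x - a))\<^sup>2) \<noteq> 0})"
    using bounded_cball bounded_subset compact_eq_bounded_closed by blast
  ultimately show ?thesis using assms(3) by (auto simp: compactly_supported_in_def)
qed

text \<open>Only radial test functions are used below. For them the distributional equation becomes a
  statement about a profile \<open>Q\<close> of one variable.\<close>

lemma poisson_radial_test:
  fixes a :: "'a::euclidean_space" and Q Q' Q'' :: "real \<Rightarrow> real"
  assumes sol: "poisson_solution_on U v f"
    and Q: "Q \<in> smooth1" and Q': "\<And>t. (Q has_real_derivative Q' t) (at t)"
    and Q'': "\<And>t. (Q' has_real_derivative Q'' t) (at t)"
    and supp: "R \<ge> 0" "\<And>t. t \<ge> R\<^sup>2 \<Longrightarrow> Q t = 0" "cball a R \<subseteq> U"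
  shows "- (LINT x:U|lborel. v x *
        (2 * real DIM('a) * Q' ((norm (x - a))\<^sup>2) + 4 * (norm (x - a))\<^sup>2 * Q'' ((norm (x - a))\<^sup>2)))
      = (LINT x:U|lborel. f x * Q ((norm (x - a))\<^sup>2))"
proof -
  let ?\<phi> = "\<lambda>x. Q ((norm (x - a))\<^sup>2)"
  have "(\<forall>k. Ck_on k UNIV ?\<phi>) \<and> compactly_supported_in U ?\<phi>"
    using smooth_about_Ck[OF smooth_about_radial[OF Q]] compactly_supported_radial[of R Q a U] supp
    by blast
  then have "- (LINT x:U|lborel. v x * laplacian ?\<phi> x) = (LINT x:U|lborel. f x * ?\<phi> x)"
    using sol unfolding poisson_solution_on_def by blast
  then show ?thesis by (simp add: laplacian_radial[OF Q' Q''])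
qed

section \<open>Divergence identities, radial integrals and convolutions\<close>

lemma integral_lborel_reflect:
  fixes f :: "'a::euclidean_space \<Rightarrow> 'b::{banach, second_countable_topology}"
  assumes [measurable]: "f \<in> borel_measurable borel"
  shows "(\<integral>x. f (t - x) \<partial>lborel) = integral\<^sup>L lborel f"
    and "integrable lborel (\<lambda>x. f (t - x)) \<longleftrightarrow> integrable lborel f"
proof -
  have "distr lborel borel (\<lambda>x. t - x) = (lborel :: 'a measure)"
    using lborel_affine[of "-1" t] by (simp add: density_1)
  then show "(\<integral>x. f (t - x) \<partial>lborel) = integral\<^sup>L lborel f"
    and "integrable lborel (\<lambda>x. f (t - x)) \<longleftrightarrow> integrable lborel f"
    using integral_distr[of "\<lambda>x. t - x" lborel borel f] integrable_distr_eq[of "\<lambda>x. t - x" lborel borel f]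
    by simp_all
qed

lemma integral_lborel_shift:
  fixes f :: "'a::euclidean_space \<Rightarrow> 'b::{banach, second_countable_topology}"
  assumes [measurable]: "f \<in> borel_measurable borel"
  shows "(\<integral>x. f (x + t) \<partial>lborel) = integral\<^sup>L lborel f"
    and "integrable lborel (\<lambda>x. f (x + t)) \<longleftrightarrow> integrable lborel f"
proof -
  have "distr lborel borel (\<lambda>x. x + t) = (lborel :: 'a measure)"
    using lborel_affine[of "1" t] by (simp add: density_1 add.commute)
  then show "(\<integral>x. f (x + t) \<partial>lborel) = integral\<^sup>L lborel f"
    and "integrable lborel (\<lambda>x. f (x + t)) \<longleftrightarrow> integrable lborel f"
    using integral_distr[of "\<lambda>x. x + t" lborel borel f] integrable_distr_eq[of "\<lambda>x. x + t" lborel borel f]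
    by simp_all
qed

lemma integrable_bounded_support:
  fixes f :: "'a::euclidean_space \<Rightarrow> 'b::{banach, second_countable_topology}"
  assumes "f \<in> borel_measurable borel" "\<And>x. norm (f x) \<le> M" "\<And>x. norm x > R \<Longrightarrow> f x = 0"
  shows "integrable lborel f"
proof (rule integrableI_bounded_set[where A = "cball 0 R" and B = M])
  show "emeasure lborel (cball 0 R :: 'a set) < \<infinity>" using emeasure_bounded_finite[OF bounded_cball] .
qed (use assms in auto)

lemma GDERIV_bounded_imp_Lipschitz:
  fixes k :: "'a::euclidean_space \<Rightarrow> real"
  assumes "\<And>x. GDERIV k x :> g x" and "\<And>x. norm (g x) \<le> M"
  shows "\<bar>k x - k y\<bar> \<le> M * norm (x - y)"
proof -
  have "norm (k x - k y) \<le> M * norm (x - y)"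
  proof (rule differentiable_bound[where S = UNIV and f' = "\<lambda>x h. h \<bullet> g x"])
    show "(k has_derivative (\<lambda>h. h \<bullet> g x)) (at x within UNIV)" for x
      using assms(1) by (simp add: gderiv_def)
    show "onorm (\<lambda>h. h \<bullet> g x) \<le> M" for x
    proof (rule onorm_le)
      fix h
      have "norm (h \<bullet> g x) \<le> norm h * norm (g x)" by (simp add: Cauchy_Schwarz_ineq2)
      also have "\<dots> \<le> norm h * M" by (intro mult_left_mono assms(2)) auto
      finally show "norm (h \<bullet> g x) \<le> M * norm h" by (simp add: mult.commute)
    qed
  qed auto
  then show ?thesis by simp
qed

lemma GDERIV_zero_if_locally_zero:
  assumes "GDERIV f x :> d" and "open S" "x \<in> S" "\<And>y. y \<in> S \<Longrightarrow> f y = 0"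
  shows "d = 0"
proof -
  have "((\<lambda>_. 0) has_derivative (\<lambda>h. 0)) (at x)" by simp
  then have "(f has_derivative (\<lambda>h. 0)) (at x)"
    by (rule has_derivative_transform_within_open[OF _ assms(2,3)]) (use assms(4) in auto)
  then have "(\<lambda>h. h \<bullet> d) = (\<lambda>h. 0)"
    using assms(1) has_derivative_unique unfolding gderiv_def by blast
  then have "d \<bullet> d = 0" by metis
  then show ?thesis by simp
qed

lemma GDERIV_zero_outside:
  fixes f :: "'a::euclidean_space \<Rightarrow> real"
  assumes "GDERIV f x :> d" "\<And>x. norm x > R \<Longrightarrow> f x = 0" "norm x > R"
  shows "d = 0"
proof (rule GDERIV_zero_if_locally_zero[OF assms(1)])
  show "open {x::'a. norm x > R}" by (intro open_Collect_less continuous_intros)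
qed (use assms in auto)

lemma GDERIV_continuous_on:
  assumes "\<And>x. GDERIV f x :> g x"
  shows "continuous_on A f"
  using assms unfolding gderiv_def
  by (meson continuous_at_imp_continuous_on has_derivative_continuous)

lemma bounded_if_compact_support:
  fixes g :: "'a::euclidean_space \<Rightarrow> 'b::real_normed_vector"
  assumes cont: "continuous_on UNIV g" and zero: "\<And>x. norm x > R \<Longrightarrow> g x = 0"
  obtains M where "M \<ge> 0" "\<And>x. norm (g x) \<le> M"
proof -
  have "compact (g ` cball 0 R)"
    by (intro compact_continuous_image continuous_on_subset[OF cont]) auto
  then obtain M where "\<And>x. x \<in> cball 0 R \<Longrightarrow> norm (g x) \<le> M"
    using compact_imp_bounded bounded_iff by (metis imageI)
  then have "norm (g x) \<le> max M 0" for x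
    using zero[of x] by (cases "norm x \<le> R") (auto simp: le_max_iff_disj)
  then show ?thesis by (intro that[of "max M 0"]) auto
qed

lemma integrable_continuous_support:
  fixes f :: "'a::euclidean_space \<Rightarrow> 'b::{banach, second_countable_topology}"
  assumes cont: "continuous_on UNIV f" and zero: "\<And>x. norm x > R \<Longrightarrow> f x = 0"
  shows "integrable lborel f"
proof -
  obtain M where M: "\<And>x. norm (f x) \<le> M"
    using bounded_if_compact_support[OF cont zero] by blast
  show ?thesis
    by (rule integrable_bounded_support[OF borel_measurable_continuous_onI[OF cont] M zero])
qed

text \<open>By translation invariance the difference quotients of \<open>Y\<close> have integral zero. They are dominated,
  as \<open>Y\<close> is Lipschitz with compact support, and converge to the directional derivative.\<close>

lemma integral_gradient_compact_support:
  fixes Y :: "'a::euclidean_space \<Rightarrow> real"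
  assumes deriv: "\<And>x. GDERIV Y x :> G x" and cont: "continuous_on UNIV G"
    and zero: "\<And>x. norm x > R \<Longrightarrow> Y x = 0"
  shows "(\<integral>x. G x \<bullet> b \<partial>lborel) = 0"
proof -
  have G0: "G x = 0" if "norm x > R" for x
    by (rule GDERIV_zero_outside[OF deriv zero that])
  obtain M where M: "\<And>x. norm (G x) \<le> M"
    using bounded_if_compact_support[OF cont G0] by blast
  have Ycont: "continuous_on UNIV Y" by (rule GDERIV_continuous_on[OF deriv])
  have [measurable]: "Y \<in> borel_measurable borel" "G \<in> borel_measurable borel"
    using Ycont cont by (auto intro: borel_measurable_continuous_onI)
  define e where "e n = inverse (real (Suc n))" for n
  have e: "e n > 0" "e n \<le> 1" for n
    by (auto simp: e_def inverse_le_1_iff)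
  define q where "q n x = (Y (x + e n *\<^sub>R b) - Y x) / e n" for n x
  have [measurable]: "q n \<in> borel_measurable borel" for n by (simp add: q_def[abs_def])
  have "(\<lambda>n. integral\<^sup>L lborel (q n)) \<longlonglongrightarrow> (\<integral>x. G x \<bullet> b \<partial>lborel)"
  proof (rule integral_dominated_convergence)
    show "integrable lborel (\<lambda>x::'a. M * norm b * indicat_real (cball 0 (R + norm b)) x)"
      using emeasure_bounded_finite[OF bounded_cball[of "0::'a" "R + norm b"]] by auto
    show "AE x in lborel. (\<lambda>n. q n x) \<longlonglongrightarrow> G x \<bullet> b"
    proof (rule AE_I2)
      fix x
      have "((\<lambda>t. Y (x + t *\<^sub>R b)) has_real_derivative G x \<bullet> b) (at 0)"
      proof -
        have "((\<lambda>t. x + t *\<^sub>R b) has_derivative (\<lambda>t. t *\<^sub>R b)) (at 0)"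
          by (auto intro!: derivative_eq_intros)
        moreover have "(Y has_derivative (\<lambda>h. h \<bullet> G x)) (at (x + 0 *\<^sub>R b))"
          using deriv[of x] by (simp add: gderiv_def)
        ultimately have "((\<lambda>t. Y (x + t *\<^sub>R b)) has_derivative (\<lambda>t. (t *\<^sub>R b) \<bullet> G x)) (at 0)"
          by (rule has_derivative_compose)
        then show ?thesis
          by (simp add: has_field_derivative_def inner_commute mult.commute[of _ "b \<bullet> G x"])
      qed
      then have "((\<lambda>t. (Y (x + t *\<^sub>R b) - Y x) / t) \<longlongrightarrow> G x \<bullet> b) (at 0)"
        by (simp add: DERIV_def)
      moreover have "filterlim e (at 0) sequentially"
        unfolding filterlim_at using e(1) LIMSEQ_inverse_real_of_nat
        by (auto simp: e_def[abs_def])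
      ultimately show "(\<lambda>n. q n x) \<longlonglongrightarrow> G x \<bullet> b"
        unfolding q_def by (rule filterlim_compose)
    qed
    show "AE x in lborel. norm (q n x) \<le> M * norm b * indicator (cball 0 (R + norm b)) x" for n
    proof (rule AE_I2)
      fix x
      have *: "\<bar>Y (x + e n *\<^sub>R b) - Y x\<bar> \<le> M * norm (e n *\<^sub>R b)"
        using GDERIV_bounded_imp_Lipschitz[OF deriv M, of "x + e n *\<^sub>R b" x] by simp
      have "norm (q n x) \<le> M * norm b"
        using * e(1)[of n] by (simp add: q_def field_simps)
      moreover have "q n x = 0" if "norm x > R + norm b"
      proof -
        have "norm (e n *\<^sub>R b) \<le> norm b" using e[of n] by (simp add: mult_left_le_one_le)
        moreover have "norm x \<le> norm (x + e n *\<^sub>R b) + norm (e n *\<^sub>R b)"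
          by (metis add_diff_cancel norm_triangle_ineq4)
        ultimately have "norm (x + e n *\<^sub>R b) > R" "norm x > R" using that norm_ge_zero[of b] by linarith+
        then show ?thesis by (simp add: q_def zero)
      qed
      ultimately show "norm (q n x) \<le> M * norm b * indicator (cball 0 (R + norm b)) x"
        by (auto simp: indicator_def)
    qed
  qed auto
  moreover have "integral\<^sup>L lborel (q n) = 0" for n
  proof -
    have iY: "integrable lborel Y" by (rule integrable_continuous_support[OF Ycont zero])
    then have "integral\<^sup>L lborel (q n) = ((\<integral>x. Y (x + e n *\<^sub>R b) \<partial>lborel) - integral\<^sup>L lborel Y) / e n"
      unfolding q_def by (simp add: integral_lborel_shift(2))
    also have "\<dots> = 0" by (simp add: integral_lborel_shift(1))
    finally show ?thesis .
  qed
  ultimately show ?thesis by (simp add: LIMSEQ_const_iff)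
qed

text \<open>The coordinate functions \<open>((x - a) \<bullet> b) Y\<close> have compact support; summing their
  \<open>b\<close>-derivatives gives the divergence \<open>(x - a) \<bullet> \<nabla>Y + n Y\<close>.\<close>

lemma integral_Euler_identity:
  fixes Y :: "'a::euclidean_space \<Rightarrow> real"
  assumes deriv: "\<And>x. GDERIV Y x :> G x" and cont: "continuous_on UNIV G"
    and zero: "\<And>x. norm x > R \<Longrightarrow> Y x = 0"
  shows "(\<integral>x. (x - a) \<bullet> G x \<partial>lborel) = - real DIM('a) * integral\<^sup>L lborel Y"
proof -
  have Ycont: "continuous_on UNIV Y" by (rule GDERIV_continuous_on[OF deriv])
  have G0: "G x = 0" if "norm x > R" for x
    by (rule GDERIV_zero_outside[OF deriv zero that])
  have iY: "integrable lborel Y" by (rule integrable_continuous_support[OF Ycont zero])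
  have iG: "integrable lborel (\<lambda>x. ((x - a) \<bullet> b) * (G x \<bullet> b))" for b
    by (rule integrable_continuous_support[where R = R])
       (auto intro!: continuous_intros cont simp: G0)
  have 1: "(\<integral>x. ((x - a) \<bullet> b) * (G x \<bullet> b) \<partial>lborel) = - integral\<^sup>L lborel Y" if "b \<in> Basis" for b
  proof -
    have "GDERIV (\<lambda>x. (x - a) \<bullet> b) x :> b" for x
      unfolding gderiv_def by (auto intro!: derivative_eq_intros)
    from GDERIV_mult[OF this deriv]
    have "GDERIV (\<lambda>x. ((x - a) \<bullet> b) * Y x) x :> ((x - a) \<bullet> b) *\<^sub>R G x + Y x *\<^sub>R b" for x .
    from integral_gradient_compact_support[OF this, of R b]
    have "(\<integral>x. ((x - a) \<bullet> b) * (G x \<bullet> b) + Y x * (b \<bullet> b) \<partial>lborel) = 0"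
      using zero by (simp add: inner_add_left continuous_intros cont Ycont)
    then show ?thesis using iY iG[of b] that by (simp add: inner_Basis)
  qed
  have "(\<integral>x. (x - a) \<bullet> G x \<partial>lborel) = (\<integral>x. (\<Sum>b\<in>Basis. ((x - a) \<bullet> b) * (G x \<bullet> b)) \<partial>lborel)"
    by (subst euclidean_inner) (rule refl)
  also have "\<dots> = (\<Sum>b\<in>Basis. \<integral>x. ((x - a) \<bullet> b) * (G x \<bullet> b) \<partial>lborel)"
    by (rule Bochner_Integration.integral_sum) (rule iG)
  also have "\<dots> = - real DIM('a) * integral\<^sup>L lborel Y"
    using 1 by simp
  finally show ?thesis .
qed

text \<open>Telescoping over a partition into \<open>N\<close> equal pieces leaves a total change of at most \<open>C / N\<close>.\<close>

lemma quadratic_increments_imp_constant: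
  fixes f :: "real \<Rightarrow> real"
  assumes "\<And>a b. 0 \<le> a \<Longrightarrow> a \<le> b \<Longrightarrow> b \<le> 1 \<Longrightarrow> \<bar>f b - f a\<bar> \<le> C * (b - a)\<^sup>2"
  shows "f 1 = f 0"
proof -
  have *: "\<bar>f 1 - f 0\<bar> \<le> C / real (Suc n)" for n
  proof -
    let ?N = "real (Suc n)"
    have "f 1 - f 0 = (\<Sum>k<Suc n. f (real (Suc k) / ?N) - f (real k / ?N))"
      by (subst sum_lessThan_telescope) simp
    also have "\<bar>\<dots>\<bar> \<le> (\<Sum>k<Suc n. \<bar>f (real (Suc k) / ?N) - f (real k / ?N)\<bar>)"
      by (rule sum_abs)
    also have "\<dots> \<le> (\<Sum>k<Suc n. C / ?N\<^sup>2)"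
    proof (rule sum_mono)
      fix k assume "k \<in> {..<Suc n}"
      then have "\<bar>f (real (Suc k) / ?N) - f (real k / ?N)\<bar> \<le> C * (real (Suc k) / ?N - real k / ?N)\<^sup>2"
        by (intro assms) (auto simp: divide_right_mono)
      also have "real (Suc k) / ?N - real k / ?N = 1 / ?N" by (simp add: field_simps)
      finally show "\<bar>f (real (Suc k) / ?N) - f (real k / ?N)\<bar> \<le> C / ?N\<^sup>2"
        by (simp add: power_divide)
    qed
    also have "\<dots> = C / ?N" by (simp add: power2_eq_square)
    finally show ?thesis .
  qed
  have "(\<lambda>n. C / real (Suc n)) \<longlonglongrightarrow> 0" 
    by (rule LIMSEQ_Suc) (rule lim_const_over_n)
  then have "\<bar>f 1 - f 0\<bar> \<le> 0" by (rule LIMSEQ_le_const) (use * in auto)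
  then show ?thesis by simp
qed

lemma measure_cball_plane: "0 \<le> r \<Longrightarrow> measure lborel (cball (a :: real^2) r) = pi * r\<^sup>2"
  by (simp add: content_cball unit_ball_vol_2)

text \<open>This replaces polar coordinates. The annulus \<open>a < |x|\<^sup>2 \<le> b\<close> has area \<open>pi (b - a)\<close>, so the
  integral over the disc of squared radius \<open>r\<close> and \<open>pi * P r\<close> have increments that agree up to a
  quadratic error.\<close>

lemma integral_radial_plane:
  fixes P P' :: "real \<Rightarrow> real"
  assumes P': "\<And>t. (P has_real_derivative P' t) (at t)"
    and Lip: "\<And>s t. 0 \<le> s \<Longrightarrow> s \<le> t \<Longrightarrow> t \<le> 1 \<Longrightarrow> \<bar>P' t - P' s\<bar> \<le> L * (t - s)"
    and cont: "continuous_on UNIV P'"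
    and zero: "\<And>t. t > 1 \<Longrightarrow> P' t = 0"
  shows "(\<integral>x. P' ((norm (x::real^2))\<^sup>2) \<partial>lborel) = pi * (P 1 - P 0)"
proof -
  have L0: "L \<ge> 0" using Lip[of 0 1] by (simp add: order_trans[OF abs_ge_zero])
  have int: "integrable lborel (\<lambda>x::real^2. P' ((norm x)\<^sup>2))"
    by (rule integrable_continuous_support[where R = 1])
       (auto intro!: continuous_intros continuous_on_compose2[OF cont] zero simp: one_less_power)
  define q where "q r = (\<integral>x. indicator (cball 0 (sqrt r)) x * P' ((norm (x::real^2))\<^sup>2) \<partial>lborel)" for r
  define D where "D r = q r - pi * P r" for r
  have int': "integrable lborel (\<lambda>x. indicator (cball 0 (sqrt r)) x * P' ((norm (x::real^2))\<^sup>2))" for r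
    using integrable_mult_indicator[OF _ int, of "cball 0 (sqrt r)"] by simp
  \<comment> \<open>both increments are compared with \<open>pi * (b - a) * P' a\<close>\<close>
  have inc: "\<bar>D b - D a\<bar> \<le> 2 * pi * L * (b - a)\<^sup>2" if ab: "0 \<le> a" "a \<le> b" "b \<le> 1" for a b
  proof -
    define A :: "(real^2) set" where "A = cball 0 (sqrt b) - cball 0 (sqrt a)"
    have [measurable]: "A \<in> sets borel" by (auto simp: A_def)
    have sub: "cball 0 (sqrt a) \<subseteq> (cball 0 (sqrt b) :: (real^2) set)" using ab by (intro subset_cball) simp
    have finA: "emeasure lborel A < \<infinity>"
      by (rule emeasure_bounded_finite[OF bounded_subset[OF bounded_cball[of 0 "sqrt b"]]]) (auto simp: A_def)
    have mA: "measure lborel A = pi * (b - a)"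
      unfolding A_def using ab sub
      by (subst measure_Diff) (auto simp: measure_cball_plane algebra_simps emeasure_cball)
    have intA: "integrable lborel (\<lambda>x. indicat_real A x * c)" for c using finA by auto
    have "q b - q a = (\<integral>x. indicator A x * P' ((norm x)\<^sup>2) \<partial>lborel)"
      unfolding q_def Bochner_Integration.integral_diff[OF int' int', symmetric]
      by (rule Bochner_Integration.integral_cong) (use sub in \<open>auto simp: A_def indicator_def\<close>)
    also have "\<dots> - P' a * (pi * (b - a)) = (\<integral>x. indicator A x * P' ((norm x)\<^sup>2) - indicator A x * P' a \<partial>lborel)"
      using integrable_mult_indicator[OF _ int, of A] intA[of "P' a"]
      by (subst Bochner_Integration.integral_diff) (auto simp: mA)
    also have "norm \<dots> \<le> (\<integral>x. indicator A x * (L * (b - a)) \<partial>lborel)"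
    proof (rule Bochner_Integration.integral_norm_bound_integral)
      show "integrable lborel (\<lambda>x. indicator A x * P' ((norm x)\<^sup>2) - indicator A x * P' a)"
        using integrable_mult_indicator[OF _ int, of A] intA by auto
      fix x
      show "norm (indicator A x * P' ((norm x)\<^sup>2) - indicator A x * P' a) \<le> indicator A x * (L * (b - a))"
      proof (cases "x \<in> A")
        case True
        then have "sqrt a < norm x" "norm x \<le> sqrt b" by (auto simp: A_def)
        then have t: "a \<le> (norm x)\<^sup>2" "(norm x)\<^sup>2 \<le> b"
          using ab power_mono[of "sqrt a" "norm x" 2] power_mono[of "norm x" "sqrt b" 2] by auto
        have "\<bar>P' ((norm x)\<^sup>2) - P' a\<bar> \<le> L * ((norm x)\<^sup>2 - a)" using ab t by (intro Lip) auto
        also have "\<dots> \<le> L * (b - a)" using L0 t by (intro mult_left_mono) auto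
        finally show ?thesis using True by simp
      qed auto
    qed (rule intA)
    also have "\<dots> = pi * L * (b - a)\<^sup>2" using mA by (simp add: power2_eq_square)
    finally have 1: "\<bar>q b - q a - P' a * (pi * (b - a))\<bar> \<le> pi * L * (b - a)\<^sup>2" by simp
    have 2: "\<bar>P b - P a - P' a * (b - a)\<bar> \<le> L * (b - a)\<^sup>2"
    proof (cases "a = b")
      case False
      then obtain z where z: "a < z" "z < b" "P b - P a = (b - a) * P' z"
        using MVT2[of a b P P'] P' ab by auto
      have "\<bar>P b - P a - P' a * (b - a)\<bar> = (b - a) * \<bar>P' z - P' a\<bar>"
        using ab by (simp add: z(3) abs_mult flip: right_diff_distrib mult.commute[of "b - a"])
      also have "\<dots> \<le> (b - a) * (L * (z - a))" using ab z by (intro mult_left_mono Lip) auto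
      also have "\<dots> \<le> (b - a) * (L * (b - a))" using ab z L0 by (intro mult_left_mono) auto
      finally show ?thesis by (simp add: power2_eq_square algebra_simps)
    qed simp
    have "D b - D a = (q b - q a - P' a * (pi * (b - a))) - pi * (P b - P a - P' a * (b - a))"
      by (simp add: D_def algebra_simps)
    also have "\<bar>\<dots>\<bar> \<le> \<bar>q b - q a - P' a * (pi * (b - a))\<bar> + pi * \<bar>P b - P a - P' a * (b - a)\<bar>"
      by (rule order_trans[OF abs_triangle_ineq4]) (simp add: abs_mult)
    also have "\<dots> \<le> pi * L * (b - a)\<^sup>2 + pi * (L * (b - a)\<^sup>2)"
      by (intro add_mono 1 mult_left_mono 2) auto
    finally show ?thesis by (simp add: mult.assoc mult.left_commute)
  qed
  have "D 1 = D 0" by (rule quadratic_increments_imp_constant[OF inc])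
  moreover have "q 0 = 0"
  proof -
    have "q 0 = (\<integral>x. 0 \<partial>(lborel :: (real^2) measure))"
      unfolding q_def
    proof (rule integral_cong_AE)
      have "AE x in lborel. x \<noteq> (0::real^2)" by (rule AE_lborel_singleton)
      then show "AE x in lborel. indicator (cball 0 (sqrt 0)) x * P' ((norm (x::real^2))\<^sup>2) = 0"
        by eventually_elim auto
    qed (use borel_measurable_integrable[OF int'[of 0]] in auto)
    then show ?thesis by simp
  qed
  moreover have "q 1 = (\<integral>x. P' ((norm (x::real^2))\<^sup>2) \<partial>lborel)"
    unfolding q_def
    by (rule Bochner_Integration.integral_cong) (auto simp: indicator_def zero one_less_power)
  ultimately show ?thesis by (simp add: D_def algebra_simps)
qed

text \<open>For \<open>|z| < 2\<close> the function \<open>1 / |z|\<close> is dominated by the sum over \<open>k\<close> of \<open>2\<^sup>k\<close> times the indicator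
  of the disc of radius \<open>2 / 2\<^sup>k\<close>; the integrals form a geometric series. The logarithmic potential
  of a bounded density therefore has a bounded gradient.\<close>

lemma integrable_inverse_norm_plane:
  "integrable lborel (\<lambda>z::real^2. indicator (ball 0 2) z / norm z)"
proof (rule integrableI_nonneg)
  show "(\<lambda>z::real^2. indicat_real (ball 0 2) z / norm z) \<in> borel_measurable lborel"
    unfolding measurable_lborel2
    by (intro borel_measurable_divide borel_measurable_indicator borel_measurable_continuous_onI) 
       (auto intro: continuous_intros)
  have "(\<integral>\<^sup>+z. ennreal (indicat_real (ball 0 2) z / norm (z::real^2)) \<partial>lborel)
     \<le> (\<integral>\<^sup>+z. (\<Sum>k. ennreal (2 ^ k) * indicator (ball 0 (2 / 2 ^ k)) (z::real^2)) \<partial>lborel)"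
  proof (rule nn_integral_mono)
    fix z :: "real^2"
    have term_le: "T k \<le> (\<Sum>k. T k)" for T :: "nat \<Rightarrow> ennreal" and k
      using sum_le_suminf[of T "{k}"] by simp
    show "ennreal (indicat_real (ball 0 2) z / norm z) \<le> (\<Sum>k. ennreal (2 ^ k) * indicator (ball 0 (2 / 2 ^ k)) z)"
    proof (cases "z \<in> ball 0 2 \<and> z \<noteq> 0")
      case True
      have "\<exists>k. (1/2) ^ k < norm z"
        using real_arch_pow_inv[of "norm z" "1/2"] True by simp
      then have "\<exists>k. 1 / 2 ^ k \<le> norm z"
        by (metis less_imp_le power_one_over)
      \<comment> \<open>the dyadic shell that contains \<open>z\<close>\<close>
      define k where "k = (LEAST k. 1 / 2 ^ k \<le> norm z)"
      have k: "1 / 2 ^ k \<le> norm z" unfolding k_def by (rule LeastI_ex) fact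
      have "norm z < 2 / 2 ^ k"
      proof (cases k)
        case (Suc j)
        then have "\<not> 1 / 2 ^ j \<le> norm z" using not_less_Least[of j "\<lambda>k. 1 / 2 ^ k \<le> norm z"] by (auto simp: k_def)
        then show ?thesis by (simp add: Suc)
      qed (use True in simp)
      have "indicat_real (ball 0 2) z / norm z \<le> 2 ^ k"
        using k True by (simp add: field_simps)
      then have "ennreal (indicat_real (ball 0 2) z / norm z) \<le> ennreal (2 ^ k) * indicator (ball 0 (2 / 2 ^ k)) z"
        using \<open>norm z < 2 / 2 ^ k\<close> by (simp add: ennreal_leI)
      also have "\<dots> \<le> (\<Sum>k. ennreal (2 ^ k) * indicator (ball 0 (2 / 2 ^ k)) z)"
        by (rule term_le)
      finally show ?thesis .
    qed auto
  qed
  also have "\<dots> = (\<Sum>k. ennreal (2 ^ k) * emeasure lborel (ball (0::real^2) (2 / 2 ^ k)))"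
  proof (subst nn_integral_suminf)
    show "(\<lambda>z::real^2. ennreal (2 ^ i) * indicator (ball 0 (2 / 2 ^ i)) z) \<in> borel_measurable lborel" for i
    proof -
      have [measurable]: "ball (0::real^2) (2 / 2 ^ i) \<in> sets borel" by simp
      show ?thesis by measurable
    qed
  qed (simp add: nn_integral_cmult_indicator)
  also have "\<dots> = (\<Sum>k. ennreal (4 * pi * (1/2) ^ k))"
  proof (rule suminf_cong)
    fix k
    have "ennreal (2 ^ k) * emeasure lborel (ball (0::real^2) (2 / 2 ^ k)) = ennreal (2 ^ k * (pi * (2 / 2 ^ k)\<^sup>2))"
      by (simp add: emeasure_ball unit_ball_vol_2 ennreal_mult)
    also have "2 ^ k * (pi * (2 / 2 ^ k)\<^sup>2) = 4 * pi * (1/2) ^ k"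
      by (simp add: power2_eq_square field_simps)
    finally show "ennreal (2 ^ k) * emeasure lborel (ball (0::real^2) (2 / 2 ^ k)) = ennreal (4 * pi * (1/2) ^ k)" .
  qed
  also have "\<dots> = ennreal (\<Sum>k. 4 * pi * (1/2) ^ k)"
    by (rule suminf_ennreal2) (auto intro!: summable_mult summable_geometric)
  also have "\<dots> < \<infinity>" by simp
  finally show "(\<integral>\<^sup>+z. ennreal (indicat_real (ball 0 2) (z::real^2) / norm z) \<partial>lborel) < \<infinity>" .
qed auto


lemma convolution_kernel_integrable:
  fixes V :: "'a::euclidean_space \<Rightarrow> real" and k :: "'a \<Rightarrow> 'b::{banach, second_countable_topology}"
  assumes V: "integrable lborel V" "\<And>y. norm y > R \<Longrightarrow> V y = 0" and k: "continuous_on UNIV k"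
  shows "integrable lborel (\<lambda>y. V y *\<^sub>R k (x - y))"
proof -
  have "compact ((\<lambda>y. k (x - y)) ` cball 0 R)"
    by (intro compact_continuous_image continuous_on_compose2[OF k]) (auto intro!: continuous_intros)
  then obtain B where B: "\<And>y. y \<in> cball 0 R \<Longrightarrow> norm (k (x - y)) \<le> B"
    using compact_imp_bounded bounded_iff by (metis (no_types, lifting) imageI)
  have [measurable]: "k \<in> borel_measurable borel" "V \<in> borel_measurable borel"
    using k V(1) by (auto intro: borel_measurable_continuous_onI)
  show ?thesis
  proof (rule Bochner_Integration.integrable_bound)
    show "integrable lborel (\<lambda>y. B * V y)" using V(1) by simp
    show "AE y in lborel. norm (V y *\<^sub>R k (x - y)) \<le> norm (B * V y)"
    proof (rule AE_I2)
      fix y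
      show "norm (V y *\<^sub>R k (x - y)) \<le> norm (B * V y)"
      proof (cases "norm y > R")
        case False
        then have "norm (k (x - y)) \<le> \<bar>B\<bar>" using B[of y] by auto
        then show ?thesis using mult_left_mono[of "norm (k (x - y))" "\<bar>B\<bar>" "\<bar>V y\<bar>"]
          by (simp add: abs_mult mult.commute[of "\<bar>B\<bar>"])
      qed (simp add: V(2))
    qed
  qed measurable
qed

text \<open>Differentiation under the integral. The mean value inequality bounds the linearisation error of
  the kernel by \<open>2 M |h|\<close>, which dominates.\<close>

lemma GDERIV_convolution:
  fixes V k :: "'a::euclidean_space \<Rightarrow> real"
  assumes V: "integrable lborel V" "\<And>y. norm y > R \<Longrightarrow> V y = 0"
    and k: "\<And>x. GDERIV k x :> g x" and g: "continuous_on UNIV g" and M: "\<And>x. norm (g x) \<le> M"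
  shows "GDERIV (\<lambda>x. \<integral>y. V y * k (x - y) \<partial>lborel) x :> (\<integral>y. V y *\<^sub>R g (x - y) \<partial>lborel)"
proof -
  have kc: "continuous_on UNIV k" by (rule GDERIV_continuous_on[OF k])
  have [measurable]: "k \<in> borel_measurable borel" "g \<in> borel_measurable borel" "V \<in> borel_measurable borel"
    using kc g V(1) by (auto intro: borel_measurable_continuous_onI)
  have ik: "integrable lborel (\<lambda>y. V y * k (x - y))" for x
    using convolution_kernel_integrable[OF V kc] by simp
  have ig: "integrable lborel (\<lambda>y. V y *\<^sub>R g (x - y))" for x
    using convolution_kernel_integrable[OF V g] .
  define r where "r h y = k (x - y + h) - k (x - y) - h \<bullet> g (x - y)" for h y
  have r_bound: "\<bar>r h y\<bar> \<le> 2 * M * norm h" for h y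
  proof -
    have "\<bar>k (x - y + h) - k (x - y)\<bar> \<le> M * norm h"
      using GDERIV_bounded_imp_Lipschitz[OF k M, of "x - y + h" "x - y"] by simp
    moreover have "\<bar>h \<bullet> g (x - y)\<bar> \<le> M * norm h"
      using Cauchy_Schwarz_ineq2[of h "g (x - y)"] mult_left_mono[OF M[of "x - y"], of "norm h"]
      by (simp add: mult.commute)
    ultimately show ?thesis by (simp add: r_def)
  qed
  have r_meas [measurable]: "r h \<in> borel_measurable borel" for h by (simp add: r_def[abs_def])
  show ?thesis
    unfolding gderiv_def has_derivative_at
  proof (intro conjI)
    show "bounded_linear (\<lambda>h. h \<bullet> (\<integral>y. V y *\<^sub>R g (x - y) \<partial>lborel))"
      by (rule bounded_linear_inner_left)
    show "(\<lambda>h. norm ((\<integral>y. V y * k (x + h - y) \<partial>lborel) - (\<integral>y. V y * k (x - y) \<partial>lborel)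
          - h \<bullet> (\<integral>y. V y *\<^sub>R g (x - y) \<partial>lborel)) / norm h) \<midarrow>0\<rightarrow> 0"
      unfolding tendsto_at_iff_sequentially comp_def
    proof (intro allI impI)
      fix h :: "nat \<Rightarrow> 'a" assume h: "\<forall>i. h i \<in> UNIV - {0}" "h \<longlonglongrightarrow> 0"
      have h0: "h i \<noteq> 0" for i using h(1) by auto
      have eq: "(\<integral>y. V y * k (x + h i - y) \<partial>lborel) - (\<integral>y. V y * k (x - y) \<partial>lborel)
          - h i \<bullet> (\<integral>y. V y *\<^sub>R g (x - y) \<partial>lborel) = (\<integral>y. V y * r (h i) y \<partial>lborel)" for i
      proof -
        have "h i \<bullet> (\<integral>y. V y *\<^sub>R g (x - y) \<partial>lborel) = (\<integral>y. h i \<bullet> (V y *\<^sub>R g (x - y)) \<partial>lborel)"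
          by (rule integral_inner_right[symmetric]) (use ig in simp)
        then have "(\<integral>y. V y * k (x + h i - y) \<partial>lborel) - (\<integral>y. V y * k (x - y) \<partial>lborel)
          - h i \<bullet> (\<integral>y. V y *\<^sub>R g (x - y) \<partial>lborel)
          = (\<integral>y. V y * k (x + h i - y) - V y * k (x - y) - h i \<bullet> (V y *\<^sub>R g (x - y)) \<partial>lborel)"
          by (simp only: Bochner_Integration.integral_diff[OF ik ik] Bochner_Integration.integral_diff[OF
              Bochner_Integration.integrable_diff[OF ik ik] integrable_inner_right[OF ig]])
        also have "\<dots> = (\<integral>y. V y * r (h i) y \<partial>lborel)"
          by (rule Bochner_Integration.integral_cong) (auto simp: r_def algebra_simps)
        finally show ?thesis .
      qed
      have "(\<lambda>i. \<integral>y. V y * r (h i) y / norm (h i) \<partial>lborel) \<longlonglongrightarrow> (\<integral>y. 0 \<partial>(lborel :: 'a measure))"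
      proof (rule integral_dominated_convergence)
        show "integrable lborel (\<lambda>y. 2 * M * \<bar>V y\<bar>)" using V(1) by simp
        show "AE y in lborel. (\<lambda>i. V y * r (h i) y / norm (h i)) \<longlonglongrightarrow> 0"
        proof (rule AE_I2)
          fix y
          have "(\<lambda>u. norm (k (x - y + u) - k (x - y) - u \<bullet> g (x - y)) / norm u) \<midarrow>0\<rightarrow> 0"
            using k[of "x - y"] unfolding gderiv_def has_derivative_at by blast
          then have "(\<lambda>i. norm (r (h i) y) / norm (h i)) \<longlonglongrightarrow> 0"
            using h unfolding tendsto_at_iff_sequentially comp_def r_def by blast
          then have "(\<lambda>i. norm (r (h i) y / norm (h i))) \<longlonglongrightarrow> 0" by simp
          then have "(\<lambda>i. r (h i) y / norm (h i)) \<longlonglongrightarrow> 0" by (rule tendsto_norm_zero_cancel)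
          from tendsto_mult_left[OF this, of "V y"]
          show "(\<lambda>i. V y * r (h i) y / norm (h i)) \<longlonglongrightarrow> 0" by simp
        qed
        show "AE y in lborel. norm (V y * r (h i) y / norm (h i)) \<le> 2 * M * \<bar>V y\<bar>" for i
        proof (rule AE_I2)
          fix y
          have "\<bar>r (h i) y\<bar> / norm (h i) \<le> 2 * M" using r_bound[of "h i" y] h0[of i] by (simp add: field_simps)
          from mult_left_mono[OF this, of "\<bar>V y\<bar>"]
          show "norm (V y * r (h i) y / norm (h i)) \<le> 2 * M * \<bar>V y\<bar>"
            by (simp add: abs_mult mult.commute)
        qed
      qed auto
      then have "(\<lambda>i. (\<integral>y. V y * r (h i) y \<partial>lborel) / norm (h i)) \<longlonglongrightarrow> 0" by simp
      then have "(\<lambda>i. norm ((\<integral>y. V y * r (h i) y \<partial>lborel) / norm (h i))) \<longlonglongrightarrow> 0"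
        by (rule tendsto_norm_zero)
      then show "(\<lambda>i. norm ((\<integral>y. V y * k (x + h i - y) \<partial>lborel) - (\<integral>y. V y * k (x - y) \<partial>lborel)
          - h i \<bullet> (\<integral>y. V y *\<^sub>R g (x - y) \<partial>lborel)) / norm (h i)) \<longlonglongrightarrow> 0"
        unfolding eq by simp
    qed
  qed
qed

lemma continuous_convolution:
  fixes V :: "'a::euclidean_space \<Rightarrow> real" and g :: "'a \<Rightarrow> 'b::{banach, second_countable_topology}"
  assumes V: "integrable lborel V" and g: "continuous_on UNIV g" and M: "\<And>x. norm (g x) \<le> M"
  shows "continuous_on UNIV (\<lambda>x. \<integral>y. V y *\<^sub>R g (x - y) \<partial>lborel)"
proof -
  have [measurable]: "g \<in> borel_measurable borel" "V \<in> borel_measurable borel"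
    using g V(1) by (auto intro: borel_measurable_continuous_onI)
  show ?thesis
    unfolding continuous_on_sequentially comp_def
  proof (intro allI ballI impI)
    fix z x assume z: "(\<forall>n. z n \<in> (UNIV::'a set)) \<and> z \<longlonglongrightarrow> x"
    show "(\<lambda>n. \<integral>y. V y *\<^sub>R g (z n - y) \<partial>lborel) \<longlonglongrightarrow> (\<integral>y. V y *\<^sub>R g (x - y) \<partial>lborel)"
    proof (rule integral_dominated_convergence)
      show "integrable lborel (\<lambda>y. M * \<bar>V y\<bar>)" using V(1) by simp
      show "AE y in lborel. (\<lambda>n. V y *\<^sub>R g (z n - y)) \<longlonglongrightarrow> V y *\<^sub>R g (x - y)"
      proof (rule AE_I2)
        fix y
        have "(\<lambda>n. z n - y) \<longlonglongrightarrow> x - y" using z by (auto intro: tendsto_intros)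
        then have "(\<lambda>n. g (z n - y)) \<longlonglongrightarrow> g (x - y)"
          using continuous_on_tendsto_compose[OF g] by fastforce
        then show "(\<lambda>n. V y *\<^sub>R g (z n - y)) \<longlonglongrightarrow> V y *\<^sub>R g (x - y)" by (intro tendsto_intros)
      qed
      show "AE y in lborel. norm (V y *\<^sub>R g (z n - y)) \<le> M * \<bar>V y\<bar>" for n
        using mult_left_mono[OF M abs_ge_zero] by (auto simp: mult.commute)
    qed auto
  qed
qed

section \<open>The mollified logarithm\<close>

text \<open>The mass that the mollifier of scale 1 puts on the disc of squared radius \<open>t\<close>.\<close>

definition cap_mass :: "real \<Rightarrow> real" where
  "cap_mass t = smooth_step (2 * t + (- 1))"

definition reg_log' :: "real \<Rightarrow> real" where
  "reg_log' t = cap_mass t * inverse t"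

text \<open>A logarithm that is made constant near zero: its derivative is \<open>1 / t\<close> weighted by
  \<open>cap_mass\<close>, and the constant is chosen so that it equals \<open>ln\<close> from 1 on.\<close>

definition reg_log :: "real \<Rightarrow> real" where
  "reg_log t = integral {0..t} reg_log' + (- integral {0..1} reg_log')"

lemma smooth1_cap_mass: "cap_mass \<in> smooth1"
  unfolding cap_mass_def[abs_def] by (rule smooth1.smooth1_affine[OF smooth1_smooth_step])

lemma cap_mass_eq_0: "t \<le> 1/2 \<Longrightarrow> cap_mass t = 0"
  and cap_mass_eq_1: "t \<ge> 1 \<Longrightarrow> cap_mass t = 1"
  and cap_mass_nonneg: "cap_mass t \<ge> 0"
  and cap_mass_le_1: "cap_mass t \<le> 1"
  by (auto simp: cap_mass_def smooth_step_eq_0 smooth_step_eq_1 smooth_step_nonneg smooth_step_le_1)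

lemma deriv_cap_mass_nonneg: "deriv cap_mass t \<ge> 0"
proof -
  have "((\<lambda>u::real. 2 * u + (- 1)) has_real_derivative 2) (at t)"
    by (auto intro!: derivative_eq_intros)
  from DERIV_chain2[OF smooth1_DERIV[OF smooth1_smooth_step] this]
  have "deriv cap_mass t = deriv smooth_step (2 * t + (- 1)) * 2"
    unfolding cap_mass_def[abs_def] by (rule DERIV_imp_deriv)
  also have "\<dots> \<ge> 0" by (intro mult_nonneg_nonneg deriv_smooth_step_nonneg) simp
  finally show ?thesis .
qed

lemma deriv_cap_mass_eq_0:
  assumes t: "t > 1"
  shows "deriv cap_mass t = 0"
proof -
  have "open {1::real<..}" by (rule open_greaterThan)
  moreover have "((\<lambda>_. 1) has_real_derivative 0) (at t)" by (rule DERIV_const)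
  ultimately have "(cap_mass has_real_derivative 0) (at t)"
    using t by (elim has_field_derivative_transform_within_open[rotated])
      (simp_all only: greaterThan_iff cap_mass_eq_1[OF less_imp_le])
  then show ?thesis by (rule DERIV_imp_deriv)
qed

lemma smooth1_reg_log': "reg_log' \<in> smooth1"
  unfolding reg_log'_def[abs_def]
  by (rule smooth1.smooth1_div_id[OF smooth1_cap_mass, of "1/2"]) (auto simp: cap_mass_eq_0)

lemma DERIV_reg_log: "(reg_log has_real_derivative reg_log' t) (at t)"
proof -
  have "((\<lambda>t. integral {0..t} reg_log') has_real_derivative reg_log' t) (at t)"
    by (rule DERIV_integral_from_zero[OF smooth1_continuous_on[OF smooth1_reg_log']])
       (auto simp: reg_log'_def cap_mass_eq_0)
  from DERIV_add[OF this DERIV_const[of "- integral {0..1} reg_log'"]]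
  show ?thesis unfolding reg_log_def[abs_def] add_0_right .
qed

lemma smooth1_reg_log: "reg_log \<in> smooth1"
  by (rule smooth1.smooth1_antideriv[OF smooth1_reg_log' DERIV_reg_log])

lemma reg_log_eq_ln: "t \<ge> 1 \<Longrightarrow> reg_log t = ln t"
proof -
  assume t: "t \<ge> 1"
  have "(reg_log t - ln t) = (reg_log 1 - ln 1)"
  proof (cases "t = 1")
    case False
    have "((\<lambda>u. reg_log u - ln u) has_real_derivative 0) (at u)" if "u \<ge> 1" for u
    proof -
      have "((\<lambda>u. reg_log u - ln u) has_real_derivative reg_log' u - 1 / u) (at u)"
        by (rule DERIV_diff[OF DERIV_reg_log]) (use that in \<open>auto intro!: derivative_eq_intros\<close>)
      then show ?thesis using that by (simp add: reg_log'_def cap_mass_eq_1 divide_inverse)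
    qed
    then show ?thesis using False t
      by (intro DERIV_isconst2[of 1 t _ t]) (auto intro!: continuous_at_imp_continuous_on DERIV_isCont)
  qed simp
  then show ?thesis by (simp add: reg_log_def)
qed

lemma smooth1_Lipschitz:
  assumes f: "f \<in> smooth1"
  shows "\<exists>L. \<forall>s t. 0 \<le> s \<longrightarrow> s \<le> t \<longrightarrow> t \<le> 1 \<longrightarrow> \<bar>f t - f s\<bar> \<le> L * (t - s)"
proof -
  have "compact (deriv f ` {0..1})"
    by (intro compact_continuous_image smooth1_continuous_on smooth1_deriv_mem f) auto
  then obtain L where L: "\<And>t. t \<in> {0..1} \<Longrightarrow> \<bar>deriv f t\<bar> \<le> L"
    using compact_imp_bounded bounded_iff by (metis imageI real_norm_def)
  have "\<bar>f t - f s\<bar> \<le> L * (t - s)" if st: "0 \<le> s" "s \<le> t" "t \<le> 1" for s t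
  proof (cases "s = t")
    case False
    with st have "s < t" by simp
    from MVT2[OF this smooth1_DERIV[OF f]] obtain z where z: "s < z" "z < t" "f t - f s = (t - s) * deriv f z"
      by metis
    have "\<bar>f t - f s\<bar> = (t - s) * \<bar>deriv f z\<bar>" using st by (simp add: z(3) abs_mult)
    also have "\<dots> \<le> (t - s) * L" using L[of z] z st by (intro mult_left_mono) auto
    finally show ?thesis by (simp add: mult.commute)
  qed simp
  then show ?thesis by (intro exI[of _ L]) simp
qed

text \<open>Profiles are functions of the squared norm. The summand \<open>2 * ln \<delta>\<close> compensates the rescaling, so
  that for \<open>|x| \<ge> \<delta>\<close> the kernel \<open>log_kernel \<delta>\<close> is the fundamental solution \<open>log |x| / (2\<pi>)\<close>.\<close>

definition log_profile :: "real \<Rightarrow> real \<Rightarrow> real" where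
  "log_profile \<delta> t = (reg_log (t / \<delta>\<^sup>2) + 2 * ln \<delta>) / (4 * pi)"

definition mollifier_profile :: "real \<Rightarrow> real \<Rightarrow> real" where
  "mollifier_profile \<delta> t = deriv cap_mass (t / \<delta>\<^sup>2) / (pi * \<delta>\<^sup>2)"

definition log_kernel :: "real \<Rightarrow> real^2 \<Rightarrow> real" where
  "log_kernel \<delta> x = log_profile \<delta> ((norm x)\<^sup>2)"

definition mollifier :: "real \<Rightarrow> real^2 \<Rightarrow> real" where
  "mollifier \<delta> x = mollifier_profile \<delta> ((norm x)\<^sup>2)"

definition log_grad :: "real \<Rightarrow> real^2 \<Rightarrow> real^2" where
  "log_grad \<delta> x = (reg_log' ((norm x)\<^sup>2 / \<delta>\<^sup>2) / (2 * pi * \<delta>\<^sup>2)) *\<^sub>R x"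

lemma smooth1_cmult: "f \<in> smooth1 \<Longrightarrow> (\<lambda>t. c * f t) \<in> smooth1"
  by (intro smooth1.smooth1_mult smooth1.smooth1_const)

lemma smooth1_scale: "f \<in> smooth1 \<Longrightarrow> (\<lambda>t. f (t / c)) \<in> smooth1"
  using smooth1.smooth1_affine[of f "inverse c" 0] by (simp add: divide_inverse mult.commute)

lemma DERIV_scale:
  assumes "\<And>t. (f has_real_derivative f' t) (at t)"
  shows "((\<lambda>t. f (t / c)) has_real_derivative f' (t / c) / c) (at t)"
proof -
  have "((\<lambda>t. f (t / c)) has_real_derivative f' (t / c) * (1 / c)) (at t)"
    by (rule DERIV_chain2[OF assms]) (auto intro!: derivative_eq_intros DERIV_cdivide)
  then show ?thesis by simp
qed

lemma smooth1_log_profile: "log_profile \<delta> \<in> smooth1"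
proof -
  have "(\<lambda>t. inverse (4 * pi) * (reg_log (t / \<delta>\<^sup>2) + 2 * ln \<delta>)) \<in> smooth1"
    by (rule smooth1_cmult[OF smooth1.smooth1_add[OF smooth1_scale[OF smooth1_reg_log] smooth1.smooth1_const]])
  moreover have "log_profile \<delta> = (\<lambda>t. inverse (4 * pi) * (reg_log (t / \<delta>\<^sup>2) + 2 * ln \<delta>))"
    by (rule ext) (unfold log_profile_def, rule trans[OF divide_inverse mult.commute])
  ultimately show ?thesis by (simp only:)
qed

lemma DERIV_log_profile:
  "(log_profile \<delta> has_real_derivative reg_log' (t / \<delta>\<^sup>2) / (4 * pi * \<delta>\<^sup>2)) (at t)"
proof -
  have "((\<lambda>t. (reg_log (t / \<delta>\<^sup>2) + 2 * ln \<delta>) / (4 * pi)) has_real_derivative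
      (reg_log' (t / \<delta>\<^sup>2) / \<delta>\<^sup>2 + 0) / (4 * pi)) (at t)"
    by (rule DERIV_cdivide[OF DERIV_add[OF DERIV_scale[OF DERIV_reg_log] DERIV_const]])
  moreover have "(reg_log' (t / \<delta>\<^sup>2) / \<delta>\<^sup>2 + 0) / (4 * pi) = reg_log' (t / \<delta>\<^sup>2) / (4 * pi * \<delta>\<^sup>2)"
    by (simp add: mult.commute)
  ultimately show ?thesis by (simp only: log_profile_def[abs_def])
qed

text \<open>In the plane the Laplacian of \<open>Q(|x|\<^sup>2)\<close> is \<open>4 (t Q'(t))'\<close> at \<open>t = |x|\<^sup>2\<close>, and for the logarithm
  \<open>t Q'(t)\<close> is a multiple of \<open>cap_mass\<close>.\<close>

lemma log_profile_laplacian: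
  assumes "\<delta> > 0"
  obtains q where "\<And>t. ((\<lambda>t. reg_log' (t / \<delta>\<^sup>2) / (4 * pi * \<delta>\<^sup>2)) has_real_derivative q t) (at t)"
    and "\<And>t. 4 * (reg_log' (t / \<delta>\<^sup>2) / (4 * pi * \<delta>\<^sup>2)) + 4 * t * q t = mollifier_profile \<delta> t"
proof
  define q where "q t = deriv reg_log' (t / \<delta>\<^sup>2) / \<delta>\<^sup>2 / (4 * pi * \<delta>\<^sup>2)" for t
  show "((\<lambda>t. reg_log' (t / \<delta>\<^sup>2) / (4 * pi * \<delta>\<^sup>2)) has_real_derivative q t) (at t)" for t
    unfolding q_def
    by (rule DERIV_cdivide[OF DERIV_scale[OF smooth1_DERIV[OF smooth1_reg_log']]])
  have *: "reg_log' t + t * deriv reg_log' t = deriv cap_mass t" for t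
  proof -
    have "((\<lambda>t. t * reg_log' t) has_real_derivative 1 * reg_log' t + deriv reg_log' t * t) (at t)"
      by (intro DERIV_mult DERIV_ident smooth1_DERIV smooth1_reg_log')
    moreover have "(\<lambda>t. t * reg_log' t) = cap_mass"
    proof
      show "t * reg_log' t = cap_mass t" for t
        by (cases "t = 0") (simp_all add: reg_log'_def cap_mass_eq_0)
    qed
    ultimately have "(cap_mass has_real_derivative 1 * reg_log' t + deriv reg_log' t * t) (at t)"
      by (simp only:)
    then have "deriv cap_mass t = 1 * reg_log' t + deriv reg_log' t * t" by (rule DERIV_imp_deriv)
    then show ?thesis by (simp add: mult.commute)
  qed
  show "4 * (reg_log' (t / \<delta>\<^sup>2) / (4 * pi * \<delta>\<^sup>2)) + 4 * t * q t = mollifier_profile \<delta> t" for t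
  proof -
    have "4 * (reg_log' (t / \<delta>\<^sup>2) / (4 * pi * \<delta>\<^sup>2)) + 4 * t * q t
        = (reg_log' (t / \<delta>\<^sup>2) + (t / \<delta>\<^sup>2) * deriv reg_log' (t / \<delta>\<^sup>2)) / (pi * \<delta>\<^sup>2)"
      unfolding q_def by (simp add: add_divide_distrib mult.commute mult.left_commute)
    then show ?thesis unfolding * mollifier_profile_def .
  qed
qed

lemma log_profile_far:
  assumes "\<delta> > 0" "t \<ge> \<delta>\<^sup>2"
  shows "log_profile \<delta> t = ln t / (4 * pi)"
proof -
  have "t > 0" using assms zero_less_power[of \<delta> 2] by linarith
  moreover have "t / \<delta>\<^sup>2 \<ge> 1" using assms by (simp add: field_simps)
  ultimately show ?thesis
    using assms by (simp add: log_profile_def reg_log_eq_ln ln_div ln_realpow)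
qed

text \<open>In terms of \<open>s = 1 / \<delta>\<^sup>2\<close> the derivative of the profile is a positive multiple of
  \<open>(cap_mass (t s) - 1) / s \<le> 0\<close>.\<close>

lemma log_profile_mono:
  assumes "0 < \<delta>" "\<delta> \<le> \<eta>"
  shows "log_profile \<delta> t \<le> log_profile \<eta> t"
proof -
  have "reg_log (t * s2) - ln s2 \<le> reg_log (t * s1) - ln s1" if s: "0 < s1" "s1 \<le> s2" for s1 s2
  proof (rule DERIV_nonpos_imp_nonincreasing[OF s(2)])
    fix s assume "s1 \<le> s" "s \<le> s2"
    then have s0: "s > 0" using s by simp
    have "((\<lambda>s. reg_log (t * s) - ln s) has_real_derivative reg_log' (t * s) * t - 1 / s) (at s)"
      using s0 by (auto intro!: derivative_eq_intros DERIV_chain2[OF DERIV_reg_log])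
    moreover have "reg_log' (t * s) * t - 1 / s = (cap_mass (t * s) - 1) / s"
      using s0 by (cases "t = 0") (auto simp: reg_log'_def cap_mass_eq_0 field_simps)
    moreover have "\<dots> \<le> 0" using s0 cap_mass_le_1 by (simp add: divide_nonpos_pos)
    ultimately show "\<exists>y. ((\<lambda>s. reg_log (t * s) - ln s) has_real_derivative y) (at s) \<and> y \<le> 0" by metis
  qed
  from this[of "1 / \<eta>\<^sup>2" "1 / \<delta>\<^sup>2"] assms
  have "reg_log (t * (1 / \<delta>\<^sup>2)) - ln (1 / \<delta>\<^sup>2) \<le> reg_log (t * (1 / \<eta>\<^sup>2)) - ln (1 / \<eta>\<^sup>2)"
    by (simp add: frac_le power_mono)
  then show ?thesis
    using assms by (simp add: log_profile_def ln_div ln_realpow divide_right_mono)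
qed

lemma continuous_on_smooth1_radial:
  fixes A :: "'a::real_normed_vector set"
  assumes "f \<in> smooth1"
  shows "continuous_on A (\<lambda>x. f ((norm x)\<^sup>2 / c))"
  unfolding divide_inverse
  by (rule continuous_on_compose2[OF smooth1_continuous_on[OF assms, of UNIV]])
     (auto intro!: continuous_on_mult continuous_on_power continuous_on_norm continuous_on_id continuous_on_const)

lemma mollifier_nonneg: "mollifier \<delta> x \<ge> 0"
  by (simp add: mollifier_def mollifier_profile_def deriv_cap_mass_nonneg)

lemma mollifier_eq_0: "\<delta> > 0 \<Longrightarrow> norm x > \<delta> \<Longrightarrow> mollifier \<delta> x = 0"
proof -
  assume "\<delta> > 0" "norm x > \<delta>"
  then have "(norm x)\<^sup>2 / \<delta>\<^sup>2 > 1" by (simp add: power_strict_mono)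
  then show ?thesis by (simp add: mollifier_def mollifier_profile_def deriv_cap_mass_eq_0)
qed

lemma mollifier_minus: "mollifier \<delta> (- x) = mollifier \<delta> x"
  by (simp add: mollifier_def)

lemma continuous_on_mollifier: "continuous_on A (mollifier \<delta>)"
  unfolding mollifier_def[abs_def] mollifier_profile_def divide_inverse[of _ "pi * _"]
  by (intro continuous_on_mult continuous_on_const continuous_on_smooth1_radial smooth1_deriv_mem smooth1_cap_mass)

lemma integrable_mollifier: "\<delta> > 0 \<Longrightarrow> integrable lborel (mollifier \<delta>)"
  by (rule integrable_continuous_support[where R = \<delta>]) (auto intro: continuous_on_mollifier mollifier_eq_0)

lemma integral_mollifier:
  assumes "0 < \<delta>" "\<delta> \<le> 1"
  shows "integral\<^sup>L lborel (mollifier \<delta>) = 1"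
proof -
  define P where "P t = cap_mass (t / \<delta>\<^sup>2) / pi" for t
  have smooth: "mollifier_profile \<delta> \<in> smooth1"
  proof -
    have "(\<lambda>t. inverse (pi * \<delta>\<^sup>2) * deriv cap_mass (t / \<delta>\<^sup>2)) \<in> smooth1"
      by (rule smooth1_cmult[OF smooth1_scale[OF smooth1_deriv_mem[OF smooth1_cap_mass]]])
    moreover have "mollifier_profile \<delta> = (\<lambda>t. inverse (pi * \<delta>\<^sup>2) * deriv cap_mass (t / \<delta>\<^sup>2))"
      by (rule ext) (simp add: mollifier_profile_def divide_inverse mult.commute)
    ultimately show ?thesis by (simp only:)
  qed
  obtain L where L: "\<And>s t. 0 \<le> s \<Longrightarrow> s \<le> t \<Longrightarrow> t \<le> 1 \<Longrightarrow>
      \<bar>mollifier_profile \<delta> t - mollifier_profile \<delta> s\<bar> \<le> L * (t - s)"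
    using smooth1_Lipschitz[OF smooth] by blast
  have "(P has_real_derivative mollifier_profile \<delta> t) (at t)" for t
  proof -
    have "(P has_real_derivative deriv cap_mass (t / \<delta>\<^sup>2) / \<delta>\<^sup>2 / pi) (at t)"
      unfolding P_def[abs_def] by (rule DERIV_cdivide[OF DERIV_scale[OF smooth1_DERIV[OF smooth1_cap_mass]]])
    then show ?thesis by (simp add: mollifier_profile_def mult.commute)
  qed
  then have "(\<integral>x. mollifier_profile \<delta> ((norm (x::real^2))\<^sup>2) \<partial>lborel) = pi * (P 1 - P 0)"
  proof (rule integral_radial_plane[OF _ L smooth1_continuous_on[OF smooth]])
    fix t :: real assume "t > 1"
    moreover have "\<delta>\<^sup>2 \<le> 1" using assms by (simp add: power_le_one)
    ultimately have "t / \<delta>\<^sup>2 > 1" using assms by (simp add: field_simps)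
    then show "mollifier_profile \<delta> t = 0" by (simp add: mollifier_profile_def deriv_cap_mass_eq_0)
  qed
  moreover have "1 / \<delta>\<^sup>2 \<ge> 1" using assms by (simp add: power_le_one)
  ultimately show ?thesis
    by (simp add: mollifier_def[abs_def] P_def cap_mass_eq_0 cap_mass_eq_1)
qed

lemma GDERIV_log_kernel: "GDERIV (log_kernel \<delta>) x :> log_grad \<delta> x"
proof -
  have "(\<lambda>h. 2 * ((x - 0) \<bullet> h) * (reg_log' ((norm (x - 0))\<^sup>2 / \<delta>\<^sup>2) / (4 * pi * \<delta>\<^sup>2)))
      = (\<lambda>h. h \<bullet> log_grad \<delta> x)"
    by (rule ext) (simp add: log_grad_def inner_commute mult.assoc mult.commute[of "_ \<bullet> _"])
  with has_derivative_radial[where a = 0 and x = x, OF DERIV_log_profile[of \<delta>]] show ?thesis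
    by (simp only: gderiv_def log_kernel_def[abs_def] diff_zero)
qed

lemma log_grad_minus: "log_grad \<delta> (- x) = - log_grad \<delta> x"
  by (simp add: log_grad_def)

lemma inner_log_grad:
  assumes "\<delta> > 0"
  shows "x \<bullet> log_grad \<delta> x = cap_mass ((norm x)\<^sup>2 / \<delta>\<^sup>2) / (2 * pi)"
  using assms
  by (cases "x = 0") (auto simp: log_grad_def reg_log'_def cap_mass_eq_0 field_simps dot_square_norm)

lemma norm_log_grad:
  assumes "\<delta> > 0"
  shows "norm (log_grad \<delta> x) = cap_mass ((norm x)\<^sup>2 / \<delta>\<^sup>2) / (2 * pi) / norm x"
proof (cases "x = 0")
  case False
  have "norm (log_grad \<delta> x) = reg_log' ((norm x)\<^sup>2 / \<delta>\<^sup>2) / (2 * pi * \<delta>\<^sup>2) * norm x"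
    using cap_mass_nonneg by (simp add: log_grad_def reg_log'_def)
  also have "\<dots> = cap_mass ((norm x)\<^sup>2 / \<delta>\<^sup>2) / (2 * pi) / norm x"
    using False assms by (simp add: reg_log'_def field_simps power2_eq_square)
  finally show ?thesis .
qed (simp add: log_grad_def)

text \<open>The second bound holds because the gradient vanishes for \<open>|x| < \<delta> / 2\<close>.\<close>

lemma norm_log_grad_le:
  assumes "\<delta> > 0"
  shows "norm (log_grad \<delta> x) \<le> 1 / norm x" and "norm (log_grad \<delta> x) \<le> 2 / \<delta>"
    and "norm (log_grad \<delta> x) * norm x \<le> 1 / (2 * pi)"
proof -
  have pi: "2 * pi \<ge> 1" using pi_gt3 by linarith
  have c: "cap_mass ((norm x)\<^sup>2 / \<delta>\<^sup>2) / (2 * pi) \<le> 1"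
    using cap_mass_le_1[of "(norm x)\<^sup>2 / \<delta>\<^sup>2"] pi by (simp add: field_simps)
  show 1: "norm (log_grad \<delta> x) \<le> 1 / norm x"
    unfolding norm_log_grad[OF assms] by (intro divide_right_mono c) auto
  show "norm (log_grad \<delta> x) \<le> 2 / \<delta>"
  proof (cases "norm x \<ge> \<delta> / 2")
    case True
    then have "1 / norm x \<le> 1 / (\<delta> / 2)" using assms by (intro frac_le) auto
    then show ?thesis using 1 by simp
  next
    case False
    then have "(norm x)\<^sup>2 \<le> (\<delta> / 2)\<^sup>2" by (intro power_mono) auto
    then have "4 * (norm x)\<^sup>2 \<le> \<delta>\<^sup>2" by (simp add: power_divide)
    then have "2 * (norm x)\<^sup>2 \<le> \<delta>\<^sup>2" using zero_le_power2[of "norm x"] by linarith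
    then have "(norm x)\<^sup>2 / \<delta>\<^sup>2 \<le> 1 / 2" using assms by (simp add: field_simps)
    then show ?thesis using assms by (simp add: norm_log_grad cap_mass_eq_0)
  qed
  show "norm (log_grad \<delta> x) * norm x \<le> 1 / (2 * pi)"
    using cap_mass_le_1[of "(norm x)\<^sup>2 / \<delta>\<^sup>2"]
    by (cases "x = 0") (auto simp: norm_log_grad[OF assms] divide_right_mono)
qed

lemma continuous_on_log_grad: "continuous_on A (log_grad \<delta>)"
  unfolding log_grad_def[abs_def] divide_inverse[of _ "2 * pi * _"]
  by (intro continuous_on_scaleR continuous_on_mult continuous_on_const continuous_on_id
      continuous_on_smooth1_radial smooth1_reg_log')

lemma continuous_on_log_kernel: "continuous_on A (log_kernel \<delta>)"
  by (rule GDERIV_continuous_on[OF GDERIV_log_kernel])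

definition mollifier_grad :: "real \<Rightarrow> real^2 \<Rightarrow> real^2" where
  "mollifier_grad \<delta> x = (2 * (deriv (deriv cap_mass) ((norm x)\<^sup>2 / \<delta>\<^sup>2) / \<delta>\<^sup>2 / (pi * \<delta>\<^sup>2))) *\<^sub>R x"

lemma GDERIV_mollifier: "GDERIV (mollifier \<delta>) x :> mollifier_grad \<delta> x"
proof -
  define q where "q t = deriv (deriv cap_mass) (t / \<delta>\<^sup>2) / \<delta>\<^sup>2 / (pi * \<delta>\<^sup>2)" for t
  have q: "(mollifier_profile \<delta> has_real_derivative q t) (at t)" for t
    unfolding mollifier_profile_def[abs_def] q_def
    by (rule DERIV_cdivide[OF DERIV_scale[OF smooth1_DERIV[OF smooth1_deriv_mem[OF smooth1_cap_mass]]]])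
  have "(\<lambda>h. 2 * ((x - 0) \<bullet> h) * q ((norm (x - 0))\<^sup>2)) = (\<lambda>h. h \<bullet> mollifier_grad \<delta> x)"
    by (rule ext) (simp add: mollifier_grad_def q_def inner_commute)
  with has_derivative_radial[where a = 0 and x = x, OF q] show ?thesis
    by (simp only: gderiv_def mollifier_def[abs_def] diff_zero)
qed

lemma continuous_on_mollifier_grad: "continuous_on A (mollifier_grad \<delta>)"
  unfolding mollifier_grad_def[abs_def] divide_inverse[of _ "pi * _"]
    divide_inverse[of "deriv (deriv cap_mass) _"]
  by (intro continuous_on_scaleR continuous_on_mult continuous_on_const continuous_on_id
      continuous_on_smooth1_radial smooth1_deriv_mem smooth1_cap_mass)

lemma mollifier_grad_eq_0:
  assumes "\<delta> > 0" "norm x > \<delta>"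
  shows "mollifier_grad \<delta> x = 0"
  by (rule GDERIV_zero_outside[OF GDERIV_mollifier mollifier_eq_0[OF assms(1)] assms(2)])

lemma mollifier_grad_bounded:
  assumes "\<delta> > 0"
  obtains M where "\<And>x. norm (mollifier_grad \<delta> x) \<le> M"
  using bounded_if_compact_support[OF continuous_on_mollifier_grad mollifier_grad_eq_0[OF assms]] that
  by blast

text \<open>The positive second moment makes \<open>|x|\<^sup>2\<close> strictly subharmonic with respect to mollification,
  as the minimum principle requires.\<close>

lemma mollifier_moments:
  assumes "0 < \<delta>" "\<delta> \<le> 1"
  shows "(\<integral>u. (a \<bullet> u) * mollifier \<delta> u \<partial>lborel) = 0"
    and "(\<integral>u. (norm u)\<^sup>2 * mollifier \<delta> u \<partial>lborel) > 0"
    and "integrable lborel (\<lambda>u. (a \<bullet> u) * mollifier \<delta> u)"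
    and "integrable lborel (\<lambda>u. (norm u)\<^sup>2 * mollifier \<delta> u)"
proof -
  have c: "continuous_on UNIV (\<lambda>u. (a \<bullet> u) * mollifier \<delta> u)" "continuous_on UNIV (\<lambda>u. (norm u)\<^sup>2 * mollifier \<delta> u)"
    by (intro continuous_on_mult continuous_on_mollifier continuous_intros)+
  show i1: "integrable lborel (\<lambda>u. (a \<bullet> u) * mollifier \<delta> u)"
    by (rule integrable_continuous_support[OF c(1), of \<delta>]) (simp add: mollifier_eq_0 assms)
  show i2: "integrable lborel (\<lambda>u. (norm u)\<^sup>2 * mollifier \<delta> u)"
    by (rule integrable_continuous_support[OF c(2), of \<delta>]) (simp add: mollifier_eq_0 assms)
  have "(\<integral>u. (a \<bullet> (0 - u)) * mollifier \<delta> (0 - u) \<partial>lborel) = (\<integral>u. (a \<bullet> u) * mollifier \<delta> u \<partial>lborel)"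
    by (rule integral_lborel_reflect(1)[OF borel_measurable_continuous_onI[OF c(1)]])
  then show "(\<integral>u. (a \<bullet> u) * mollifier \<delta> u \<partial>lborel) = 0"
    by (simp add: mollifier_minus)
  have nn: "AE u in lborel. 0 \<le> (norm u)\<^sup>2 * mollifier \<delta> u"
    by (simp add: mollifier_nonneg)
  have "(\<integral>u. (norm u)\<^sup>2 * mollifier \<delta> u \<partial>lborel) \<noteq> 0"
  proof
    assume "(\<integral>u. (norm u)\<^sup>2 * mollifier \<delta> u \<partial>lborel) = 0"
    then have "AE u in lborel. (norm u)\<^sup>2 * mollifier \<delta> u = 0"
      using integral_nonneg_eq_0_iff_AE[OF i2 nn] by simp
    moreover have "AE u in lborel. u \<noteq> (0::real^2)" by (rule AE_lborel_singleton)
    ultimately have "AE u in lborel. mollifier \<delta> u = 0" by eventually_elim auto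
    then have "integral\<^sup>L lborel (mollifier \<delta>) = (\<integral>u. 0 \<partial>(lborel :: (real^2) measure))"
      using integrable_mollifier[OF assms(1)] by (intro integral_cong_AE) auto
    then show False using integral_mollifier[OF assms] by simp
  qed
  moreover have "(\<integral>u. (norm u)\<^sup>2 * mollifier \<delta> u \<partial>lborel) \<ge> 0"
    by (rule integral_nonneg_AE[OF nn])
  ultimately show "(\<integral>u. (norm u)\<^sup>2 * mollifier \<delta> u \<partial>lborel) > 0" by linarith
qed

section \<open>A Poisson equation on the unit disc\<close>

lemma GDERIV_radial:
  fixes a :: "'a::euclidean_space"
  assumes "(Q has_real_derivative q) (at ((norm (x - a))\<^sup>2))"
  shows "GDERIV (\<lambda>x. Q ((norm (x - a))\<^sup>2)) x :> (2 * q) *\<^sub>R (x - a)"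
proof -
  have "(\<lambda>h. 2 * ((x - a) \<bullet> h) * q) = (\<lambda>h. h \<bullet> (2 * q) *\<^sub>R (x - a))"
    by (rule ext) (simp add: inner_commute)
  with has_derivative_radial[OF assms] show ?thesis by (simp only: gderiv_def)
qed

lemma continuous_on_radial:
  assumes "continuous_on UNIV (Q :: real \<Rightarrow> real)"
  shows "continuous_on UNIV (\<lambda>x. Q ((norm (x - a))\<^sup>2))"
  by (rule continuous_on_compose2[OF assms])
     (auto intro!: continuous_on_power continuous_on_norm continuous_on_diff continuous_on_id continuous_on_const)

lemma norm_diff_gt:
  fixes a :: "'a::real_normed_vector"
  shows "norm x > norm a + R \<Longrightarrow> norm (x - a) > R"
  using norm_triangle_ineq2[of x a] by linarith

lemma radial_laplacian_support:
  fixes Q Q' Q'' :: "real \<Rightarrow> real"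
  assumes Q': "\<And>t. (Q has_real_derivative Q' t) (at t)" and Q'': "\<And>t. (Q' has_real_derivative Q'' t) (at t)"
    and supp: "\<And>t. t \<ge> r \<Longrightarrow> Q t = 0" and t: "t > r"
  shows "Q' t = 0" "Q'' t = 0"
proof -
  have Q'0: "Q' t = 0" if "t > r" for t
    by (rule GDERIV_zero_if_locally_zero[where f = Q and x = t and S = "{r<..}"]) (use that supp Q' in auto)
  show "Q' t = 0" using Q'0 t .
  show "Q'' t = 0"
    by (rule GDERIV_zero_if_locally_zero[where f = Q' and x = t and S = "{r<..}"]) (use t Q'0 Q'' in auto)
qed

text \<open>Euler's identity for \<open>2 Q'(|x - a|\<^sup>2)\<close>.\<close>

lemma integral_radial_laplacian:
  fixes Q' Q'' :: "real \<Rightarrow> real" and a :: "real^2"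
  assumes Q': "Q' \<in> smooth1" and Q'': "\<And>t. (Q' has_real_derivative Q'' t) (at t)"
    and R: "R \<ge> 0" and Q'0: "\<And>t. t > R\<^sup>2 \<Longrightarrow> Q' t = 0"
  shows "(\<integral>x. 4 * Q' ((norm (x - a))\<^sup>2) + 4 * (norm (x - a))\<^sup>2 * Q'' ((norm (x - a))\<^sup>2) \<partial>lborel) = 0"
    and "integrable lborel (\<lambda>x. 4 * Q' ((norm (x - a))\<^sup>2))"
    and "integrable lborel (\<lambda>x. 4 * (norm (x - a))\<^sup>2 * Q'' ((norm (x - a))\<^sup>2))"
proof -
  have "deriv Q' = Q''" using DERIV_imp_deriv[OF Q''] by (rule ext)
  then have Q''s: "Q'' \<in> smooth1" using smooth1_deriv_mem[OF Q'] by simp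
  have Q''0: "Q'' t = 0" if "t > R\<^sup>2" for t
    by (rule GDERIV_zero_if_locally_zero[where f = Q' and x = t and S = "{R\<^sup>2<..}"]) (use that Q'0 Q'' in auto)
  let ?Y = "\<lambda>x. Q' ((norm (x - a))\<^sup>2)" and ?G = "\<lambda>x. (2 * Q'' ((norm (x - a))\<^sup>2)) *\<^sub>R (x - a)"
  have far: "(norm (x - a))\<^sup>2 > R\<^sup>2" if "norm x > norm a + R" for x
    using norm_diff_gt[OF that] R by (simp add: power_strict_mono)
  have cY: "continuous_on UNIV ?Y" by (rule continuous_on_radial[OF smooth1_continuous_on[OF Q']])
  have cQ'': "continuous_on UNIV (\<lambda>x. Q'' ((norm (x - a))\<^sup>2))"
    by (rule continuous_on_radial[OF smooth1_continuous_on[OF Q''s]])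
  have E: "(\<integral>x. (x - a) \<bullet> ?G x \<partial>lborel) = - real DIM(real^2) * integral\<^sup>L lborel ?Y"
  proof (rule integral_Euler_identity)
    show "GDERIV ?Y x :> ?G x" for x by (rule GDERIV_radial[OF Q''])
    show "continuous_on UNIV ?G"
      by (intro continuous_on_scaleR continuous_on_mult cQ'' continuous_on_const continuous_on_diff continuous_on_id)
    show "?Y x = 0" if "norm x > norm a + R" for x using far[OF that] Q'0 by blast
  qed
  show i1: "integrable lborel (\<lambda>x. 4 * ?Y x)"
    by (rule integrable_continuous_support[of _ "norm a + R"])
       (use far Q'0 in \<open>auto intro!: continuous_on_mult cY continuous_on_const\<close>)
  show i2: "integrable lborel (\<lambda>x. 4 * (norm (x - a))\<^sup>2 * Q'' ((norm (x - a))\<^sup>2))"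
    by (rule integrable_continuous_support[of _ "norm a + R"])
       (use far Q''0 in \<open>auto intro!: continuous_on_mult cQ'' continuous_on_const continuous_on_power
          continuous_on_norm continuous_on_diff continuous_on_id\<close>)
  have "(\<lambda>x. 4 * (norm (x - a))\<^sup>2 * Q'' ((norm (x - a))\<^sup>2)) = (\<lambda>x. 2 * ((x - a) \<bullet> ?G x))"
    by (rule ext) (simp add: power2_norm_eq_inner)
  then have "(\<integral>x. 4 * (norm (x - a))\<^sup>2 * Q'' ((norm (x - a))\<^sup>2) \<partial>lborel) = 2 * (\<integral>x. (x - a) \<bullet> ?G x \<partial>lborel)"
    by (simp only: integral_mult_right_zero)
  also have "\<dots> = - (\<integral>x. 4 * ?Y x \<partial>lborel)"
    unfolding E by simp
  finally show "(\<integral>x. 4 * ?Y x + 4 * (norm (x - a))\<^sup>2 * Q'' ((norm (x - a))\<^sup>2) \<partial>lborel) = 0"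
    by (simp only: Bochner_Integration.integral_add[OF i1 i2])
qed

text \<open>The constant \<open>c\<close> is free; it will be the minimum of \<open>v\<close> on the circle. Subtracting it makes the
  estimates depend on the oscillation of the boundary values only.\<close>

locale disc_poisson =
  fixes v f :: "real^2 \<Rightarrow> real" and c :: real
  assumes v_cont: "continuous_on (cball 0 1) v"
    and f_cont: "continuous_on (cball 0 1) f"
    and f_nonneg: "\<And>x. x \<in> cball 0 1 \<Longrightarrow> f x \<ge> 0"
    and sol: "poisson_solution_on (ball 0 1) v f"
begin

text \<open>\<open>v - c\<close> and \<open>f\<close> extended by zero, so that all integrals range over the plane.\<close>

definition V :: "real^2 \<Rightarrow> real" where
  "V x = indicator (ball 0 1) x * (v x - c)"

definition F :: "real^2 \<Rightarrow> real" where
  "F x = indicator (ball 0 1) x * f x"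

lemma V_eq: "norm x < 1 \<Longrightarrow> V x = v x - c" and V_out: "norm x \<ge> 1 \<Longrightarrow> V x = 0"
  and F_eq: "norm x < 1 \<Longrightarrow> F x = f x" and F_out: "norm x \<ge> 1 \<Longrightarrow> F x = 0"
  by (auto simp: V_def F_def)

lemma F_nonneg: "F x \<ge> 0"
  using f_nonneg[of x] by (auto simp: F_def indicator_def)

lemma indicator_disc_continuous:
  fixes g :: "real^2 \<Rightarrow> real"
  assumes "continuous_on (cball 0 1) g"
  shows "(\<lambda>x. indicator (ball 0 1) x * g x) \<in> borel_measurable borel"
    and "\<exists>M. \<forall>x. \<bar>indicator (ball 0 1) x * g x\<bar> \<le> M"
proof -
  have "(\<lambda>x. indicator (ball 0 1) x *\<^sub>R g x) \<in> borel_measurable borel"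
    by (rule borel_measurable_continuous_on_indicator) (auto intro: continuous_on_subset[OF assms])
  then show "(\<lambda>x. indicator (ball 0 1) x * g x) \<in> borel_measurable borel" by simp
  have "compact (g ` cball 0 1)" by (intro compact_continuous_image assms) auto
  then obtain M where M: "\<And>x. x \<in> cball 0 1 \<Longrightarrow> \<bar>g x\<bar> \<le> M"
    using compact_imp_bounded bounded_iff by (metis imageI real_norm_def)
  have "\<bar>indicator (ball 0 1) x * g x\<bar> \<le> max M 0" for x
    using M[of x] by (cases "x \<in> ball 0 1") (auto simp: le_max_iff_disj)
  then show "\<exists>M. \<forall>x. \<bar>indicator (ball 0 1) x * g x\<bar> \<le> M" by blast
qed

lemma V_measurable [measurable]: "V \<in> borel_measurable borel"
  and V_bounded: "\<exists>M. \<forall>x. \<bar>V x\<bar> \<le> M"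
  unfolding V_def[abs_def]
  by (rule indicator_disc_continuous; intro continuous_on_diff v_cont continuous_on_const)+

lemma F_measurable [measurable]: "F \<in> borel_measurable borel"
  and F_bounded: "\<exists>M. \<forall>x. \<bar>F x\<bar> \<le> M"
  unfolding F_def[abs_def]
  by (rule indicator_disc_continuous[OF f_cont])+

lemma V_integrable: "integrable lborel V"
proof -
  obtain M where "\<And>x. \<bar>V x\<bar> \<le> M" using V_bounded by blast
  then show ?thesis by (intro integrable_bounded_support[of V M 1]) (auto simp: V_out)
qed

lemma F_integrable: "integrable lborel F"
proof -
  obtain M where "\<And>x. \<bar>F x\<bar> \<le> M" using F_bounded by blast
  then show ?thesis by (intro integrable_bounded_support[of F M 1]) (auto simp: F_out)
qed

lemma integrable_mult_continuous:
  assumes "integrable lborel (U :: real^2 \<Rightarrow> real)" "\<And>x. norm x \<ge> 1 \<Longrightarrow> U x = 0" "continuous_on UNIV g"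
  shows "integrable lborel (\<lambda>x. U x * g x)"
proof -
  have "continuous_on UNIV (\<lambda>x. g (- x))"
    by (rule continuous_on_compose2[OF assms(3)]) (auto intro!: continuous_on_minus continuous_on_id)
  from convolution_kernel_integrable[OF assms(1) _ this, of 1 0] assms(2)
  show ?thesis by simp
qed

text \<open>Passing from \<open>v\<close> to \<open>v - c\<close> costs nothing, since the Laplacian of a radial test function has
  integral zero.\<close>

lemma radial_test:
  fixes Q Q' Q'' :: "real \<Rightarrow> real"
  assumes Q: "Q \<in> smooth1" and Q': "\<And>t. (Q has_real_derivative Q' t) (at t)"
    and Q'': "\<And>t. (Q' has_real_derivative Q'' t) (at t)"
    and R: "R \<ge> 0" "norm a + R < 1" and supp: "\<And>t. t \<ge> R\<^sup>2 \<Longrightarrow> Q t = 0"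
  shows "(\<integral>x. V x * (4 * Q' ((norm (x - a))\<^sup>2) + 4 * (norm (x - a))\<^sup>2 * Q'' ((norm (x - a))\<^sup>2)) \<partial>lborel)
       = - (\<integral>x. F x * Q ((norm (x - a))\<^sup>2) \<partial>lborel)"
proof -
  let ?J = "\<lambda>x. 4 * Q' ((norm (x - a))\<^sup>2) + 4 * (norm (x - a))\<^sup>2 * Q'' ((norm (x - a))\<^sup>2)"
  have dQ: "deriv Q = Q'" using DERIV_imp_deriv[OF Q'] by (rule ext)
  then have Q's: "Q' \<in> smooth1" using smooth1_deriv_mem[OF Q] by simp
  have "deriv Q' = Q''" using DERIV_imp_deriv[OF Q''] by (rule ext)
  then have Q''s: "Q'' \<in> smooth1" using smooth1_deriv_mem[OF Q's] by simp
  note zero = radial_laplacian_support[OF Q' Q'' supp]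
  have J_cont: "continuous_on UNIV ?J"
    by (intro continuous_on_add continuous_on_mult continuous_on_const continuous_on_power
        continuous_on_norm continuous_on_diff continuous_on_id continuous_on_radial
        smooth1_continuous_on Q's Q''s)
  have J0: "?J x = 0" if "norm x \<ge> 1" for x
  proof -
    have "norm (x - a) > R" using that R norm_diff_gt[of a R x] by linarith
    then have "(norm (x - a))\<^sup>2 > R\<^sup>2" using R by (simp add: power_strict_mono)
    then show ?thesis using zero by simp
  qed
  have int_J: "integral\<^sup>L lborel ?J = 0"
    by (rule integral_radial_laplacian(1)[OF Q's Q'' R(1)]) (rule zero(1))
  have J_int: "integrable lborel ?J"
    by (rule integrable_continuous_support[OF J_cont, of 1]) (use J0 in auto)
  have "- (LINT x:ball 0 1|lborel. v x * ?J x) = (LINT x:ball 0 1|lborel. f x * Q ((norm (x - a))\<^sup>2))"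
  proof -
    have "cball a R \<subseteq> ball 0 1"
    proof
      fix x assume "x \<in> cball a R"
      then have "norm (x - a) \<le> R" by (simp add: dist_norm norm_minus_commute)
      then show "x \<in> ball 0 1" using norm_triangle_ineq2[of x a] R by simp
    qed
    from poisson_radial_test[OF sol Q Q' Q'' R(1) supp this]
    show ?thesis by (simp add: mult.assoc)
  qed
  moreover have "(LINT x:ball 0 1|lborel. f x * Q ((norm (x - a))\<^sup>2)) = (\<integral>x. F x * Q ((norm (x - a))\<^sup>2) \<partial>lborel)"
    unfolding set_lebesgue_integral_def
    by (rule Bochner_Integration.integral_cong) (auto simp: F_def indicator_def)
  moreover have "(LINT x:ball 0 1|lborel. v x * ?J x) = (\<integral>x. V x * ?J x \<partial>lborel)"
  proof -
    have "(LINT x:ball 0 1|lborel. v x * ?J x) = (\<integral>x. V x * ?J x + c * ?J x \<partial>lborel)"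
      unfolding set_lebesgue_integral_def
    proof (rule Bochner_Integration.integral_cong)
      fix x :: "real^2"
      show "indicator (ball 0 1) x *\<^sub>R (v x * ?J x) = V x * ?J x + c * ?J x"
      proof (cases "norm x < 1")
        case False
        then show ?thesis using J0[of x] by (simp add: V_out)
      qed (simp add: V_eq left_diff_distrib del: distrib_left_numeral)
    qed simp
    also have "\<dots> = (\<integral>x. V x * ?J x \<partial>lborel) + c * integral\<^sup>L lborel ?J"
      by (subst Bochner_Integration.integral_add)
         (auto intro!: integrable_mult_continuous V_integrable V_out J_cont J_int simp: integral_mult_right_zero
             simp del: distrib_left_numeral)
    finally show ?thesis using int_J by simp
  qed
  ultimately show ?thesis by simp
qed

definition Vm :: "real \<Rightarrow> real^2 \<Rightarrow> real" where
  "Vm \<delta> x = (\<integral>y. V y * mollifier \<delta> (x - y) \<partial>lborel)"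

definition Fl :: "real \<Rightarrow> real^2 \<Rightarrow> real" where
  "Fl \<delta> x = (\<integral>y. F y * log_kernel \<delta> (x - y) \<partial>lborel)"

lemma V_mollifier_integrable: "integrable lborel (\<lambda>y. V y * mollifier \<delta> (x - y))"
  using convolution_kernel_integrable[OF V_integrable _ continuous_on_mollifier, of 1 \<delta> x] V_out by simp

lemma F_log_kernel_integrable: "integrable lborel (\<lambda>y. F y * log_kernel \<delta> (x - y))"
  using convolution_kernel_integrable[OF F_integrable _ continuous_on_log_kernel, of 1 \<delta> x] F_out by simp

text \<open>The difference of two regularised logarithms vanishes outside the larger scale and is thus a test
  function; its Laplacian is the difference of the two mollifiers. The common value of both sides is
  the harmonic part of \<open>v - c\<close>.\<close>

lemma mollified_representation:
  assumes "0 < \<delta>" "\<delta> \<le> \<eta>" "norm x + \<eta> < 1"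
  shows "Vm \<delta> x + Fl \<delta> x = Vm \<eta> x + Fl \<eta> x"
proof -
  have \<eta>: "\<eta> > 0" using assms by simp
  obtain p where p: "\<And>t. ((\<lambda>t. reg_log' (t / \<delta>\<^sup>2) / (4 * pi * \<delta>\<^sup>2)) has_real_derivative p t) (at t)"
    "\<And>t. 4 * (reg_log' (t / \<delta>\<^sup>2) / (4 * pi * \<delta>\<^sup>2)) + 4 * t * p t = mollifier_profile \<delta> t"
    using log_profile_laplacian[OF assms(1)] by metis
  obtain q where q: "\<And>t. ((\<lambda>t. reg_log' (t / \<eta>\<^sup>2) / (4 * pi * \<eta>\<^sup>2)) has_real_derivative q t) (at t)"
    "\<And>t. 4 * (reg_log' (t / \<eta>\<^sup>2) / (4 * pi * \<eta>\<^sup>2)) + 4 * t * q t = mollifier_profile \<eta> t"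
    using log_profile_laplacian[OF \<eta>] by metis
  let ?Q = "\<lambda>t. log_profile \<delta> t + (- 1) * log_profile \<eta> t"
  let ?Q' = "\<lambda>t. reg_log' (t / \<delta>\<^sup>2) / (4 * pi * \<delta>\<^sup>2) - reg_log' (t / \<eta>\<^sup>2) / (4 * pi * \<eta>\<^sup>2)"
  have "(\<integral>y. V y * (4 * ?Q' ((norm (y - x))\<^sup>2) + 4 * (norm (y - x))\<^sup>2 * (p ((norm (y - x))\<^sup>2) - q ((norm (y - x))\<^sup>2))) \<partial>lborel)
     = - (\<integral>y. F y * ?Q ((norm (y - x))\<^sup>2) \<partial>lborel)"
  proof (rule radial_test)
    show "?Q \<in> smooth1"
      by (intro smooth1.smooth1_add smooth1_log_profile smooth1_cmult)
    show "(?Q has_real_derivative ?Q' t) (at t)" for t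
      using DERIV_diff[OF DERIV_log_profile[of \<delta> t] DERIV_log_profile[of \<eta> t]] by simp
    show "(?Q' has_real_derivative p t - q t) (at t)" for t
      by (rule DERIV_diff[OF p(1) q(1)])
    show "?Q t = 0" if "t \<ge> \<eta>\<^sup>2" for t
    proof -
      have "\<delta>\<^sup>2 \<le> \<eta>\<^sup>2" using assms by (intro power_mono) auto
      then have "t \<ge> \<delta>\<^sup>2" using that by simp
      then show ?thesis using that assms(1) \<eta> by (simp add: log_profile_far)
    qed
  qed (use assms in auto)
  moreover have "4 * ?Q' t + 4 * t * (p t - q t) = mollifier_profile \<delta> t - mollifier_profile \<eta> t" for t
    unfolding p(2)[symmetric] q(2)[symmetric] by (simp add: algebra_simps)
  ultimately have "(\<integral>y. V y * (mollifier_profile \<delta> ((norm (y - x))\<^sup>2) - mollifier_profile \<eta> ((norm (y - x))\<^sup>2)) \<partial>lborel)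
     = - (\<integral>y. F y * (log_profile \<delta> ((norm (y - x))\<^sup>2) - log_profile \<eta> ((norm (y - x))\<^sup>2)) \<partial>lborel)"
    by simp
  then have "(\<integral>y. V y * mollifier \<delta> (x - y) - V y * mollifier \<eta> (x - y) \<partial>lborel)
     = - (\<integral>y. F y * log_kernel \<delta> (x - y) - F y * log_kernel \<eta> (x - y) \<partial>lborel)"
    by (simp only: mollifier_def log_kernel_def norm_minus_commute[of x] right_diff_distrib)
  then show ?thesis
    unfolding Vm_def Fl_def
    by (simp add: Bochner_Integration.integral_diff[OF V_mollifier_integrable V_mollifier_integrable]
        Bochner_Integration.integral_diff[OF F_log_kernel_integrable F_log_kernel_integrable])
qed

lemma mollifier_shift:
  assumes "0 < \<delta>" "\<delta> \<le> 1"
  shows "integrable lborel (\<lambda>y. mollifier \<delta> (x - y))" "(\<integral>y. mollifier \<delta> (x - y) \<partial>lborel) = 1"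
  using integral_lborel_reflect[OF borel_measurable_continuous_onI[OF continuous_on_mollifier], of \<delta> x]
    integrable_mollifier integral_mollifier assms by auto

lemma Vm_converges:
  assumes "r < 1" "e > 0"
  shows "\<exists>\<delta>0>0. \<forall>\<delta> x. 0 < \<delta> \<longrightarrow> \<delta> \<le> \<delta>0 \<longrightarrow> norm x \<le> r \<longrightarrow> \<bar>Vm \<delta> x - (v x - c)\<bar> \<le> e"
proof -
  have "uniformly_continuous_on (cball 0 1) v"
    by (rule compact_uniformly_continuous[OF v_cont]) simp
  then obtain d where d: "d > 0" "\<And>x y. x \<in> cball 0 1 \<Longrightarrow> y \<in> cball 0 1 \<Longrightarrow> dist y x < d \<Longrightarrow> dist (v y) (v x) < e"
    unfolding uniformly_continuous_on_def using assms(2) by metis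
  define \<delta>0 where "\<delta>0 = min (min ((1 - r) / 2) (d / 2)) 1"
  have "\<delta>0 \<le> (1 - r) / 2" "\<delta>0 \<le> d / 2" "\<delta>0 \<le> 1" unfolding \<delta>0_def by linarith+
  moreover have "\<delta>0 > 0" using assms d(1) by (auto simp: \<delta>0_def)
  ultimately have \<delta>0: "\<delta>0 > 0" "\<delta>0 < 1 - r" "\<delta>0 < d" "\<delta>0 \<le> 1" using assms d(1) by auto
  show ?thesis
  proof (intro exI[of _ \<delta>0] conjI allI impI)
    fix \<delta> and x :: "real^2" assume *: "0 < \<delta>" "\<delta> \<le> \<delta>0" "norm x \<le> r"
    have \<delta>1: "\<delta> \<le> 1" using * \<delta>0 by simp
    note m = mollifier_shift[OF *(1) \<delta>1, of x]
    have "Vm \<delta> x - (v x - c) = (\<integral>y. V y * mollifier \<delta> (x - y) \<partial>lborel) - (\<integral>y. (v x - c) * mollifier \<delta> (x - y) \<partial>lborel)"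
      using m by (simp add: Vm_def)
    also have "\<dots> = (\<integral>y. V y * mollifier \<delta> (x - y) - (v x - c) * mollifier \<delta> (x - y) \<partial>lborel)"
      by (rule Bochner_Integration.integral_diff[symmetric]) (use V_mollifier_integrable m in auto)
    also have "norm \<dots> \<le> (\<integral>y. e * mollifier \<delta> (x - y) \<partial>lborel)"
    proof (rule Bochner_Integration.integral_norm_bound_integral)
      fix y
      show "norm (V y * mollifier \<delta> (x - y) - (v x - c) * mollifier \<delta> (x - y)) \<le> e * mollifier \<delta> (x - y)"
      proof (cases "norm (x - y) > \<delta>")
        case True
        then show ?thesis using *(1) by (simp add: mollifier_eq_0)
      next
        case False
        then have "norm y < 1" using norm_triangle_ineq2[of y x] * \<delta>0 by (simp add: norm_minus_commute)
        moreover have "norm x < 1" using *(3) assms by simp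
        moreover have "dist y x < d" using False * \<delta>0 by (simp add: dist_norm norm_minus_commute)
        ultimately have "\<bar>v y - v x\<bar> \<le> e" using d(2)[of x y] by (auto simp: dist_norm)
        then have "\<bar>V y - (v x - c)\<bar> \<le> e" using \<open>norm y < 1\<close> by (simp add: V_eq)
        then have "\<bar>V y - (v x - c)\<bar> * mollifier \<delta> (x - y) \<le> e * mollifier \<delta> (x - y)"
          by (rule mult_right_mono[OF _ mollifier_nonneg])
        then show ?thesis using mollifier_nonneg[of \<delta> "x - y"]
          by (simp add: abs_mult flip: left_diff_distrib)
      qed
    qed (use V_mollifier_integrable m in auto)
    finally show "\<bar>Vm \<delta> x - (v x - c)\<bar> \<le> e" using m by simp
  qed (rule \<delta>0(1))
qed

text \<open>The kernels \<open>log_kernel \<delta>\<close> increase with \<open>\<delta>\<close> and \<open>F \<ge> 0\<close>, so by the representation the mollified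
  solution increases as the scale shrinks to zero.\<close>

lemma super_mean_value:
  assumes "\<eta> > 0" "norm x + \<eta> < 1"
  shows "Vm \<eta> x \<le> v x - c"
proof (rule field_le_epsilon)
  fix e :: real assume "e > 0"
  have "norm x < 1" using assms by simp
  from Vm_converges[OF this \<open>e > 0\<close>] obtain \<delta>0 where
    \<delta>0: "\<delta>0 > 0" "\<And>\<delta>. 0 < \<delta> \<Longrightarrow> \<delta> \<le> \<delta>0 \<Longrightarrow> \<bar>Vm \<delta> x - (v x - c)\<bar> \<le> e" by blast
  define \<delta> where "\<delta> = min \<delta>0 \<eta>"
  have \<delta>: "0 < \<delta>" "\<delta> \<le> \<delta>0" "\<delta> \<le> \<eta>" using \<delta>0 assms by (auto simp: \<delta>_def)
  have "Fl \<delta> x \<le> Fl \<eta> x"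
    unfolding Fl_def
    by (intro integral_mono F_log_kernel_integrable mult_left_mono F_nonneg)
       (simp add: log_kernel_def log_profile_mono \<delta>)
  with mollified_representation[OF \<delta>(1,3) assms(2)] have "Vm \<eta> x \<le> Vm \<delta> x" by linarith
  then show "Vm \<eta> x \<le> v x - c + e" using \<delta>0(2)[OF \<delta>(1,2)] by linarith
qed

text \<open>At an interior minimum of \<open>v - e |x|\<^sup>2\<close> the mean of \<open>v\<close> would exceed its central value by
  at least \<open>e\<close> times the second moment of the mollifier, against the super mean value property.\<close>

lemma minimum_principle:
  assumes bdry: "\<And>x. norm x = 1 \<Longrightarrow> c \<le> v x" and x: "norm x \<le> 1"
  shows "c \<le> v x"
proof (rule field_le_epsilon)
  fix e :: real assume e: "e > 0"
  define z where "z y = v y - c - e * (norm y)\<^sup>2" for y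
  have "continuous_on (cball 0 1) z"
    unfolding z_def by (intro continuous_intros v_cont)
  then obtain x0 where x0: "norm x0 \<le> 1" "\<And>y. norm y \<le> 1 \<Longrightarrow> z x0 \<le> z y"
    using continuous_attains_inf[of "cball 0 1" z] by auto
  have "norm x0 = 1"
  proof (rule ccontr)
    assume "norm x0 \<noteq> 1"
    then have x01: "norm x0 < 1" using x0(1) by simp
    define \<eta> where "\<eta> = (1 - norm x0) / 2"
    have \<eta>: "\<eta> > 0" "\<eta> \<le> 1" "norm x0 + \<eta> < 1" using x01 by (auto simp: \<eta>_def field_simps)
    note m = mollifier_shift[OF \<eta>(1,2), of x0] and mom = mollifier_moments[OF \<eta>(1,2)]
    define \<kappa> where "\<kappa> = (\<integral>u. (norm u)\<^sup>2 * mollifier \<eta> u \<partial>lborel)"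
    \<comment> \<open>the mean of \<open>|x|\<^sup>2\<close> about \<open>x0\<close>; the linear term drops out by symmetry\<close>
    have poly: "(norm (x0 - u))\<^sup>2 * mollifier \<eta> u
        = (norm x0)\<^sup>2 * mollifier \<eta> u - 2 * ((x0 \<bullet> u) * mollifier \<eta> u) + (norm u)\<^sup>2 * mollifier \<eta> u" for u
      unfolding power2_norm_eq_inner by (simp add: inner_diff_left inner_diff_right inner_commute algebra_simps)
    have I: "integrable lborel (\<lambda>u. (norm (x0 - u))\<^sup>2 * mollifier \<eta> u)"
      unfolding poly using mom(3)[of x0] mom(4) integrable_mollifier[OF \<eta>(1)] by auto
    have moment: "(\<integral>u. (norm (x0 - u))\<^sup>2 * mollifier \<eta> u \<partial>lborel) = (norm x0)\<^sup>2 + \<kappa>"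
      unfolding poly \<kappa>_def using mom(1,3)[of x0] mom(4) integrable_mollifier[OF \<eta>(1)] integral_mollifier[OF \<eta>(1,2)]
      by simp
    let ?g = "\<lambda>y. (norm y)\<^sup>2 * mollifier \<eta> (x0 - y)"
    have gm: "?g \<in> borel_measurable borel"
      by (rule borel_measurable_continuous_onI)
         (auto intro!: continuous_intros continuous_on_compose2[OF continuous_on_mollifier[of UNIV]])
    have Ig: "integrable lborel ?g" and Mg: "integral\<^sup>L lborel ?g = (norm x0)\<^sup>2 + \<kappa>"
      using integral_lborel_reflect[OF gm, of x0] I moment by simp_all
    have "z x0 + e * ((norm x0)\<^sup>2 + \<kappa>) = (\<integral>y. z x0 * mollifier \<eta> (x0 - y) + e * ?g y \<partial>lborel)"
      using m Ig Mg by (simp add: integral_mult_right_zero)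
    also have "\<dots> \<le> Vm \<eta> x0"
      unfolding Vm_def
    proof (rule integral_mono)
      fix y
      show "z x0 * mollifier \<eta> (x0 - y) + e * ?g y \<le> V y * mollifier \<eta> (x0 - y)"
      proof (cases "norm (x0 - y) > \<eta>")
        case False
        then have y1: "norm y < 1" using norm_triangle_ineq2[of y x0] \<eta> by (simp add: norm_minus_commute)
        then have "z x0 + e * (norm y)\<^sup>2 \<le> V y" using x0(2)[of y] by (simp add: V_eq z_def)
        from mult_right_mono[OF this mollifier_nonneg[of \<eta> "x0 - y"]]
        show ?thesis by (simp add: algebra_simps)
      qed (simp add: mollifier_eq_0 \<eta>)
    qed (use m Ig V_mollifier_integrable in auto)
    also have "\<dots> \<le> v x0 - c" by (rule super_mean_value[OF \<eta>(1,3)])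
    also have "\<dots> = z x0 + e * (norm x0)\<^sup>2" by (simp add: z_def)
    finally have "e * \<kappa> \<le> 0" by (simp add: algebra_simps)
    moreover have "\<kappa> > 0" using mom(2) by (simp add: \<kappa>_def)
    ultimately show False using e by (simp add: mult_le_0_iff)
  qed
  then have "- e \<le> z x0" using bdry[of x0] by (simp add: z_def)
  also have "\<dots> \<le> z x" using x0(2) x by simp
  also have "\<dots> \<le> v x - c" using e by (simp add: z_def)
  finally show "c \<le> v x + e" by simp
qed

text \<open>The test function is \<open>\<theta>(1 - |x|\<^sup>2)\<close> with \<open>\<theta>'\<close> a smooth step from \<open>\<tau>\<close> to \<open>2\<tau>\<close>. Its Laplacian
  \<open>- 4 \<theta>' + 4 |x|\<^sup>2 \<theta>''\<close> has integral zero; the first part is at most \<open>- 4\<close> times the indicator of the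
  disc of radius \<open>3/4\<close>, and the second lives in a shell at the circle that is so thin that
  \<open>v - c \<le> C0 + 1\<close> there.\<close>

lemma integral_above_boundary_min:
  assumes lower: "\<And>x. norm x = 1 \<Longrightarrow> c \<le> v x" and upper: "\<And>x. norm x = 1 \<Longrightarrow> v x \<le> c + C0"
    and C0: "C0 \<ge> 0"
  shows "(\<integral>x. indicator (cball 0 (3/4)) x * V x \<partial>lborel) \<le> integral\<^sup>L lborel F / 4 + (C0 + 1) * pi"
proof -
  have V_nonneg: "V x \<ge> 0" for x
    using minimum_principle[OF lower, of x] by (cases "norm x < 1") (auto simp: V_eq V_out)
  have "uniformly_continuous_on (cball 0 1) v"
    by (rule compact_uniformly_continuous[OF v_cont]) simp
  then obtain d where d: "d > 0" "\<And>x y. x \<in> cball 0 1 \<Longrightarrow> y \<in> cball 0 1 \<Longrightarrow> dist y x < d \<Longrightarrow> dist (v y) (v x) < 1"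
    unfolding uniformly_continuous_on_def by (metis zero_less_one)
  define \<tau> where "\<tau> = min (d / 4) (1 / 8)"
  have \<tau>: "\<tau> > 0" "\<tau> \<le> 1 / 8" "2 * \<tau> < d" using d(1) by (auto simp: \<tau>_def min_def)
  \<comment> \<open>in this shell \<open>x\<close> is closer than \<open>d\<close> to its radial projection onto the circle\<close>
  have near: "V x \<le> C0 + 1" if "1 - 2 * \<tau> \<le> (norm x)\<^sup>2" for x
  proof (cases "norm x < 1")
    case True
    have x0: "norm x > 0" using that \<tau> by (cases "x = 0") auto
    have "(norm x)\<^sup>2 \<le> norm x" using True x0 by (simp add: power2_eq_square mult_left_le)
    then have "1 - norm x < d" using that \<tau> by linarith
    define y where "y = (1 / norm x) *\<^sub>R x"
    have y: "norm y = 1" using x0 by (simp add: y_def)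
    have "x - y = (1 - 1 / norm x) *\<^sub>R x" by (simp add: y_def algebra_simps)
    then have "norm (x - y) = \<bar>1 - 1 / norm x\<bar> * norm x" by simp
    also have "\<dots> = 1 - norm x" using x0 True by (simp add: abs_if field_simps)
    finally have "dist x y < d" using \<open>1 - norm x < d\<close> by (simp add: dist_norm)
    then have "dist (v x) (v y) < 1" using d(2)[of y x] y True by simp
    then show ?thesis using upper[OF y] True by (simp add: V_eq dist_real_def)
  qed (use C0 in \<open>simp add: V_out\<close>)
  define \<theta>' where "\<theta>' t = smooth_step (t / \<tau> + (- 1))" for t
  define \<theta>'' where "\<theta>'' t = deriv smooth_step (t / \<tau> + (- 1)) / \<tau>" for t
  define \<theta> where "\<theta> t = integral {0..t} \<theta>'" for t
  have \<theta>'_smooth: "\<theta>' \<in> smooth1"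
  proof -
    have "\<theta>' = (\<lambda>t. smooth_step (inverse \<tau> * t + (- 1)))"
      by (rule ext) (simp add: \<theta>'_def divide_inverse mult.commute)
    then show ?thesis using smooth1.smooth1_affine[OF smooth1_smooth_step, of "inverse \<tau>" "- 1"] by (simp only:)
  qed
  have \<theta>'_0: "\<theta>' t = 0" if "t \<le> \<tau>" for t
    using that \<tau> by (simp add: \<theta>'_def smooth_step_eq_0 field_simps)
  have \<theta>'_1: "\<theta>' t = 1" if "t \<ge> 2 * \<tau>" for t
    using that \<tau> by (simp add: \<theta>'_def smooth_step_eq_1 field_simps)
  have d_\<theta>: "(\<theta> has_real_derivative \<theta>' t) (at t)" for t
    unfolding \<theta>_def[abs_def]
    by (rule DERIV_integral_from_zero[OF smooth1_continuous_on[OF \<theta>'_smooth]]) (use \<theta>'_0 \<tau> in auto)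
  have d_\<theta>': "(\<theta>' has_real_derivative \<theta>'' t) (at t)" for t
  proof -
    have "((\<lambda>t. t / \<tau> + (- 1)) has_real_derivative 1 / \<tau> + 0) (at t)"
      by (rule DERIV_add[OF DERIV_cdivide[OF DERIV_ident] DERIV_const])
    from DERIV_chain2[OF smooth1_DERIV[OF smooth1_smooth_step] this] show ?thesis
      by (simp add: \<theta>'_def[abs_def] \<theta>''_def)
  qed
  have \<theta>''_nonneg: "\<theta>'' t \<ge> 0" for t
    unfolding \<theta>''_def using deriv_smooth_step_nonneg \<tau>(1) by (intro divide_nonneg_pos)
  have \<theta>''_0: "\<theta>'' t = 0" if "t > 2 * \<tau>" for t
    by (rule DERIV_unique[OF d_\<theta>'])
       (rule has_field_derivative_transform_within_open[OF DERIV_const[of 1] open_greaterThan[of "2 * \<tau>"]],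
         use that \<theta>'_1 in auto)
  define Q where "Q t = \<theta> ((- 1) * t + 1)" for t
  define Q' where "Q' t = (- 1) * \<theta>' ((- 1) * t + 1)" for t
  define Q'' where "Q'' t = \<theta>'' ((- 1) * t + 1)" for t
  have Q_smooth: "Q \<in> smooth1"
    unfolding Q_def[abs_def] by (rule smooth1.smooth1_affine[OF smooth1.smooth1_antideriv[OF \<theta>'_smooth d_\<theta>]])
  have Q'_smooth: "Q' \<in> smooth1"
    unfolding Q'_def[abs_def] by (rule smooth1_cmult[OF smooth1.smooth1_affine[OF \<theta>'_smooth]])
  have lin: "((\<lambda>t. (- 1) * t + 1) has_real_derivative - 1) (at t)" for t :: real
    using DERIV_add[OF DERIV_cmult_Id[of "- 1" t UNIV] DERIV_const[of 1]] by simp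
  have d_Q: "(Q has_real_derivative Q' t) (at t)" for t
    using DERIV_chain2[OF d_\<theta> lin] by (simp add: Q_def[abs_def] Q'_def)
  have d_Q': "(Q' has_real_derivative Q'' t) (at t)" for t
    using DERIV_cmult[where c = "- 1", OF DERIV_chain2[OF d_\<theta>' lin]] by (simp add: Q'_def[abs_def] Q''_def)
  define R where "R = sqrt (1 - \<tau>)"
  have R: "R \<ge> 0" "norm (0::real^2) + R < 1" "R\<^sup>2 = 1 - \<tau>" using \<tau> by (auto simp: R_def)
  have Q0: "Q t = 0" if "t \<ge> R\<^sup>2" for t
  proof -
    have "integral {0..1 - t} \<theta>' = integral {0..1 - t} (\<lambda>_. 0)"
      by (rule Henstock_Kurzweil_Integration.integral_cong) (use that R(3) \<theta>'_0 in auto)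
    then show ?thesis by (simp add: Q_def \<theta>_def)
  qed
  have Q_le: "Q t \<le> 1" if "t \<ge> 0" for t
  proof (cases "t \<le> 1")
    case True
    have "integral {0..1 - t} \<theta>' \<le> integral {0..1 - t} (\<lambda>_. 1)"
      by (intro integral_le integrable_continuous_real smooth1_continuous_on \<theta>'_smooth continuous_on_const)
         (simp add: \<theta>'_def smooth_step_le_1)
    then show ?thesis using that True by (simp add: Q_def \<theta>_def)
  next
    case False
    then show ?thesis by (simp add: Q_def \<theta>_def)
  qed
  let ?n = "\<lambda>x::real^2. (norm x)\<^sup>2"
  have test: "(\<integral>x. V x * (4 * Q' (?n x) + 4 * ?n x * Q'' (?n x)) \<partial>lborel) = - (\<integral>x. F x * Q (?n x) \<partial>lborel)"
    using radial_test[OF Q_smooth d_Q d_Q' R(1,2) Q0] by simp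
  note zero = radial_laplacian_support[OF d_Q d_Q' Q0]
  have bal: "(\<integral>x. 4 * Q' (?n x) + 4 * ?n x * Q'' (?n x) \<partial>lborel) = 0"
    and i1: "integrable lborel (\<lambda>x. 4 * Q' (?n x))"
    and i2: "integrable lborel (\<lambda>x. 4 * ?n x * Q'' (?n x))"
    using integral_radial_laplacian[where a = 0, OF Q'_smooth d_Q' R(1) zero(1)] by simp_all
  have Q''_smooth: "Q'' \<in> smooth1"
  proof -
    have "deriv Q' = Q''" using DERIV_imp_deriv[OF d_Q'] by (rule ext)
    then show ?thesis using smooth1_deriv_mem[OF Q'_smooth] by simp
  qed
  have c1: "continuous_on UNIV (\<lambda>x. 4 * Q' (?n x))" and c2: "continuous_on UNIV (\<lambda>x. 4 * ?n x * Q'' (?n x))"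
    and c3: "continuous_on UNIV (\<lambda>x. Q (?n x))"
    using continuous_on_smooth1_radial[OF Q'_smooth, of UNIV 1] continuous_on_smooth1_radial[OF Q''_smooth, of UNIV 1]
      continuous_on_smooth1_radial[OF Q_smooth, of UNIV 1]
    by (auto intro!: continuous_on_mult continuous_on_const continuous_on_power continuous_on_norm continuous_on_id)
  have iV: "integrable lborel (\<lambda>x. V x * g x)" and iF: "integrable lborel (\<lambda>x. F x * g x)"
    if "continuous_on UNIV g" for g
    using integrable_mult_continuous[OF V_integrable V_out that] integrable_mult_continuous[OF F_integrable F_out that]
    by auto
  have "(\<integral>x. V x * (4 * Q' (?n x)) \<partial>lborel) + (\<integral>x. V x * (4 * ?n x * Q'' (?n x)) \<partial>lborel) = - (\<integral>x. F x * Q (?n x) \<partial>lborel)"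
    using test by (simp only: distrib_left[of "V _"] Bochner_Integration.integral_add[OF iV[OF c1] iV[OF c2]])
  moreover have "(\<integral>x. F x * Q (?n x) \<partial>lborel) \<le> integral\<^sup>L lborel F"
    by (rule integral_mono[OF iF[OF c3] F_integrable])
       (use mult_left_mono[OF Q_le F_nonneg] in auto)
  moreover have "(\<integral>x. V x * (4 * ?n x * Q'' (?n x)) \<partial>lborel) \<le> (\<integral>x. (C0 + 1) * (4 * ?n x * Q'' (?n x)) \<partial>lborel)"
  proof (rule integral_mono)
    fix x
    show "V x * (4 * ?n x * Q'' (?n x)) \<le> (C0 + 1) * (4 * ?n x * Q'' (?n x))"
    proof (cases "1 - 2 * \<tau> \<le> ?n x")
      case True
      have "4 * ?n x * Q'' (?n x) \<ge> 0" using \<theta>''_nonneg by (simp add: Q''_def)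
      from mult_right_mono[OF near[OF True] this] show ?thesis .
    next
      case False
      then have "Q'' (?n x) = 0" unfolding Q''_def by (intro \<theta>''_0) simp
      then show ?thesis by simp
    qed
  qed (use iV[OF c2] i2 in auto)
  \<comment> \<open>the two parts of the Laplacian balance, and \<open>\<theta>' \<le> 1\<close> on a disc of area \<open>pi\<close>\<close>
  moreover have "(\<integral>x. 4 * ?n x * Q'' (?n x) \<partial>lborel) \<le> 4 * pi"
  proof -
    have "(\<integral>x. 4 * ?n x * Q'' (?n x) \<partial>lborel) = (\<integral>x. - (4 * Q' (?n x)) \<partial>lborel)"
      using bal by (simp only: Bochner_Integration.integral_add[OF i1 i2] Bochner_Integration.integral_minus)
    also have "\<dots> \<le> (\<integral>x. 4 * indicator (cball 0 1) (x::real^2) \<partial>lborel)"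
    proof (rule integral_mono)
      show "integrable lborel (\<lambda>x. 4 * indicat_real (cball 0 1) (x::real^2))"
        using emeasure_bounded_finite[OF bounded_cball[of "0::real^2" 1]] by auto
      fix x
      show "- (4 * Q' (?n x)) \<le> 4 * indicator (cball 0 1) x"
      proof (cases "norm x \<le> 1")
        case True
        then show ?thesis using smooth_step_le_1 by (simp add: Q'_def \<theta>'_def)
      next
        case False
        then have "?n x > 1" by (simp add: one_less_power)
        then have "Q' (?n x) = 0" using zero(1) R(3) \<tau> by simp
        then show ?thesis by simp
      qed
    qed (use i1 in simp)
    also have "\<dots> = 4 * pi" by (simp add: measure_cball_plane)
    finally show ?thesis .
  qed
  moreover have "(\<integral>x. (C0 + 1) * (4 * ?n x * Q'' (?n x)) \<partial>lborel) = (C0 + 1) * (\<integral>x. 4 * ?n x * Q'' (?n x) \<partial>lborel)"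
    by (rule integral_mult_right_zero)
  moreover have "4 * (\<integral>x. indicator (cball 0 (3/4)) x * V x \<partial>lborel) \<le> - (\<integral>x. V x * (4 * Q' (?n x)) \<partial>lborel)"
  proof -
    have iI: "integrable lborel (\<lambda>x. 4 * (indicator (cball 0 (3/4)) x * V x))"
      using integrable_mult_indicator[OF _ V_integrable, of "cball 0 (3/4)"] by simp
    have "4 * (\<integral>x. indicator (cball 0 (3/4)) x * V x \<partial>lborel) = (\<integral>x. 4 * (indicator (cball 0 (3/4)) x * V x) \<partial>lborel)"
      by (rule integral_mult_right_zero[symmetric])
    also have "\<dots> \<le> (\<integral>x. - (V x * (4 * Q' (?n x))) \<partial>lborel)"
    proof (rule integral_mono[OF iI])
      fix x
      show "4 * (indicator (cball 0 (3/4)) x * V x) \<le> - (V x * (4 * Q' (?n x)))"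
      proof (cases "norm x \<le> 3/4")
        case True
        then have "?n x \<le> (3/4)\<^sup>2" by (intro power_mono) auto
        then have "1 - ?n x \<ge> 2 * \<tau>" using \<tau> by (simp add: power2_eq_square)
        then have "Q' (?n x) = - 1" using \<theta>'_1 by (simp add: Q'_def)
        then show ?thesis using True by simp
      next
        case False
        have "Q' (?n x) \<le> 0" using smooth_step_nonneg by (simp add: Q'_def \<theta>'_def)
        then show ?thesis using False V_nonneg[of x] by (simp add: mult_nonneg_nonpos)
      qed
    qed (use iV[OF c1] in simp)
    finally show ?thesis by simp
  qed
  moreover have "(C0 + 1) * (\<integral>x. 4 * ?n x * Q'' (?n x) \<partial>lborel) \<le> (C0 + 1) * (4 * pi)"
    using calculation(4) C0 by (intro mult_left_mono) auto
  ultimately show ?thesis by (simp add: field_simps)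
qed

text \<open>The gradient of the harmonic part, read off from its representation at scale \<open>1/4\<close>.\<close>

definition w_grad :: "real^2 \<Rightarrow> real^2" where
  "w_grad x = (\<integral>y. V y *\<^sub>R mollifier_grad (1/4) (x - y) \<partial>lborel) + (\<integral>y. F y *\<^sub>R log_grad (1/4) (x - y) \<partial>lborel)"

lemma Fl_GDERIV:
  assumes "\<delta> > 0"
  shows "GDERIV (Fl \<delta>) x :> (\<integral>y. F y *\<^sub>R log_grad \<delta> (x - y) \<partial>lborel)"
  unfolding Fl_def[abs_def]
  by (rule GDERIV_convolution[OF F_integrable _ GDERIV_log_kernel continuous_on_log_grad norm_log_grad_le(2)[OF assms], of 1])
     (simp add: F_out)

lemma Fl_grad_continuous:
  assumes "\<delta> > 0"
  shows "continuous_on UNIV (\<lambda>x. \<integral>y. F y *\<^sub>R log_grad \<delta> (x - y) \<partial>lborel)"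
  by (rule continuous_convolution[OF F_integrable continuous_on_log_grad norm_log_grad_le(2)[OF assms]])

lemma w_GDERIV: "GDERIV (\<lambda>x. Vm (1/4) x + Fl (1/4) x) x :> w_grad x"
proof -
  obtain M where M: "\<And>x. norm (mollifier_grad (1/4) x) \<le> M" using mollifier_grad_bounded[of "1/4"] by auto
  have "GDERIV (Vm (1/4)) x :> (\<integral>y. V y *\<^sub>R mollifier_grad (1/4) (x - y) \<partial>lborel)"
    unfolding Vm_def[abs_def]
    by (rule GDERIV_convolution[OF V_integrable _ GDERIV_mollifier continuous_on_mollifier_grad M, of 1])
       (simp add: V_out)
  from GDERIV_add[OF this Fl_GDERIV] show ?thesis by (simp add: w_grad_def)
qed

lemma w_grad_continuous: "continuous_on UNIV w_grad"
proof -
  obtain M where M: "\<And>x. norm (mollifier_grad (1/4) x) \<le> M" using mollifier_grad_bounded[of "1/4"] by auto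
  show ?thesis
    unfolding w_grad_def[abs_def]
    by (intro continuous_on_add Fl_grad_continuous
        continuous_convolution[OF V_integrable continuous_on_mollifier_grad M]) simp
qed

text \<open>Both kernels are bounded at the fixed scale \<open>1/4\<close>, and for \<open>|x| \<le> 1/2\<close> the mollifier sees \<open>V\<close> only
  on the disc of radius \<open>3/4\<close>.\<close>

lemma w_grad_bound:
  assumes lower: "\<And>x. norm x = 1 \<Longrightarrow> c \<le> v x" and upper: "\<And>x. norm x = 1 \<Longrightarrow> v x \<le> c + C0"
    and C0: "C0 \<ge> 0" and M: "\<And>x. norm (mollifier_grad (1/4) x) \<le> M" and x: "norm x \<le> 1/2"
  shows "norm (w_grad x) \<le> M * (integral\<^sup>L lborel F / 4 + (C0 + 1) * pi) + 8 * integral\<^sup>L lborel F"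
proof -
  have M0: "M \<ge> 0" using M[of 0] norm_ge_zero order_trans by blast
  have V_nonneg: "V x \<ge> 0" for x
    using minimum_principle[OF lower, of x] by (cases "norm x < 1") (auto simp: V_eq V_out)
  have iI: "integrable lborel (\<lambda>x. indicator (cball 0 (3/4)) x * V x)"
    using integrable_mult_indicator[OF _ V_integrable, of "cball 0 (3/4)"] by simp
  have "norm (\<integral>y. V y *\<^sub>R mollifier_grad (1/4) (x - y) \<partial>lborel) \<le> (\<integral>y. M * (indicator (cball 0 (3/4)) y * V y) \<partial>lborel)"
  proof (rule Bochner_Integration.integral_norm_bound_integral)
    show "integrable lborel (\<lambda>y. V y *\<^sub>R mollifier_grad (1/4) (x - y))"
      by (rule convolution_kernel_integrable[OF V_integrable _ continuous_on_mollifier_grad, of 1]) (simp add: V_out)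
    fix y
    show "norm (V y *\<^sub>R mollifier_grad (1/4) (x - y)) \<le> M * (indicator (cball 0 (3/4)) y * V y)"
    proof (cases "norm y \<le> 3/4")
      case True
      then show ?thesis using mult_left_mono[OF M V_nonneg[of y], of "x - y"] V_nonneg[of y] by (simp add: mult.commute)
    next
      case False
      then have "norm (x - y) > 1/4" using x norm_triangle_ineq2[of y x] by (simp add: norm_minus_commute)
      then show ?thesis using False by (simp add: mollifier_grad_eq_0)
    qed
  qed (use iI in simp)
  also have "\<dots> \<le> M * (integral\<^sup>L lborel F / 4 + (C0 + 1) * pi)"
    using mult_left_mono[OF integral_above_boundary_min[OF lower upper C0] M0] by simp
  finally have 1: "norm (\<integral>y. V y *\<^sub>R mollifier_grad (1/4) (x - y) \<partial>lborel) \<le> M * (integral\<^sup>L lborel F / 4 + (C0 + 1) * pi)" .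
  have "norm (\<integral>y. F y *\<^sub>R log_grad (1/4) (x - y) \<partial>lborel) \<le> (\<integral>y. 8 * F y \<partial>lborel)"
  proof (rule Bochner_Integration.integral_norm_bound_integral)
    show "integrable lborel (\<lambda>y. F y *\<^sub>R log_grad (1/4) (x - y))"
      by (rule convolution_kernel_integrable[OF F_integrable _ continuous_on_log_grad, of 1]) (simp add: F_out)
    fix y
    show "norm (F y *\<^sub>R log_grad (1/4) (x - y)) \<le> 8 * F y"
      using mult_left_mono[OF norm_log_grad_le(2)[of "1/4" "x - y"] F_nonneg[of y]] F_nonneg[of y]
      by (simp add: mult.commute)
  qed (use F_integrable in simp)
  then have 2: "norm (\<integral>y. F y *\<^sub>R log_grad (1/4) (x - y) \<partial>lborel) \<le> 8 * integral\<^sup>L lborel F" by simp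
  show ?thesis unfolding w_grad_def using norm_triangle_ineq 1 2 by (meson add_mono order_trans)
qed

end

section \<open>The Pohozaev identity by symmetrisation\<close>

text \<open>Exchanging the variables changes the sign of the odd kernel \<open>g\<close>; the two double integrals are
  averaged.\<close>

lemma integral_symmetrize:
  fixes a g :: "'a::euclidean_space \<Rightarrow> 'a"
  assumes "finite_measure \<mu>" and sets: "sets \<mu> = sets borel"
    and [measurable]: "a \<in> borel_measurable borel" "g \<in> borel_measurable borel"
    and odd: "\<And>x. g (- x) = - g x"
    and A: "\<And>x. norm (a x) \<le> A" and B: "\<And>x. norm (g x) \<le> B"
  shows "2 * (\<integral>x. \<integral>y. a x \<bullet> g (x - y) \<partial>\<mu> \<partial>\<mu>) = (\<integral>x. \<integral>y. (a x - a y) \<bullet> g (x - y) \<partial>\<mu> \<partial>\<mu>)"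
    and "integrable \<mu> (\<lambda>x. \<integral>y. (a x - a y) \<bullet> g (x - y) \<partial>\<mu>)"
proof -
  interpret finite_measure \<mu> by fact
  interpret P: pair_sigma_finite \<mu> \<mu> ..
  interpret Q: finite_measure "\<mu> \<Otimes>\<^sub>M \<mu>" by (rule finite_measure_pair_measure) fact+
  note sets[measurable_cong]
  have B0: "B \<ge> 0" using B norm_ge_zero order_trans by blast
  have bd: "\<bar>a x \<bullet> g z\<bar> \<le> A * B" for x z
  proof -
    have "A \<ge> 0" using A[of x] norm_ge_zero[of "a x"] by linarith
    then have "norm (a x) * norm (g z) \<le> A * B" by (intro mult_mono A B) auto
    then show ?thesis using Cauchy_Schwarz_ineq2[of "a x" "g z"] by linarith
  qed
  have i1: "integrable (\<mu> \<Otimes>\<^sub>M \<mu>) (case_prod (\<lambda>x y. a x \<bullet> g (x - y)))"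
    by (rule Q.integrable_const_bound[of _ "A * B"]) (use bd in auto)
  have i2: "integrable (\<mu> \<Otimes>\<^sub>M \<mu>) (case_prod (\<lambda>x y. a y \<bullet> g (x - y)))"
    by (rule Q.integrable_const_bound[of _ "A * B"]) (use bd in auto)
  have j1: "integrable \<mu> (\<lambda>y. a x \<bullet> g (x - y))" and j2: "integrable \<mu> (\<lambda>y. a y \<bullet> g (x - y))" for x
    by (rule integrable_const_bound[of _ "A * B"]; use bd in auto)+
  have eq: "(\<integral>y. (a x - a y) \<bullet> g (x - y) \<partial>\<mu>) = (\<integral>y. a x \<bullet> g (x - y) \<partial>\<mu>) - (\<integral>y. a y \<bullet> g (x - y) \<partial>\<mu>)" for x
    unfolding inner_diff_left by (rule Bochner_Integration.integral_diff[OF j1 j2])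
  have k1: "integrable \<mu> (\<lambda>x. \<integral>y. a x \<bullet> g (x - y) \<partial>\<mu>)" by (rule P.integrable_fst[OF i1])
  have k2: "integrable \<mu> (\<lambda>x. \<integral>y. a y \<bullet> g (x - y) \<partial>\<mu>)" by (rule P.integrable_fst[OF i2])
  show "integrable \<mu> (\<lambda>x. \<integral>y. (a x - a y) \<bullet> g (x - y) \<partial>\<mu>)"
    unfolding eq by (rule Bochner_Integration.integrable_diff[OF k1 k2])
  have "(\<integral>x. \<integral>y. a y \<bullet> g (x - y) \<partial>\<mu> \<partial>\<mu>) = (\<integral>y. \<integral>x. a y \<bullet> g (x - y) \<partial>\<mu> \<partial>\<mu>)"
    by (rule P.Fubini_integral[OF i2, symmetric])
  also have "\<dots> = (\<integral>y. \<integral>x. - (a y \<bullet> g (y - x)) \<partial>\<mu> \<partial>\<mu>)"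
    by (simp only: odd[symmetric] inner_minus_right[symmetric] minus_diff_eq)
  also have "\<dots> = - (\<integral>x. \<integral>y. a x \<bullet> g (x - y) \<partial>\<mu> \<partial>\<mu>)" by simp
  finally show "2 * (\<integral>x. \<integral>y. a x \<bullet> g (x - y) \<partial>\<mu> \<partial>\<mu>) = (\<integral>x. \<integral>y. (a x - a y) \<bullet> g (x - y) \<partial>\<mu> \<partial>\<mu>)"
    unfolding eq Bochner_Integration.integral_diff[OF k1 k2] by simp
qed

text \<open>The symmetrised kernel is at most \<open>L / (2\<pi>)\<close>, because \<open>a\<close> is Lipschitz and the kernel decays like
  \<open>1 / |x - y|\<close>. If \<open>a\<close> is the identity at both points it is \<open>(x - y) \<bullet> log_grad \<delta> (x - y)\<close>, that is
  \<open>1 / (2\<pi>)\<close> unless \<open>|x - y| < \<delta>\<close>. The two exceptional sets produce the two error terms.\<close>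

lemma symmetrized_energy_estimate:
  fixes a :: "real^2 \<Rightarrow> real^2"
  assumes fin: "finite_measure \<mu>" and sets: "sets \<mu> = sets borel"
    and [measurable]: "a \<in> borel_measurable borel" and A: "\<And>x. norm (a x) \<le> A"
    and Lip: "\<And>x y. norm (a x - a y) \<le> L * norm (x - y)" and L: "L \<ge> 0"
    and a_id: "\<And>x. norm x \<le> r \<Longrightarrow> a x = x"
    and \<delta>: "\<delta> > 0" and b: "\<And>x. measure \<mu> (ball x \<delta>) \<le> b"
  shows "\<bar>4 * pi * (\<integral>x. \<integral>y. a x \<bullet> log_grad \<delta> (x - y) \<partial>\<mu> \<partial>\<mu>) - (measure \<mu> UNIV)\<^sup>2\<bar>
      \<le> measure \<mu> UNIV * (2 * (L + 1) * measure \<mu> {x. norm x > r} + b)"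
proof -
  interpret finite_measure \<mu> by fact
  note sets[measurable_cong]
  have space: "space \<mu> = UNIV" using sets_eq_imp_space_eq[OF sets] by simp
  have [measurable]: "log_grad \<delta> \<in> borel_measurable borel"
    by (rule borel_measurable_continuous_onI[OF continuous_on_log_grad])
  define m where "m = measure \<mu> UNIV"
  define Far where "Far = {x::real^2. norm x > r}"
  have [measurable]: "Far \<in> sets borel" unfolding Far_def by measurable
  define k where "k x y = (a x - a y) \<bullet> log_grad \<delta> (x - y)" for x y
  define \<phi> where "\<phi> x = (\<integral>y. k x y \<partial>\<mu>)" for x
  have sym: "2 * (\<integral>x. \<integral>y. a x \<bullet> log_grad \<delta> (x - y) \<partial>\<mu> \<partial>\<mu>) = (\<integral>x. \<phi> x \<partial>\<mu>)"
    and \<phi>_int: "integrable \<mu> \<phi>"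
    unfolding \<phi>_def[abs_def] k_def
    by (rule integral_symmetrize[where a = a and g = "log_grad \<delta>", OF fin sets _ _ log_grad_minus[of \<delta>] A norm_log_grad_le(2)[OF \<delta>]]; measurable)+
  have k_bound: "2 * pi * \<bar>k x y\<bar> \<le> L" for x y
  proof -
    have "\<bar>k x y\<bar> \<le> norm (a x - a y) * norm (log_grad \<delta> (x - y))"
      unfolding k_def by (rule Cauchy_Schwarz_ineq2)
    also have "\<dots> \<le> L * norm (x - y) * norm (log_grad \<delta> (x - y))"
      by (intro mult_right_mono Lip) simp
    also have "\<dots> = L * (norm (log_grad \<delta> (x - y)) * norm (x - y))" by simp
    also have "\<dots> \<le> L * (1 / (2 * pi))" by (intro mult_left_mono norm_log_grad_le(3) \<delta> L)
    finally show ?thesis by (simp add: field_simps)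
  qed
  \<comment> \<open>the normalised kernel differs from 1 only for far points or close pairs\<close>
  have pointwise: "\<bar>2 * pi * k x y - 1\<bar> \<le> (L + 1) * (indicator Far x + indicator Far y) + indicator (ball x \<delta>) y" for x y
  proof (cases "x \<in> Far \<or> y \<in> Far")
    case True
    have "\<bar>2 * pi * k x y\<bar> \<le> L" using k_bound[of x y] by (simp add: abs_mult)
    then have "\<bar>2 * pi * k x y - 1\<bar> \<le> L + 1" by linarith
    also have "\<dots> \<le> (L + 1) * (indicator Far x + indicator Far y)"
      using True L by (auto simp: indicator_def)
    also have "\<dots> \<le> (L + 1) * (indicator Far x + indicator Far y) + indicator (ball x \<delta>) y" by simp
    finally show ?thesis .
  next
    case False
    then have "k x y = cap_mass ((norm (x - y))\<^sup>2 / \<delta>\<^sup>2) / (2 * pi)"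
      unfolding k_def using inner_log_grad[OF \<delta>, of "x - y"] by (simp add: Far_def a_id)
    then have *: "2 * pi * k x y = cap_mass ((norm (x - y))\<^sup>2 / \<delta>\<^sup>2)" by simp
    show ?thesis
    proof (cases "y \<in> ball x \<delta>")
      case True
      then show ?thesis using False cap_mass_nonneg cap_mass_le_1 unfolding * by (simp add: abs_le_iff)
    next
      case F: False
      then have "norm (x - y) \<ge> \<delta>" by (simp add: dist_norm)
      then have "(norm (x - y))\<^sup>2 / \<delta>\<^sup>2 \<ge> 1" using \<delta> by (simp add: power_mono)
      then show ?thesis using False F unfolding * by (simp add: cap_mass_eq_1)
    qed
  qed
  have k_meas [measurable]: "k x \<in> borel_measurable borel" for x
    unfolding k_def[abs_def] by measurable
  have k_int: "integrable \<mu> (k x)" for x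
  proof (rule integrable_const_bound)
    show "AE y in \<mu>. norm (k x y) \<le> L"
    proof (rule AE_I2)
      fix y
      have "1 * \<bar>k x y\<bar> \<le> 2 * pi * \<bar>k x y\<bar>" using pi_gt3 by (intro mult_right_mono) auto
      then show "norm (k x y) \<le> L" using k_bound[of x y] by simp
    qed
  qed measurable
  have ind_int: "integrable \<mu> (indicat_real S)" if [measurable]: "S \<in> sets borel" for S
    by (rule integrable_const_bound[of _ 1]) (auto simp: indicator_def)
  have ind: "(\<integral>x. indicat_real S x \<partial>\<mu>) = measure \<mu> S" for S
    by (simp add: space)
  have \<phi>_bound: "\<bar>2 * pi * \<phi> x - m\<bar> \<le> (L + 1) * (indicator Far x * m + measure \<mu> Far) + b" for x
  proof -
    have "2 * pi * \<phi> x - m = (\<integral>y. 2 * pi * k x y - 1 \<partial>\<mu>)"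
      using k_int by (simp add: \<phi>_def m_def space)
    also have "norm \<dots> \<le> (\<integral>y. (L + 1) * (indicator Far x + indicator Far y) + indicator (ball x \<delta>) y \<partial>\<mu>)"
      by (rule Bochner_Integration.integral_norm_bound_integral)
         (use k_int ind_int pointwise in \<open>auto intro!: Bochner_Integration.integrable_add integrable_mult_right\<close>)
    also have "\<dots> = (L + 1) * (indicator Far x * m + measure \<mu> Far) + measure \<mu> (ball x \<delta>)"
      using ind_int by (simp add: ind m_def space mult.commute)
    also have "\<dots> \<le> (L + 1) * (indicator Far x * m + measure \<mu> Far) + b" using b by simp
    finally show ?thesis by simp
  qed
  have "4 * pi * (\<integral>x. \<integral>y. a x \<bullet> log_grad \<delta> (x - y) \<partial>\<mu> \<partial>\<mu>) - m\<^sup>2 = 2 * pi * (\<integral>x. \<phi> x \<partial>\<mu>) - m\<^sup>2"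
    unfolding sym[symmetric] by simp
  also have "\<dots> = (\<integral>x. 2 * pi * \<phi> x - m \<partial>\<mu>)"
    using \<phi>_int by (simp add: m_def space power2_eq_square)
  also have "norm \<dots> \<le> (\<integral>x. (L + 1) * (indicator Far x * m + measure \<mu> Far) + b \<partial>\<mu>)"
    by (rule Bochner_Integration.integral_norm_bound_integral)
       (use \<phi>_int ind_int[of Far] \<phi>_bound in \<open>auto intro!: Bochner_Integration.integrable_add integrable_mult_right integrable_mult_left\<close>)
  also have "\<dots> = (L + 1) * (measure \<mu> Far * m + measure \<mu> Far * m) + b * m"
    using ind_int[of Far] by (simp add: ind m_def space mult.commute)
  finally show ?thesis by (simp add: m_def Far_def algebra_simps)
qed

context disc_poisson
begin

text \<open>As a finite measure \<open>f dx\<close> makes every bounded measurable function integrable, also on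
  the product space used for the symmetrisation.\<close>

definition \<mu> :: "(real^2) measure" where
  "\<mu> = density lborel (\<lambda>x. ennreal (F x))"

lemma sets_\<mu>: "sets \<mu> = sets borel"
  by (simp add: \<mu>_def)

lemma integral_\<mu>:
  fixes h :: "real^2 \<Rightarrow> 'b::{banach, second_countable_topology}"
  assumes "h \<in> borel_measurable borel"
  shows "integral\<^sup>L \<mu> h = (\<integral>x. F x *\<^sub>R h x \<partial>lborel)"
  unfolding \<mu>_def using assms F_nonneg F_measurable by (intro integral_density) auto

lemma finite_\<mu>: "finite_measure \<mu>"
proof
  have "emeasure \<mu> (space \<mu>) = (\<integral>\<^sup>+x. ennreal (F x) \<partial>lborel)"
    unfolding \<mu>_def using F_measurable by (subst emeasure_density) auto
  also have "\<dots> = ennreal (integral\<^sup>L lborel F)"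
    by (rule nn_integral_eq_integral[OF F_integrable]) (simp add: F_nonneg)
  finally show "emeasure \<mu> (space \<mu>) \<noteq> \<infinity>" by simp
qed

lemma measure_\<mu>:
  assumes "S \<in> sets borel"
  shows "measure \<mu> S = (\<integral>x. indicator S x * F x \<partial>lborel)"
proof -
  interpret finite_measure \<mu> by (rule finite_\<mu>)
  have "measure \<mu> S = integral\<^sup>L \<mu> (indicat_real S)" by (simp add: \<mu>_def)
  also have "\<dots> = (\<integral>x. F x *\<^sub>R indicat_real S x \<partial>lborel)" using assms by (intro integral_\<mu>) auto
  finally show ?thesis by (simp add: mult.commute)
qed

lemma Fl_grad_uniform_bound:
  "\<exists>B. \<forall>\<delta>>0. \<forall>x. norm x \<le> 1 \<longrightarrow> norm (\<integral>y. F y *\<^sub>R log_grad \<delta> (x - y) \<partial>lborel) \<le> B"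
proof -
  obtain MF where MF: "\<And>x. \<bar>F x\<bar> \<le> MF" using F_bounded by blast
  have MF0: "MF \<ge> 0" using MF[of 0] by linarith
  define N where "N = (\<lambda>z::real^2. indicator (ball 0 2) z / norm z)"
  have N: "integrable lborel N" unfolding N_def by (rule integrable_inverse_norm_plane)
  have Nm: "N \<in> borel_measurable borel" using borel_measurable_integrable[OF N] by simp
  have Ns: "integrable lborel (\<lambda>y. N (x - y))" "(\<integral>y. N (x - y) \<partial>lborel) = integral\<^sup>L lborel N" for x
    using integral_lborel_reflect[OF Nm, of x] N by auto
  have "norm (\<integral>y. F y *\<^sub>R log_grad \<delta> (x - y) \<partial>lborel) \<le> MF * integral\<^sup>L lborel N" if "\<delta> > 0" "norm x \<le> 1" for \<delta> x
  proof -
    have "norm (\<integral>y. F y *\<^sub>R log_grad \<delta> (x - y) \<partial>lborel) \<le> (\<integral>y. MF * N (x - y) \<partial>lborel)"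
    proof (rule Bochner_Integration.integral_norm_bound_integral)
      show "integrable lborel (\<lambda>y. F y *\<^sub>R log_grad \<delta> (x - y))"
        by (rule convolution_kernel_integrable[OF F_integrable _ continuous_on_log_grad, of 1]) (simp add: F_out)
      fix y
      show "norm (F y *\<^sub>R log_grad \<delta> (x - y)) \<le> MF * N (x - y)"
      proof (cases "norm y < 1")
        case True
        then have "norm (x - y) < 2" using norm_triangle_ineq4[of x y] that by linarith
        then have "N (x - y) = 1 / norm (x - y)" by (simp add: N_def)
        moreover have "norm (F y *\<^sub>R log_grad \<delta> (x - y)) \<le> MF * (1 / norm (x - y))"
          unfolding norm_scaleR by (intro mult_mono MF norm_log_grad_le(1) that MF0) auto
        ultimately show ?thesis by simp
      next
        case False
        then show ?thesis using MF0 by (simp add: F_out N_def)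
      qed
    qed (use Ns in simp)
    then show ?thesis using Ns by simp
  qed
  then show ?thesis by blast
qed

lemma measure_\<mu>_ball: "\<exists>B\<ge>0. \<forall>\<delta>>0. \<forall>x. measure \<mu> (ball x \<delta>) \<le> B * \<delta>\<^sup>2"
proof -
  obtain MF where MF: "\<And>x. \<bar>F x\<bar> \<le> MF" using F_bounded by blast
  have MF0: "MF \<ge> 0" using MF[of 0] by linarith
  have "measure \<mu> (ball x \<delta>) \<le> (MF * pi) * \<delta>\<^sup>2" if "\<delta> > 0" for x \<delta>
  proof -
    have ib: "integrable lborel (indicat_real (ball x \<delta>))"
      using emeasure_bounded_finite[OF bounded_ball[of x \<delta>]] by auto
    have "measure \<mu> (ball x \<delta>) = (\<integral>y. indicator (ball x \<delta>) y * F y \<partial>lborel)" by (rule measure_\<mu>) simp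
    also have "\<dots> \<le> (\<integral>y. MF * indicator (ball x \<delta>) y \<partial>lborel)"
    proof (rule integral_mono)
      show "integrable lborel (\<lambda>y. indicator (ball x \<delta>) y * F y)"
        using integrable_mult_indicator[OF _ F_integrable, of "ball x \<delta>"] by simp
      show "indicator (ball x \<delta>) y * F y \<le> MF * indicator (ball x \<delta>) y" for y
        using MF[of y] by (auto simp: indicator_def)
    qed (use ib in simp)
    also have "\<dots> = MF * (pi * \<delta>\<^sup>2)" using that by (simp add: content_ball unit_ball_vol_2)
    finally show ?thesis by simp
  qed
  then show ?thesis using MF0 by (intro exI[of _ "MF * pi"]) auto
qed

text \<open>The identity for a density \<open>\<psi> f = T e\<^sup>v\<close> that is cut off near the origin; \<open>T\<close> is \<open>\<psi> H\<close> in the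
  application. Euler's identity for \<open>T\<close> times the exponential of the regularised solution contains
  three parts: the right-hand side of the Pohozaev identity, the harmonic part, which the gradient
  bound and the factor \<open>x\<close> make small, and the potential part, which is the symmetrised energy. All
  regularisation errors are \<open>O(e)\<close>, with a constant depending on the solution, and disappear as
  \<open>e\<close> tends to 0; the errors in the statement are those that vanish under concentration.\<close>

lemma pohozaev_estimate:
  assumes lower: "\<And>x. norm x = 1 \<Longrightarrow> c \<le> v x" and upper: "\<And>x. norm x = 1 \<Longrightarrow> v x \<le> c + C0"
    and C0: "C0 \<ge> 0" and M: "\<And>x. norm (mollifier_grad (1/4) x) \<le> M"
    and T: "\<And>x. GDERIV T x :> gT x" "continuous_on UNIV gT" "\<And>x. norm x > 1/2 \<Longrightarrow> T x = 0"
    and \<psi>: "continuous_on UNIV \<psi>" "\<And>x. 0 \<le> \<psi> x" "\<And>x. \<psi> x \<le> 1" "\<And>x. norm x > 1/2 \<Longrightarrow> \<psi> x = 0"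
      "\<And>x. norm x \<le> r \<Longrightarrow> \<psi> x = 1"
    and Lip: "\<And>x y. norm (\<psi> x *\<^sub>R x - \<psi> y *\<^sub>R y) \<le> L * norm (x - y)" and L: "L \<ge> 0"
    and fT: "\<And>x. norm x < 1 \<Longrightarrow> \<psi> x * f x = T x * exp (v x)"
  defines "lam \<equiv> integral\<^sup>L lborel F"
  shows "\<bar>4 * pi * (\<integral>x. exp (V x + c) * (2 * T x + x \<bullet> gT x) \<partial>lborel) - lam\<^sup>2\<bar>
    \<le> 4 * pi * (M * (lam / 4 + (C0 + 1) * pi) + 8 * lam) * (\<integral>x. F x * (\<psi> x * norm x) \<partial>lborel)
       + 2 * (L + 1) * lam * measure \<mu> {x. norm x > r}"
proof (rule field_le_epsilon)
  fix e0 :: real assume e0: "e0 > 0"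
  define E where "E x = exp (V x + c)" for x
  define U where "U \<delta> x = (\<integral>y. F y *\<^sub>R log_grad \<delta> (x - y) \<partial>lborel)" for \<delta> x
  define G where "G = M * (lam / 4 + (C0 + 1) * pi) + 8 * lam"
  define D where "D = (\<integral>x. E x * (2 * T x + x \<bullet> gT x) \<partial>lborel)"
  have fTE: "\<psi> x * F x = T x * E x" for x
  proof (cases "norm x < 1")
    case True
    then show ?thesis using fT by (simp add: F_eq E_def V_eq)
  qed (simp add: F_out T(3))
  have gT0: "gT x = 0" if "norm x > 1/2" for x
    by (rule GDERIV_zero_outside[OF T(1,3) that])
  have Tc: "continuous_on UNIV T" by (rule GDERIV_continuous_on[OF T(1)])
  have E_meas [measurable]: "E \<in> borel_measurable borel" unfolding E_def[abs_def] by measurable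
  obtain MV where MV: "\<And>x. \<bar>V x\<bar> \<le> MV" using V_bounded by blast
  define EM where "EM = exp (MV + c)"
  have E_le: "E x \<le> EM" for x using MV[of x] by (simp add: E_def EM_def)
  have EM: "EM > 0" by (simp add: EM_def)
  from Fl_grad_uniform_bound obtain BU where
    "\<forall>\<delta>>0. \<forall>x. norm x \<le> 1 \<longrightarrow> norm (U \<delta> x) \<le> BU" unfolding U_def ..
  then have BU: "norm (U \<delta> x) \<le> BU" if "\<delta> > 0" "norm x \<le> 1" for \<delta> x using that by simp
  have BU0: "BU \<ge> 0" by (rule order_trans[OF norm_ge_zero BU[of 1 0]]) auto
  from measure_\<mu>_ball obtain Bb where
    Bb': "Bb \<ge> 0 \<and> (\<forall>\<delta>>0. \<forall>x. measure \<mu> (ball x \<delta>) \<le> Bb * \<delta>\<^sup>2)" ..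
  have Bb: "Bb \<ge> 0" using Bb' ..
  have ball_le: "measure \<mu> (ball x \<delta>) \<le> Bb * \<delta>\<^sup>2" if "\<delta> > 0" for \<delta> x using that Bb' by auto
  let ?S = "\<lambda>x. 2 * T x + x \<bullet> gT x + T x * (x \<bullet> w_grad x)"
  have Sc: "continuous_on UNIV ?S"
    by (intro continuous_on_add continuous_on_mult continuous_on_inner Tc T(2) w_grad_continuous
        continuous_on_const continuous_on_id)
  have S0: "?S x = 0" if "norm x > 1/2" for x using that by (simp add: T(3) gT0)
  obtain K1 where K10: "K1 \<ge> 0" and K1: "\<And>x. norm (?S x) \<le> K1"
    using bounded_if_compact_support[OF Sc S0] by blast
  obtain K2 where K20: "K2 \<ge> 0" and K2: "\<And>x. norm (T x) \<le> K2"
    using bounded_if_compact_support[OF Tc T(3)] by blast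
  define K0 where "K0 = K1 + K2 * BU"
  have K00: "K0 \<ge> 0" using K10 K20 BU0 unfolding K0_def by simp
  \<comment> \<open>the constant in front of \<open>e\<close> once all regularisation errors are added up\<close>
  define B where "B = 4 * pi * (2 * EM * K0 * pi) + lam * Bb + 1"
  have lam0: "lam \<ge> 0" unfolding lam_def by (intro integral_nonneg_AE) (simp add: F_nonneg)
  have B0: "B > 0" using EM K00 lam0 Bb unfolding B_def by (intro add_nonneg_pos add_nonneg_nonneg) auto
  define e where "e = min (1/2) (e0 / B)"
  have e: "e > 0" "e \<le> 1/2" "B * e \<le> e0" using e0 B0 by (auto simp: e_def min_def field_simps)
  have "(1/2::real) < 1" by simp
  from Vm_converges[OF this e(1)] obtain \<delta>0 where
    \<delta>0: "\<delta>0 > 0" "\<And>\<delta> x. 0 < \<delta> \<Longrightarrow> \<delta> \<le> \<delta>0 \<Longrightarrow> norm x \<le> 1/2 \<Longrightarrow> \<bar>Vm \<delta> x - (v x - c)\<bar> \<le> e" by blast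
  define \<delta> where "\<delta> = min \<delta>0 (min e (1/4))"
  have \<delta>: "\<delta> > 0" "\<delta> \<le> \<delta>0" "\<delta> \<le> e" "\<delta> \<le> 1/4" using \<delta>0(1) e by (auto simp: \<delta>_def)
  have "\<delta>\<^sup>2 \<le> \<delta> * 1" unfolding power2_eq_square using \<delta> by (intro mult_left_mono) auto
  then have \<delta>2: "\<delta>\<^sup>2 \<le> e" using \<delta> by simp
  \<comment> \<open>smooth on the whole plane; on the disc of radius \<open>1/2\<close> it is \<open>c + Vm \<delta>\<close>, hence close to \<open>v\<close>\<close>
  define vd where "vd x = c + ((Vm (1/4) x + Fl (1/4) x) - Fl \<delta> x)" for x
  have vd_grad: "GDERIV vd x :> w_grad x - U \<delta> x" for x
    using GDERIV_add[OF GDERIV_const[of c x] GDERIV_diff[OF w_GDERIV Fl_GDERIV[OF \<delta>(1)]]]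
    unfolding vd_def[abs_def] U_def by simp
  have vd_near: "\<bar>vd x - (V x + c)\<bar> \<le> e" if "norm x \<le> 1/2" for x
  proof -
    have "vd x = c + Vm \<delta> x"
      using mollified_representation[OF \<delta>(1,4), of x] that by (simp add: vd_def)
    then show ?thesis using \<delta>0(2)[OF \<delta>(1,2) that] that by (simp add: V_eq)
  qed
  have vdc: "continuous_on UNIV vd" by (rule GDERIV_continuous_on[OF vd_grad])
  have Uc: "continuous_on UNIV (U \<delta>)"
    unfolding U_def[abs_def] by (rule Fl_grad_continuous[OF \<delta>(1)])
  \<comment> \<open>the integrand of Euler's identity for \<open>T exp vd\<close>, divided by the exponential\<close>
  define Z where "Z x = 2 * T x + x \<bullet> gT x + T x * (x \<bullet> (w_grad x - U \<delta> x))" for x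
  have Zc: "continuous_on UNIV Z"
    unfolding Z_def[abs_def]
    by (intro continuous_on_add continuous_on_mult continuous_on_inner continuous_on_diff Tc T(2) w_grad_continuous Uc
        continuous_on_const continuous_on_id)
  have Z0: "Z x = 0" if "norm x > 1/2" for x using that by (simp add: T(3) gT0 Z_def)
  have Z_bound: "\<bar>Z x\<bar> \<le> K0" if x: "norm x \<le> 1/2" for x
  proof -
    have "Z x = ?S x - T x * (x \<bullet> U \<delta> x)" by (simp add: Z_def inner_diff_right algebra_simps)
    moreover have "\<bar>T x * (x \<bullet> U \<delta> x)\<bar> \<le> K2 * BU"
    proof -
      have "\<bar>x \<bullet> U \<delta> x\<bar> \<le> norm x * norm (U \<delta> x)" by (rule Cauchy_Schwarz_ineq2)
      also have "\<dots> \<le> 1 * BU" using x by (intro mult_mono BU \<delta>) auto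
      finally show ?thesis unfolding abs_mult using K2[of x] K20 by (intro mult_mono) auto
    qed
    ultimately show ?thesis using K1[of x] abs_triangle_ineq4[of "?S x" "T x * (x \<bullet> U \<delta> x)"]
      unfolding K0_def real_norm_def by linarith
  qed
  have euler: "(\<integral>x. exp (vd x) * Z x \<partial>lborel) = 0"
  proof -
    let ?Y = "\<lambda>x. T x * exp (vd x)"
    let ?GY = "\<lambda>x. T x *\<^sub>R (exp (vd x) *\<^sub>R (w_grad x - U \<delta> x)) + exp (vd x) *\<^sub>R gT x"
    have "GDERIV ?Y x :> ?GY x" for x
      by (rule GDERIV_mult[OF T(1) GDERIV_DERIV_compose[OF vd_grad DERIV_exp]])
    moreover have expc: "continuous_on UNIV (\<lambda>x. exp (vd x))" by (intro continuous_on_exp vdc)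
    moreover have GYc: "continuous_on UNIV ?GY"
      by (intro continuous_on_add continuous_on_scaleR continuous_on_diff Tc T(2) w_grad_continuous Uc expc)
    ultimately have "(\<integral>x. (x - 0) \<bullet> ?GY x \<partial>lborel) = - real DIM(real^2) * (\<integral>x. ?Y x \<partial>lborel)"
      by (intro integral_Euler_identity[where R = "1/2"]) (simp_all add: T(3))
    then have "(\<integral>x. x \<bullet> ?GY x \<partial>lborel) + (\<integral>x. 2 * ?Y x \<partial>lborel) = 0" by simp
    moreover have "integrable lborel (\<lambda>x. x \<bullet> ?GY x)" "integrable lborel (\<lambda>x. 2 * ?Y x)"
      by (rule integrable_continuous_support[of _ "1/2"];
          (intro continuous_on_inner continuous_on_id GYc continuous_on_mult Tc expc continuous_on_const)?;
          simp add: T(3) gT0)+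
    ultimately have "(\<integral>x. x \<bullet> ?GY x + 2 * ?Y x \<partial>lborel) = 0" by simp
    moreover have "(\<lambda>x. x \<bullet> ?GY x + 2 * ?Y x) = (\<lambda>x. exp (vd x) * Z x)"
      by (rule ext) (simp add: Z_def inner_add_right algebra_simps)
    ultimately show ?thesis by (simp only:)
  qed
  have Z_int: "integrable lborel (\<lambda>x. exp (vd x) * Z x)"
    by (rule integrable_continuous_support[of _ "1/2"])
       (auto intro!: continuous_on_mult continuous_on_exp vdc Zc simp: Z0 simp del: mult_eq_0_iff)
  have [measurable]: "T \<in> borel_measurable borel" "gT \<in> borel_measurable borel" "w_grad \<in> borel_measurable borel"
    "U \<delta> \<in> borel_measurable borel" "\<psi> \<in> borel_measurable borel"
    by (rule borel_measurable_continuous_onI[OF Tc] borel_measurable_continuous_onI[OF T(2)]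
        borel_measurable_continuous_onI[OF w_grad_continuous] borel_measurable_continuous_onI[OF Uc]
        borel_measurable_continuous_onI[OF \<psi>(1)])+
  have E_mult_int: "integrable lborel (\<lambda>x. E x * h x)"
    if h: "continuous_on UNIV h" "\<And>x. norm x > 1/2 \<Longrightarrow> h x = 0" for h :: "real^2 \<Rightarrow> real"
  proof (rule Bochner_Integration.integrable_bound)
    show "integrable lborel (\<lambda>x. EM * h x)"
      using integrable_continuous_support[of h "1/2", OF h] by simp
    show "(\<lambda>x. E x * h x) \<in> borel_measurable lborel"
      using borel_measurable_continuous_onI[OF h(1)] by measurable
    show "AE x in lborel. norm (E x * h x) \<le> norm (EM * h x)"
      using mult_right_mono[OF E_le abs_ge_zero] EM by (auto simp: abs_mult E_def)
  qed
  have EZ_int: "integrable lborel (\<lambda>x. E x * Z x)" by (rule E_mult_int[OF Zc Z0])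
  \<comment> \<open>\<open>E\<close> may replace \<open>exp vd\<close> since \<open>Z\<close> is bounded uniformly in \<open>\<delta>\<close>\<close>
  have main: "\<bar>\<integral>x. E x * Z x \<partial>lborel\<bar> \<le> 2 * e * EM * K0 * pi"
  proof -
    have "(\<integral>x. E x * Z x \<partial>lborel) = (\<integral>x. E x * Z x - exp (vd x) * Z x \<partial>lborel)"
      using Bochner_Integration.integral_diff[OF EZ_int Z_int] euler by simp
    also have "norm \<dots> \<le> (\<integral>x. (2 * e * EM * K0) * indicator (cball 0 1) (x::real^2) \<partial>lborel)"
    proof (rule Bochner_Integration.integral_norm_bound_integral)
      show "integrable lborel (\<lambda>x. (2 * e * EM * K0) * indicat_real (cball 0 1) (x::real^2))"
        using emeasure_bounded_finite[OF bounded_cball[of "0::real^2" 1]] by auto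
      fix x
      show "norm (E x * Z x - exp (vd x) * Z x) \<le> (2 * e * EM * K0) * indicator (cball 0 1) x"
      proof (cases "norm x \<le> 1/2")
        case True
        have "\<bar>exp (vd x) - E x\<bar> \<le> 2 * e * EM"
        proof -
          define t where "t = vd x - (V x + c)"
          have t: "\<bar>t\<bar> \<le> e" using vd_near[OF True] by (simp add: t_def)
          have "exp (vd x) - E x = E x * (exp t - 1)"
            by (simp add: E_def t_def right_diff_distrib flip: exp_add)
          moreover have "\<bar>exp t - 1\<bar> \<le> 2 * e"
          proof -
            have "exp \<bar>t\<bar> \<le> 1 + 2 * \<bar>t\<bar>" using exp_bound_lemma[of "\<bar>t\<bar>"] t e by simp
            moreover have "exp t \<le> exp \<bar>t\<bar>" by simp
            moreover have "1 + t \<le> exp t" by (rule exp_ge_add_one_self)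
            ultimately have "exp t - 1 \<le> 2 * e" "- (2 * e) \<le> exp t - 1" using t e(1) by linarith+
            then show ?thesis by (simp add: abs_le_iff)
          qed
          ultimately show ?thesis
            using mult_mono[OF E_le, of "\<bar>exp t - 1\<bar>" "2 * e" x] EM e
            by (simp add: abs_mult E_def mult.commute)
        qed
        then have "\<bar>E x - exp (vd x)\<bar> * \<bar>Z x\<bar> \<le> (2 * e * EM) * K0"
          using Z_bound[OF True] e EM by (intro mult_mono) auto
        moreover have "E x * Z x - exp (vd x) * Z x = (E x - exp (vd x)) * Z x"
          by (rule left_diff_distrib[symmetric])
        then have "norm (E x * Z x - exp (vd x) * Z x) = \<bar>E x - exp (vd x)\<bar> * \<bar>Z x\<bar>"
          by (simp only: real_norm_def abs_mult)
        moreover have "indicat_real (cball 0 1) x = 1" using True by simp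
        ultimately show ?thesis by (simp only: mult.right_neutral)
      next
        case False
        then have "Z x = 0" using Z0 by simp
        then show ?thesis using e EM K00 by (simp only: mult_zero_right diff_self norm_zero) simp
      qed
    qed (use EZ_int Z_int in simp)
    also have "\<dots> = 2 * e * EM * K0 * pi" by (simp add: measure_cball_plane)
    finally show ?thesis by simp
  qed
  define A where "A = (\<integral>x. E x * (T x * (x \<bullet> w_grad x)) \<partial>lborel)"
  define S where "S = (\<integral>x. E x * (T x * (x \<bullet> U \<delta> x)) \<partial>lborel)"
  have split: "(\<integral>x. E x * Z x \<partial>lborel) = D + A - S"
  proof -
    have 1: "integrable lborel (\<lambda>x. E x * (2 * T x + x \<bullet> gT x))"
      by (rule E_mult_int)
         (auto intro!: continuous_on_add continuous_on_mult continuous_on_inner Tc T(2) continuous_on_const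
           continuous_on_id simp: T(3) gT0)
    have 2: "integrable lborel (\<lambda>x. E x * (T x * (x \<bullet> w_grad x)))"
      by (rule E_mult_int)
         (auto intro!: continuous_on_mult continuous_on_inner Tc w_grad_continuous continuous_on_id simp: T(3))
    have 3: "integrable lborel (\<lambda>x. E x * (T x * (x \<bullet> U \<delta> x)))"
      by (rule E_mult_int)
         (auto intro!: continuous_on_mult continuous_on_inner Tc Uc continuous_on_id simp: T(3))
    have "(\<lambda>x. E x * Z x) = (\<lambda>x. E x * (2 * T x + x \<bullet> gT x) + E x * (T x * (x \<bullet> w_grad x)) - E x * (T x * (x \<bullet> U \<delta> x)))"
      by (rule ext) (simp add: Z_def inner_diff_right algebra_simps)
    then show ?thesis
      unfolding D_def A_def S_def
      by (simp only: Bochner_Integration.integral_diff[OF Bochner_Integration.integrable_add[OF 1 2] 3]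
          Bochner_Integration.integral_add[OF 1 2])
  qed
  have i_psi: "integrable lborel (\<lambda>x. F x * (\<psi> x * norm x))"
    by (rule integrable_mult_continuous[OF F_integrable F_out])
       (auto intro!: continuous_on_mult \<psi>(1) continuous_on_norm continuous_on_id)
  have A_bound: "\<bar>A\<bar> \<le> G * (\<integral>x. F x * (\<psi> x * norm x) \<partial>lborel)"
  proof -
    have "norm A \<le> (\<integral>x. G * (F x * (\<psi> x * norm x)) \<partial>lborel)"
      unfolding A_def
    proof (rule Bochner_Integration.integral_norm_bound_integral)
      show "integrable lborel (\<lambda>x. E x * (T x * (x \<bullet> w_grad x)))"
        by (rule E_mult_int)
           (auto intro!: continuous_on_mult continuous_on_inner Tc w_grad_continuous continuous_on_id simp: T(3))
      fix x
      have "E x * (T x * (x \<bullet> w_grad x)) = \<psi> x * F x * (x \<bullet> w_grad x)" by (simp add: fTE)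
      also have "norm \<dots> \<le> G * (F x * (\<psi> x * norm x))"
      proof (cases "norm x \<le> 1/2")
        case True
        have "\<bar>x \<bullet> w_grad x\<bar> \<le> norm x * norm (w_grad x)" by (rule Cauchy_Schwarz_ineq2)
        also have "\<dots> \<le> norm x * G"
          unfolding G_def lam_def by (intro mult_left_mono w_grad_bound[OF lower upper C0 M True]) auto
        finally have "(\<psi> x * F x) * \<bar>x \<bullet> w_grad x\<bar> \<le> (\<psi> x * F x) * (norm x * G)"
          using \<psi>(2) F_nonneg by (intro mult_left_mono) auto
        then show ?thesis using \<psi>(2)[of x] F_nonneg[of x] by (simp add: abs_mult mult_ac)
      qed (simp add: \<psi>(4))
      finally show "norm (E x * (T x * (x \<bullet> w_grad x))) \<le> G * (F x * (\<psi> x * norm x))" .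
    qed (use i_psi in simp)
    then show ?thesis by simp
  qed
  have S_bound: "\<bar>4 * pi * S - lam\<^sup>2\<bar> \<le> lam * (2 * (L + 1) * measure \<mu> {x. norm x > r} + Bb * \<delta>\<^sup>2)"
  proof -
    let ?a = "\<lambda>x. \<psi> x *\<^sub>R x"
    have [measurable]: "log_grad \<delta> \<in> borel_measurable borel"
      by (rule borel_measurable_continuous_onI[OF continuous_on_log_grad])
    have lam: "measure \<mu> UNIV = lam" by (simp add: measure_\<mu> lam_def)
    have inner: "(\<integral>y. ?a x \<bullet> log_grad \<delta> (x - y) \<partial>\<mu>) = ?a x \<bullet> U \<delta> x" for x
    proof -
      have "(\<integral>y. ?a x \<bullet> log_grad \<delta> (x - y) \<partial>\<mu>) = (\<integral>y. ?a x \<bullet> (F y *\<^sub>R log_grad \<delta> (x - y)) \<partial>lborel)"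
        by (subst integral_\<mu>) (simp_all add: mult.left_commute mult.commute)
      also have "\<dots> = ?a x \<bullet> U \<delta> x"
        unfolding U_def
        by (rule integral_inner_right)
           (rule convolution_kernel_integrable[OF F_integrable _ continuous_on_log_grad, of 1], simp add: F_out)
      finally show ?thesis .
    qed
    have "(\<integral>x. \<integral>y. ?a x \<bullet> log_grad \<delta> (x - y) \<partial>\<mu> \<partial>\<mu>) = (\<integral>x. F x *\<^sub>R (?a x \<bullet> U \<delta> x) \<partial>lborel)"
      unfolding inner by (rule integral_\<mu>) measurable
    also have "\<dots> = S"
      unfolding S_def
    proof (rule Bochner_Integration.integral_cong[OF refl])
      fix x
      show "F x *\<^sub>R (?a x \<bullet> U \<delta> x) = E x * (T x * (x \<bullet> U \<delta> x))"
        using fTE[of x] by (simp add: algebra_simps)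
    qed
    finally have S_eq: "S = (\<integral>x. \<integral>y. ?a x \<bullet> log_grad \<delta> (x - y) \<partial>\<mu> \<partial>\<mu>)" by simp
    have a_bound: "norm (?a x) \<le> 1" for x
    proof (cases "norm x \<le> 1/2")
      case True
      have "\<psi> x * norm x \<le> 1 * (1/2)" using True \<psi>(2,3) by (intro mult_mono) auto
      then show ?thesis using \<psi>(2)[of x] by simp
    qed (simp add: \<psi>(4))
    show ?thesis
      unfolding S_eq lam[symmetric]
      by (rule symmetrized_energy_estimate[OF finite_\<mu> sets_\<mu> _ a_bound Lip L _ \<delta>(1) ball_le[OF \<delta>(1)]])
         (simp_all add: \<psi>(5))
  qed
  have "4 * pi * D - lam\<^sup>2 = 4 * pi * (D + A - S) - 4 * pi * A + (4 * pi * S - lam\<^sup>2)"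
    by (simp add: algebra_simps)
  also have "\<bar>\<dots>\<bar> \<le> 4 * pi * \<bar>D + A - S\<bar> + 4 * pi * \<bar>A\<bar> + \<bar>4 * pi * S - lam\<^sup>2\<bar>"
  proof -
    have "\<bar>p - q + s\<bar> \<le> \<bar>p\<bar> + \<bar>q\<bar> + \<bar>s\<bar>" for p q s :: real by linarith
    from this[of "4 * pi * (D + A - S)" "4 * pi * A" "4 * pi * S - lam\<^sup>2"] show ?thesis
      by (simp add: abs_mult)
  qed
  also have "\<dots> \<le> 4 * pi * (2 * e * EM * K0 * pi) + 4 * pi * (G * (\<integral>x. F x * (\<psi> x * norm x) \<partial>lborel))
      + lam * (2 * (L + 1) * measure \<mu> {x. norm x > r} + Bb * \<delta>\<^sup>2)"
    using main A_bound S_bound unfolding split by (intro add_mono mult_left_mono) auto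
  also have "lam * (2 * (L + 1) * measure \<mu> {x. norm x > r} + Bb * \<delta>\<^sup>2)
      \<le> 2 * (L + 1) * lam * measure \<mu> {x. norm x > r} + lam * Bb * e"
    using mult_left_mono[OF \<delta>2, of "lam * Bb"] lam0 Bb by (simp add: algebra_simps)
  finally have "\<bar>4 * pi * D - lam\<^sup>2\<bar> \<le> 4 * pi * G * (\<integral>x. F x * (\<psi> x * norm x) \<partial>lborel)
       + 2 * (L + 1) * lam * measure \<mu> {x. norm x > r} + (4 * pi * (2 * EM * K0 * pi) + lam * Bb) * e"
    by (simp add: algebra_simps)
  moreover have "(4 * pi * (2 * EM * K0 * pi) + lam * Bb) * e \<le> B * e"
    unfolding B_def using e by (intro mult_right_mono) auto
  ultimately show "\<bar>4 * pi * (\<integral>x. exp (V x + c) * (2 * T x + x \<bullet> gT x) \<partial>lborel) - lam\<^sup>2\<bar>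
    \<le> 4 * pi * (M * (lam / 4 + (C0 + 1) * pi) + 8 * lam) * (\<integral>x. F x * (\<psi> x * norm x) \<partial>lborel)
       + 2 * (L + 1) * lam * measure \<mu> {x. norm x > r} + e0"
    using e(3) unfolding D_def E_def G_def by linarith
qed

end

section \<open>Cutoff functions\<close>

definition cutoff :: "real \<Rightarrow> real^2 \<Rightarrow> real" where
  "cutoff \<rho> x = 1 - cap_mass ((norm x)\<^sup>2 / \<rho>\<^sup>2)"

definition cutoff_grad :: "real \<Rightarrow> real^2 \<Rightarrow> real^2" where
  "cutoff_grad \<rho> x = (2 * (- deriv cap_mass ((norm x)\<^sup>2 / \<rho>\<^sup>2) / \<rho>\<^sup>2)) *\<^sub>R x"

lemma cutoff_nonneg: "0 \<le> cutoff \<rho> x" and cutoff_le_1: "cutoff \<rho> x \<le> 1"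
  using cap_mass_nonneg cap_mass_le_1 by (simp_all add: cutoff_def)

lemma cutoff_eq_1:
  assumes "\<rho> > 0" "norm x \<le> \<rho> / 2"
  shows "cutoff \<rho> x = 1"
proof -
  have "(norm x)\<^sup>2 \<le> (\<rho> / 2)\<^sup>2" using assms by (intro power_mono) auto
  then have "4 * (norm x)\<^sup>2 \<le> \<rho>\<^sup>2" by (simp add: power_divide)
  then have "2 * (norm x)\<^sup>2 \<le> \<rho>\<^sup>2" using zero_le_power2[of "norm x"] by linarith
  then have "(norm x)\<^sup>2 / \<rho>\<^sup>2 \<le> 1 / 2" using assms by (simp add: field_simps)
  then show ?thesis by (simp add: cutoff_def cap_mass_eq_0)
qed

lemma cutoff_eq_0:
  assumes "\<rho> > 0" "norm x \<ge> \<rho>"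
  shows "cutoff \<rho> x = 0"
proof -
  have "(norm x)\<^sup>2 / \<rho>\<^sup>2 \<ge> 1" using assms by (simp add: power_mono)
  then show ?thesis by (simp add: cutoff_def cap_mass_eq_1)
qed

lemma cutoff_continuous: "continuous_on A (cutoff \<rho>)"
  unfolding cutoff_def[abs_def]
  by (intro continuous_on_diff continuous_on_const continuous_on_smooth1_radial smooth1_cap_mass)

lemma cutoff_grad_continuous: "continuous_on A (cutoff_grad \<rho>)"
  unfolding cutoff_grad_def[abs_def] divide_inverse[of "- _"]
  by (intro continuous_on_scaleR continuous_on_mult continuous_on_minus continuous_on_const continuous_on_id
      continuous_on_smooth1_radial smooth1_deriv_mem smooth1_cap_mass)

lemma cutoff_GDERIV: "GDERIV (cutoff \<rho>) x :> cutoff_grad \<rho> x"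
proof -
  have "((\<lambda>t. 1 - cap_mass (t / \<rho>\<^sup>2)) has_real_derivative - deriv cap_mass (t / \<rho>\<^sup>2) / \<rho>\<^sup>2) (at t)" for t
    using DERIV_diff[OF DERIV_const[of 1] DERIV_scale[OF smooth1_DERIV[OF smooth1_cap_mass], where c = "\<rho>\<^sup>2"]]
    by simp
  from GDERIV_radial[where a = 0, OF this] show ?thesis
    by (simp only: cutoff_def[abs_def] cutoff_grad_def diff_zero)
qed

lemma cutoff_grad_eq_0:
  assumes "\<rho> > 0" "norm x > \<rho>"
  shows "cutoff_grad \<rho> x = 0"
  by (rule GDERIV_zero_outside[OF cutoff_GDERIV _ assms(2)]) (use assms(1) cutoff_eq_0 in auto)

text \<open>The difference is split so that the increment of the cutoff multiplies a point of its support.\<close>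

lemma cutoff_identity_Lipschitz:
  assumes "\<rho> > 0"
  shows "\<exists>L\<ge>0. \<forall>x y. norm (cutoff \<rho> x *\<^sub>R x - cutoff \<rho> y *\<^sub>R y) \<le> L * norm (x - y)"
proof -
  obtain M where "M \<ge> 0" and M: "\<And>x. norm (cutoff_grad \<rho> x) \<le> M"
    using bounded_if_compact_support[OF cutoff_grad_continuous cutoff_grad_eq_0[OF assms]] by blast
  have lip: "\<bar>cutoff \<rho> x - cutoff \<rho> y\<bar> \<le> M * norm (x - y)" for x y
    by (rule GDERIV_bounded_imp_Lipschitz[OF cutoff_GDERIV M])
  \<comment> \<open>by symmetry one of the two points may be taken in the support\<close>
  have inside: "norm (cutoff \<rho> x *\<^sub>R x - cutoff \<rho> y *\<^sub>R y) \<le> (1 + M * \<rho>) * norm (x - y)"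
    if "norm y \<le> \<rho>" for x y
  proof -
    have "cutoff \<rho> x *\<^sub>R x - cutoff \<rho> y *\<^sub>R y = cutoff \<rho> x *\<^sub>R (x - y) + (cutoff \<rho> x - cutoff \<rho> y) *\<^sub>R y"
      by (simp add: algebra_simps)
    also have "norm \<dots> \<le> cutoff \<rho> x * norm (x - y) + \<bar>cutoff \<rho> x - cutoff \<rho> y\<bar> * norm y"
      using norm_triangle_ineq[of "cutoff \<rho> x *\<^sub>R (x - y)" "(cutoff \<rho> x - cutoff \<rho> y) *\<^sub>R y"]
        cutoff_nonneg[of \<rho> x] by simp
    also have "\<dots> \<le> 1 * norm (x - y) + (M * norm (x - y)) * \<rho>"
      using cutoff_le_1 lip that \<open>M \<ge> 0\<close> by (intro add_mono mult_right_mono mult_mono) auto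
    finally show ?thesis by (simp add: algebra_simps)
  qed
  have "norm (cutoff \<rho> x *\<^sub>R x - cutoff \<rho> y *\<^sub>R y) \<le> (1 + M * \<rho>) * norm (x - y)" for x y
  proof (cases "norm y \<le> \<rho>")
    case False
    show ?thesis
    proof (cases "norm x \<le> \<rho>")
      case True
      from inside[OF this, of y] show ?thesis by (simp add: norm_minus_commute)
    next
      case F: False
      then show ?thesis using False assms \<open>M \<ge> 0\<close> by (simp add: cutoff_eq_0)
    qed
  qed (rule inside)
  moreover have "1 + M * \<rho> \<ge> 0" using assms \<open>M \<ge> 0\<close> by simp
  ultimately show ?thesis by blast
qed

section \<open>The Pohozaev identity for the weighted equation\<close>

lemma h_weight_powr:
  "h_weight e x powr (2 * a) = (e\<^sup>2 + (norm x)\<^sup>2) powr a"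
proof -
  have "e\<^sup>2 + (norm x)\<^sup>2 \<ge> 0" by simp
  then have "h_weight e x = (e\<^sup>2 + (norm x)\<^sup>2) powr (1/2)" by (simp add: h_weight_def powr_half_sqrt)
  then show ?thesis by (simp add: powr_powr)
qed

lemma h_weight_powr_GDERIV:
  assumes "e > 0"
  shows "GDERIV (\<lambda>x. h_weight e x powr (2 * a)) x :> (2 * a * (e\<^sup>2 + (norm x)\<^sup>2) powr (a - 1)) *\<^sub>R x"
proof -
  have pos: "e\<^sup>2 + (norm (x - 0))\<^sup>2 > 0" using assms by (simp add: add_pos_nonneg)
  have "((\<lambda>t. (e\<^sup>2 + t) powr a) has_real_derivative a * (e\<^sup>2 + (norm (x - 0))\<^sup>2) powr (a - 1)) (at ((norm (x - 0))\<^sup>2))"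
    using DERIV_chain2[OF has_real_derivative_powr[OF pos, of a] DERIV_add[OF DERIV_const DERIV_ident]] by simp
  from GDERIV_radial[OF this] show ?thesis
    unfolding h_weight_powr by (simp add: mult.assoc)
qed

lemma h_weight_powr_continuous:
  assumes "e > 0"
  shows "continuous_on A (\<lambda>x. h_weight e x powr (2 * a))"
  by (rule GDERIV_continuous_on[OF h_weight_powr_GDERIV[OF assms]])

definition gradient :: "('a::euclidean_space \<Rightarrow> real) \<Rightarrow> 'a \<Rightarrow> 'a" where
  "gradient k x = (\<Sum>b\<in>Basis. partial_deriv b k x *\<^sub>R b)"

lemma gradient_Ck1:
  fixes k :: "'a::euclidean_space \<Rightarrow> real"
  assumes "Ck_on 1 S k"
  shows "continuous_on S (gradient k)" and "x \<in> S \<Longrightarrow> GDERIV k x :> gradient k x"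
proof -
  have "\<And>b. b \<in> Basis \<Longrightarrow> continuous_on S (partial_deriv b k)" using assms by simp
  then show "continuous_on S (gradient k)"
    unfolding gradient_def[abs_def]
    by (intro continuous_on_sum continuous_on_scaleR continuous_on_const)
  assume "x \<in> S"
  then have "k differentiable at x" using assms by simp
  then have d: "(k has_derivative frechet_derivative k (at x)) (at x)" by (simp add: frechet_derivative_works)
  then interpret bounded_linear "frechet_derivative k (at x)" by (rule has_derivative_bounded_linear)
  have "frechet_derivative k (at x) h = h \<bullet> gradient k x" for h
  proof -
    have "frechet_derivative k (at x) h = frechet_derivative k (at x) (\<Sum>b\<in>Basis. (h \<bullet> b) *\<^sub>R b)"
      by (simp add: euclidean_representation)
    also have "\<dots> = h \<bullet> gradient k x"
      by (simp add: sum scaleR gradient_def partial_deriv_def inner_sum_right mult.commute)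
    finally show ?thesis .
  qed
  then have "frechet_derivative k (at x) = (\<lambda>h. h \<bullet> gradient k x)" by (rule ext)
  with d show "GDERIV k x :> gradient k x" by (simp add: gderiv_def)
qed

lemma norm_gradient_le:
  fixes k :: "'a::euclidean_space \<Rightarrow> real"
  assumes "\<And>b. b \<in> Basis \<Longrightarrow> \<bar>partial_deriv b k x\<bar> \<le> B"
  shows "norm (gradient k x) \<le> real DIM('a) * B"
proof -
  have "norm (gradient k x) \<le> (\<Sum>b\<in>(Basis::'a set). norm (partial_deriv b k x *\<^sub>R b))"
    unfolding gradient_def by (rule norm_sum)
  also have "\<dots> \<le> (\<Sum>b\<in>(Basis::'a set). B)" by (intro sum_mono) (use assms in auto)
  finally show ?thesis by simp
qed

text \<open>Here \<open>T\<close> is the cutoff times the weight \<open>W\<close> times \<open>k\<close>, and \<open>x \<bullet> \<nabla>T\<close> is expanded. The weight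
  contributes \<open>2 a\<close> times the factor \<open>|x|\<^sup>2 / (e\<^sup>2 + |x|\<^sup>2)\<close>, which lies between 0 and 1; its integral
  against the cut off density is \<open>I\<close>. The term with \<open>\<nabla>k\<close> carries no factor \<open>k\<close>; the lower bound
  \<open>k \<ge> k0\<close> on the support of the cutoff turns it into an integral against the density.\<close>

lemma weighted_pohozaev:
  fixes v k :: "real^2 \<Rightarrow> real" and e a c C0 :: real
  defines "W \<equiv> \<lambda>x. h_weight e x powr (2 * a)"
  defines "f \<equiv> \<lambda>x. W x * k x * exp (v x)"
  defines "\<nu> \<equiv> density_on (ball 0 1) f"
  defines "lam \<equiv> measure \<nu> UNIV"
  assumes e: "e > 0"
    and k_cont: "continuous_on (cball 0 1) k" and k_nonneg: "\<And>x. x \<in> cball 0 1 \<Longrightarrow> k x \<ge> 0"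
    and k_C1: "Ck_on 1 (ball 0 1) k"
    and v_cont: "continuous_on (cball 0 1) v"
    and sol: "poisson_solution_on (ball 0 1) v f"
    and lower: "\<And>x. norm x = 1 \<Longrightarrow> c \<le> v x" and upper: "\<And>x. norm x = 1 \<Longrightarrow> v x \<le> c + C0" and C0: "C0 \<ge> 0"
    and M: "\<And>x. norm (mollifier_grad (1/4) x) \<le> M"
    and \<rho>: "0 < \<rho>" "\<rho> \<le> 1/2" and k0: "k0 > 0" "\<And>x. norm x \<le> \<rho> \<Longrightarrow> k x \<ge> k0"
    and B: "\<And>x. norm x \<le> \<rho> \<Longrightarrow> norm (gradient k x) \<le> B"
    and L: "L \<ge> 0" "\<And>x y. norm (cutoff \<rho> x *\<^sub>R x - cutoff \<rho> y *\<^sub>R y) \<le> L * norm (x - y)"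
  shows "\<exists>I. 0 \<le> I \<and> I \<le> integral\<^sup>L \<nu> (cutoff \<rho>) \<and>
    \<bar>4 * pi * (2 * integral\<^sup>L \<nu> (cutoff \<rho>) + 2 * a * I) - lam\<^sup>2\<bar>
      \<le> 4 * pi * \<bar>\<integral>x. x \<bullet> cutoff_grad \<rho> x \<partial>\<nu>\<bar>
        + 4 * pi * (B / k0 + M * (lam / 4 + (C0 + 1) * pi) + 8 * lam) * (\<integral>x. cutoff \<rho> x * norm x \<partial>\<nu>)
        + 2 * (L + 1) * lam * measure \<nu> {x. norm x > \<rho> / 2}"
proof -
  have Wc: "continuous_on A W" for A unfolding W_def by (rule h_weight_powr_continuous[OF e])
  have W_pos: "W x > 0" for x
  proof -
    have "e\<^sup>2 + (norm x)\<^sup>2 > 0" using e by (simp add: add_pos_nonneg)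
    then show ?thesis using e by (simp add: W_def h_weight_powr)
  qed
  interpret disc_poisson v f c
  proof
    show "continuous_on (cball 0 1) f"
      unfolding f_def by (intro continuous_on_mult Wc k_cont continuous_on_exp v_cont)
    show "f x \<ge> 0" if "x \<in> cball 0 1" for x
      unfolding f_def using k_nonneg[OF that] W_pos[of x] by simp
  qed fact+
  have \<mu>_eq: "\<mu> = \<nu>"
    by (simp add: \<mu>_def \<nu>_def density_on_def F_def)
  have int_\<nu>: "integral\<^sup>L \<nu> h = (\<integral>x. F x * h x \<partial>lborel)" if "continuous_on UNIV h" for h :: "real^2 \<Rightarrow> real"
    using integral_\<mu>[OF borel_measurable_continuous_onI[OF that]] by (simp add: \<mu>_eq)
  have lam_eq: "integral\<^sup>L lborel F = lam"
    using measure_\<mu>[of UNIV] by (simp add: \<mu>_eq lam_def)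
  let ?\<chi> = "cutoff \<rho>"
  define T where "T x = ?\<chi> x * (W x * k x)" for x
  define gW where "gW x = (2 * a * (e\<^sup>2 + (norm x)\<^sup>2) powr (a - 1)) *\<^sub>R x" for x :: "real^2"
  define gT0 where "gT0 x = ?\<chi> x *\<^sub>R (W x *\<^sub>R gradient k x + k x *\<^sub>R gW x) + (W x * k x) *\<^sub>R cutoff_grad \<rho> x" for x
  define gT where "gT x = (if norm x < 1 then gT0 x else 0)" for x
  have T_der0: "GDERIV T x :> gT0 x" if "norm x < 1" for x
  proof -
    have W': "GDERIV W x :> gW x" unfolding W_def gW_def by (rule h_weight_powr_GDERIV[OF e])
    have k': "GDERIV k x :> gradient k x" using gradient_Ck1(2)[OF k_C1, of x] that by simp
    show ?thesis unfolding T_def[abs_def] gT0_def by (rule GDERIV_mult[OF cutoff_GDERIV GDERIV_mult[OF W' k']])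
  qed
  have T_zero: "T x = 0" if "norm x > 1/2" for x
    using that \<rho> by (simp add: T_def cutoff_eq_0)
  let ?O = "{x::real^2. norm x > 1/2}"
  have O: "open ?O" by (intro open_Collect_less continuous_intros)
  have gT_zero: "gT x = 0" if "norm x > 1/2" for x
  proof (cases "norm x < 1")
    case True
    have "gT0 x = 0" by (rule GDERIV_zero_if_locally_zero[OF T_der0[OF True] O]) (use that T_zero in auto)
    then show ?thesis by (simp add: gT_def)
  qed (simp add: gT_def)
  have T_der: "GDERIV T x :> gT x" for x
  proof (cases "norm x < 1")
    case True
    then show ?thesis using T_der0 by (simp add: gT_def)
  next
    case False
    have "((\<lambda>_. 0) has_derivative (\<lambda>h. 0)) (at x)" by simp
    then have "(T has_derivative (\<lambda>h. 0)) (at x)"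
      by (rule has_derivative_transform_within_open[OF _ O]) (use False T_zero in auto)
    then show ?thesis using False by (simp add: gderiv_def gT_def)
  qed
  have gT_cont: "continuous_on UNIV gT"
  proof -
    have "continuous_on (ball 0 1) gT0"
      unfolding gT0_def[abs_def] gW_def
      using e by (intro continuous_intros cutoff_continuous cutoff_grad_continuous Wc gradient_Ck1(1)[OF k_C1]
          continuous_on_subset[OF k_cont]) (auto simp: add_pos_nonneg less_imp_neq[symmetric])
    then have 1: "continuous_on (ball 0 1) gT" by (rule continuous_on_eq) (simp add: gT_def)
    have 2: "continuous_on ?O gT" by (rule continuous_on_eq[OF continuous_on_const[of _ 0]]) (simp add: gT_zero)
    have "ball 0 1 \<union> ?O = UNIV" by auto
    then show ?thesis using continuous_on_open_Un[OF open_ball O 1 2] by simp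
  qed
  have fT: "?\<chi> x * f x = T x * exp (v x)" for x by (simp add: T_def f_def)
  have "cutoff \<rho> x = 0" if "norm x > 1/2" for x using that \<rho> by (simp add: cutoff_eq_0)
  from pohozaev_estimate[where r = "\<rho> / 2", OF lower upper C0 M T_der gT_cont T_zero cutoff_continuous cutoff_nonneg cutoff_le_1
      this cutoff_eq_1[OF \<rho>(1)] L(2,1) fT]
  have est: "\<bar>4 * pi * (\<integral>x. exp (V x + c) * (2 * T x + x \<bullet> gT x) \<partial>lborel) - lam\<^sup>2\<bar>
    \<le> 4 * pi * (M * (lam / 4 + (C0 + 1) * pi) + 8 * lam) * (\<integral>x. ?\<chi> x * norm x \<partial>\<nu>)
       + 2 * (L + 1) * lam * measure \<nu> {x. norm x > \<rho> / 2}"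
    unfolding \<mu>_eq lam_eq
    by (subst int_\<nu>) (auto intro!: continuous_on_mult cutoff_continuous continuous_on_norm continuous_on_id)
  define q where "q x = (norm x)\<^sup>2 / (e\<^sup>2 + (norm x)\<^sup>2)" for x :: "real^2"
  have q: "0 \<le> q x" "q x \<le> 1" for x
    using e by (auto simp: q_def field_simps add_pos_nonneg)
  have q_cont: "continuous_on UNIV q"
    unfolding q_def[abs_def] using e
    by (intro continuous_intros) (auto simp: add_pos_nonneg less_imp_neq[symmetric])
  define I where "I = (\<integral>x. F x * (?\<chi> x * q x) \<partial>lborel)"
  define R where "R x = ?\<chi> x * (W x * exp (V x + c)) * (x \<bullet> gradient k x)" for x
  \<comment> \<open>\<open>R\<close> collects the terms with \<open>\<nabla>k\<close>\<close>
  have expand: "exp (V x + c) * (2 * T x + x \<bullet> gT x)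
      = 2 * (F x * ?\<chi> x) + 2 * a * (F x * (?\<chi> x * q x)) + F x * (x \<bullet> cutoff_grad \<rho> x) + R x" for x
  proof (cases "norm x < 1")
    case True
    have pos: "e\<^sup>2 + (norm x)\<^sup>2 > 0" using e by (simp add: add_pos_nonneg)
    have "x \<bullet> gW x = 2 * a * (e\<^sup>2 + (norm x)\<^sup>2) powr (a - 1) * (norm x)\<^sup>2"
      by (simp add: gW_def power2_norm_eq_inner)
    also have "(e\<^sup>2 + (norm x)\<^sup>2) powr (a - 1) = W x / (e\<^sup>2 + (norm x)\<^sup>2)"
      using pos by (simp add: W_def h_weight_powr powr_diff)
    finally have xgW: "x \<bullet> gW x = 2 * a * q x * W x" by (simp add: q_def)
    have "x \<bullet> gT x = ?\<chi> x * (W x * (x \<bullet> gradient k x) + k x * (2 * a * q x * W x)) + W x * k x * (x \<bullet> cutoff_grad \<rho> x)"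
      using True by (simp add: gT_def gT0_def inner_add_right xgW)
    moreover have "F x = W x * k x * exp (v x)" unfolding F_eq[OF True] by (simp add: f_def)
    moreover have "exp (V x + c) = exp (v x)" using True by (simp add: V_eq)
    ultimately show ?thesis by (simp add: T_def R_def algebra_simps)
  next
    case False
    then have "?\<chi> x = 0" using \<rho> by (simp add: cutoff_eq_0)
    then show ?thesis using False T_zero[of x] gT_zero[of x] by (simp add: F_out R_def)
  qed
  have iF: "integrable lborel (\<lambda>x. F x * h x)" if "continuous_on UNIV h" for h
    using integrable_mult_continuous[OF F_integrable F_out that] by auto
  have i1: "integrable lborel (\<lambda>x. F x * ?\<chi> x)" by (rule iF[OF cutoff_continuous])
  have i2: "integrable lborel (\<lambda>x. F x * (?\<chi> x * q x))"
    by (intro iF continuous_on_mult cutoff_continuous q_cont)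
  have i3: "integrable lborel (\<lambda>x. F x * (x \<bullet> cutoff_grad \<rho> x))"
    by (intro iF continuous_on_inner continuous_on_id cutoff_grad_continuous)
  have i5: "integrable lborel (\<lambda>x. F x * (?\<chi> x * norm x))"
    by (intro iF continuous_on_mult cutoff_continuous continuous_on_norm continuous_on_id)
  have R_bound: "norm (R x) \<le> B / k0 * (F x * (?\<chi> x * norm x))" for x
  proof (cases "norm x < \<rho>")
    case True
    have x1: "norm x < 1" using True \<rho> by simp
    have B0: "B \<ge> 0" using order_trans[OF norm_ge_zero B[of x]] True by simp
    have "\<bar>x \<bullet> gradient k x\<bar> \<le> norm x * norm (gradient k x)" by (rule Cauchy_Schwarz_ineq2)
    also have "\<dots> \<le> norm x * B" using B[of x] True by (intro mult_left_mono) auto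
    finally have 1: "\<bar>x \<bullet> gradient k x\<bar> \<le> norm x * B" .
    have "norm (R x) = ?\<chi> x * (W x * exp (v x)) * \<bar>x \<bullet> gradient k x\<bar>"
      using x1 cutoff_nonneg[of \<rho> x] W_pos[of x] by (simp add: R_def V_eq abs_mult)
    also have "\<dots> \<le> ?\<chi> x * (W x * exp (v x)) * (norm x * B)"
      using 1 cutoff_nonneg[of \<rho> x] W_pos[of x] by (intro mult_left_mono) auto
    \<comment> \<open>the missing factor \<open>k\<close> is supplied by \<open>k0 \<le> k x\<close>\<close>
    also have "\<dots> = (?\<chi> x * (W x * exp (v x)) * norm x * (B / k0)) * k0" using k0 by simp
    also have "\<dots> \<le> (?\<chi> x * (W x * exp (v x)) * norm x * (B / k0)) * k x"
      using k0 True cutoff_nonneg[of \<rho> x] W_pos[of x] B0 by (intro mult_left_mono) auto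
    also have "\<dots> = B / k0 * (F x * (?\<chi> x * norm x))"
      unfolding F_eq[OF x1] by (simp add: f_def)
    finally show ?thesis .
  next
    case False
    then show ?thesis using \<rho> by (simp add: R_def cutoff_eq_0)
  qed
  have i4: "integrable lborel R"
  proof (rule Bochner_Integration.integrable_bound)
    show "integrable lborel (\<lambda>x. B / k0 * (F x * (?\<chi> x * norm x)))" using i5 by simp
    show "AE x in lborel. norm (R x) \<le> norm (B / k0 * (F x * (?\<chi> x * norm x)))"
      by (rule AE_I2, rule order_trans[OF R_bound]) (simp only: real_norm_def abs_ge_self)
    have "(\<lambda>x. exp (V x + c) * (2 * T x + x \<bullet> gT x)
        - (2 * (F x * ?\<chi> x) + 2 * a * (F x * (?\<chi> x * q x)) + F x * (x \<bullet> cutoff_grad \<rho> x))) \<in> borel_measurable lborel"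
    proof -
      have "continuous_on UNIV T" by (rule GDERIV_continuous_on[OF T_der])
      then have [measurable]: "T \<in> borel_measurable borel" "gT \<in> borel_measurable borel" "q \<in> borel_measurable borel"
        "cutoff \<rho> \<in> borel_measurable borel" "cutoff_grad \<rho> \<in> borel_measurable borel"
        by (auto intro!: borel_measurable_continuous_onI gT_cont q_cont cutoff_continuous cutoff_grad_continuous)
      show ?thesis by measurable
    qed
    then show "R \<in> borel_measurable lborel" unfolding expand by simp
  qed
  have D: "(\<integral>x. exp (V x + c) * (2 * T x + x \<bullet> gT x) \<partial>lborel)
      = 2 * integral\<^sup>L \<nu> ?\<chi> + 2 * a * I + (\<integral>x. x \<bullet> cutoff_grad \<rho> x \<partial>\<nu>) + integral\<^sup>L lborel R"
  proof -
    have "(\<integral>x. x \<bullet> cutoff_grad \<rho> x \<partial>\<nu>) = (\<integral>x. F x * (x \<bullet> cutoff_grad \<rho> x) \<partial>lborel)"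
      by (rule int_\<nu>) (intro continuous_on_inner continuous_on_id cutoff_grad_continuous)
    moreover have "integral\<^sup>L \<nu> ?\<chi> = (\<integral>x. F x * ?\<chi> x \<partial>lborel)" by (rule int_\<nu>[OF cutoff_continuous])
    ultimately show ?thesis
      unfolding expand I_def using i1 i2 i3 i4 by simp
  qed
  have R_int: "\<bar>integral\<^sup>L lborel R\<bar> \<le> B / k0 * (\<integral>x. ?\<chi> x * norm x \<partial>\<nu>)"
  proof -
    have "norm (integral\<^sup>L lborel R) \<le> (\<integral>x. B / k0 * (F x * (?\<chi> x * norm x)) \<partial>lborel)"
      by (rule Bochner_Integration.integral_norm_bound_integral[OF i4 _ R_bound]) (use i5 in simp)
    also have "\<dots> = B / k0 * (\<integral>x. ?\<chi> x * norm x \<partial>\<nu>)"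
      by (subst int_\<nu>) (auto intro!: continuous_on_mult cutoff_continuous continuous_on_norm continuous_on_id)
    finally show ?thesis by simp
  qed
  show ?thesis
  proof (intro exI[of _ I] conjI)
    show "0 \<le> I"
      unfolding I_def by (intro integral_nonneg_AE AE_I2 mult_nonneg_nonneg F_nonneg cutoff_nonneg q)
    show "I \<le> integral\<^sup>L \<nu> ?\<chi>"
      unfolding I_def int_\<nu>[OF cutoff_continuous]
    proof (rule integral_mono[OF i2 i1])
      fix x show "F x * (?\<chi> x * q x) \<le> F x * ?\<chi> x"
        using mult_left_mono[OF q(2) cutoff_nonneg[of \<rho> x], of x] by (intro mult_left_mono F_nonneg) simp
    qed
    let ?X = "2 * integral\<^sup>L \<nu> ?\<chi> + 2 * a * I" and ?J = "\<integral>x. x \<bullet> cutoff_grad \<rho> x \<partial>\<nu>"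
    let ?N = "\<integral>x. ?\<chi> x * norm x \<partial>\<nu>"
    have "4 * pi * ?X - lam\<^sup>2 = (4 * pi * (?X + ?J + integral\<^sup>L lborel R) - lam\<^sup>2) - 4 * pi * ?J - 4 * pi * integral\<^sup>L lborel R"
      by (simp add: algebra_simps)
    also have "\<bar>\<dots>\<bar> \<le> \<bar>4 * pi * (?X + ?J + integral\<^sup>L lborel R) - lam\<^sup>2\<bar> + 4 * pi * \<bar>?J\<bar> + 4 * pi * \<bar>integral\<^sup>L lborel R\<bar>"
    proof -
      have "\<bar>p - y - z\<bar> \<le> \<bar>p\<bar> + \<bar>y\<bar> + \<bar>z\<bar>" for p y z :: real by linarith
      from this[of "4 * pi * (?X + ?J + integral\<^sup>L lborel R) - lam\<^sup>2" "4 * pi * ?J" "4 * pi * integral\<^sup>L lborel R"]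
      show ?thesis by (simp add: abs_mult)
    qed
    also have "\<dots> \<le> (4 * pi * (M * (lam / 4 + (C0 + 1) * pi) + 8 * lam) * ?N
       + 2 * (L + 1) * lam * measure \<nu> {x. norm x > \<rho> / 2}) + 4 * pi * \<bar>?J\<bar> + 4 * pi * (B / k0 * ?N)"
      using est R_int unfolding D by (intro add_mono mult_left_mono) auto
    also have "\<dots> = 4 * pi * \<bar>?J\<bar> + 4 * pi * (B / k0 + M * (lam / 4 + (C0 + 1) * pi) + 8 * lam) * ?N
        + 2 * (L + 1) * lam * measure \<nu> {x. norm x > \<rho> / 2}"
      by (simp add: algebra_simps)
    finally show "\<bar>4 * pi * ?X - lam\<^sup>2\<bar> \<le> 4 * pi * \<bar>?J\<bar>
        + 4 * pi * (B / k0 + M * (lam / 4 + (C0 + 1) * pi) + 8 * lam) * ?N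
        + 2 * (L + 1) * lam * measure \<nu> {x. norm x > \<rho> / 2}" .
  qed
qed

section \<open>The concentration limit\<close>

lemma integral_scaled_dirac:
  fixes \<psi> :: "'a::euclidean_space \<Rightarrow> real"
  assumes "\<beta> > 0" "continuous_on UNIV \<psi>"
  shows "integral\<^sup>L (scale_measure (ennreal \<beta>) (dirac p)) \<psi> = \<beta> * \<psi> p"
proof -
  have m: "\<psi> \<in> borel_measurable (return borel p)"
    using borel_measurable_continuous_onI[OF assms(2)] by simp
  have "scale_measure (ennreal \<beta>) (return borel p) = density (return borel p) (\<lambda>_. ennreal \<beta>)"
    by (rule measure_eqI) (simp_all add: emeasure_density_const)
  then have "integral\<^sup>L (scale_measure (ennreal \<beta>) (dirac p)) \<psi> = (\<integral>x. \<beta> *\<^sub>R \<psi> x \<partial>return borel p)"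
    unfolding dirac_def using assms(1) m by (simp only:) (rule integral_density, auto)
  also have "\<dots> = \<beta> * \<psi> p" using m by (subst integral_return) auto
  finally show ?thesis .
qed

lemma compactly_supported_in_ball:
  fixes \<psi> :: "'a::euclidean_space \<Rightarrow> real"
  assumes "r < 1" "\<And>x. norm x > r \<Longrightarrow> \<psi> x = 0"
  shows "compactly_supported_in (ball 0 1) \<psi>"
proof -
  have "{x. \<psi> x \<noteq> 0} \<subseteq> cball 0 r" using assms(2) by force
  then have *: "closure {x. \<psi> x \<noteq> 0} \<subseteq> cball 0 r" by (simp add: closure_minimal)
  then have "compact (closure {x. \<psi> x \<noteq> 0})"
    using bounded_cball bounded_subset compact_eq_bounded_closed by blast
  moreover have "cball 0 r \<subseteq> (ball 0 1 :: 'a set)" using assms(1) by auto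
  ultimately show ?thesis using * by (auto simp: compactly_supported_in_def)
qed

lemma powr_le_exp_bound:
  fixes y a A E :: real
  assumes "1/4 \<le> y" "y \<le> E" "\<bar>a\<bar> \<le> A" "E \<ge> 1"
  shows "y powr a \<le> exp (A * ln (4 * E))"
proof -
  have y: "y > 0" using assms by linarith
  have "ln y \<le> ln (4 * E)" using assms y by (subst ln_le_cancel_iff) auto
  moreover have "- ln (4 * E) \<le> ln y"
  proof -
    have "- ln (4 * E) = ln (1 / (4 * E))" using assms by (simp add: ln_div)
    also have "\<dots> \<le> ln y"
    proof (subst ln_le_cancel_iff)
      have "1 / (4 * E) \<le> 1 / 4" using assms by (simp add: field_simps)
      then show "1 / (4 * E) \<le> y" using assms by linarith
    qed (use assms y in auto)
    finally show ?thesis .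
  qed
  ultimately have "\<bar>ln y\<bar> \<le> ln (4 * E)" by (simp add: abs_le_iff)
  then have "\<bar>a\<bar> * \<bar>ln y\<bar> \<le> A * ln (4 * E)" using assms(3) by (intro mult_mono) auto
  then have "a * ln y \<le> A * ln (4 * E)" using abs_ge_self[of "a * ln y"] by (simp add: abs_mult)
  then show ?thesis using y by (simp add: powr_def)
qed

theorem theorem2p5:
  fixes \<sigma> C \<beta> lam_inf :: real
    and \<epsilon> lam :: "nat \<Rightarrow> real"
    and K :: "nat \<Rightarrow> real^2 \<Rightarrow> real" and K_inf :: "real^2 \<Rightarrow> real"
    and v :: "nat \<Rightarrow> real^2 \<Rightarrow> real"
    and s :: "nat \<Rightarrow> nat"
  assumes eps_pos: "\<And>n. \<epsilon> n > 0" and eps_lim: "\<epsilon> \<longlonglongrightarrow> 0"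
    and K_cont: "\<And>n. continuous_on (cball 0 1) (K n)"
    and K_nonneg: "\<And>n x. x \<in> cball 0 1 \<Longrightarrow> K n x \<ge> 0"
    and K_unif: "uniform_limit (cball 0 1) K K_inf sequentially"
    and K_C1: "C1_loc_converges (ball 0 1) K K_inf"
    and v_cont: "\<And>n. continuous_on (cball 0 1) (v n)"
    and v_sol: "\<And>n. poisson_solution_on (ball 0 1) (v n)
                    (\<lambda>x. H_weight \<sigma> (\<epsilon> n) (lam n) (K n) x * exp (v n x))"
    and v_int: "\<And>n. (LINT x:ball 0 1|lborel.
                    h_weight (\<epsilon> n) x powr (2 * alpha \<sigma> (lam n)) * exp (v n x)) \<le> C"
    and lam_def: "\<And>n. lam n = (LINT x:ball 0 1|lborel.
                    H_weight \<sigma> (\<epsilon> n) (lam n) (K n) x * exp (v n x))"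
    and lam_lim: "lam \<longlonglongrightarrow> lam_inf" and lam_inf_pos: "lam_inf > 0"
    and v_bdd: "\<And>r. r \<in> {0<..<1} \<Longrightarrow>
                    \<exists>Cr>0. \<forall>n. (SUP x\<in>closure (ball 0 1 - ball 0 r). v n x) \<le> Cr"
    and v_blowup: "\<And>r. r \<in> {0<..<1} \<Longrightarrow>
                    filterlim (\<lambda>n. SUP x\<in>cball 0 r. v n x) at_top sequentially"
    and sigma: "(\<sigma> < 0 \<and> lam_inf < 4 * pi / \<bar>\<sigma>\<bar>) \<or> (\<sigma> > 0 \<and> lam_inf \<le> 4 * pi / \<sigma>)"
    and v_osc: "\<And>n. (SUP x\<in>sphere 0 1. v n x) - (INF x\<in>sphere 0 1. v n x) \<le> C"
    and subseq: "strict_mono s"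
    and beta_pos: "\<beta> > 0"
    and beta: "weakly_converges_in (ball 0 1)
                 (\<lambda>n. density_on (ball 0 1)
                    (\<lambda>x. H_weight \<sigma> (\<epsilon> (s n)) (lam (s n)) (K (s n)) x * exp (v (s n) x)))
                 (scale_measure (ennreal \<beta>) (dirac 0))"
  shows "\<beta> = lam_inf \<and>
    (\<sigma> < 0 \<longrightarrow>
       8 * pi + 2 * \<sigma> * lam_inf = 8 * pi * (1 + alpha \<sigma> lam_inf) \<and>
       8 * pi * (1 + alpha \<sigma> lam_inf) \<le> \<beta> \<and> \<beta> \<le> 8 * pi \<and>
       8 * pi / (1 + 2 * \<bar>\<sigma>\<bar>) \<le> lam_inf \<and> lam_inf \<le> 8 * pi) \<and>
    (\<sigma> > 0 \<longrightarrow>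
       0 < \<sigma> \<and> \<sigma> \<le> 1 / 2 \<and>
       8 * pi \<le> \<beta> \<and> \<beta> \<le> 8 * pi * (1 + alpha \<sigma> lam_inf) \<and>
       8 * pi * (1 + alpha \<sigma> lam_inf) = 8 * pi + 2 * \<sigma> * lam_inf \<and>
       8 * pi \<le> lam_inf \<and>
       ereal lam_inf \<le> min (if \<sigma> = 1 / 2 then \<infinity> else ereal (8 * pi / (1 - 2 * \<sigma>)))
                           (ereal (4 * pi / \<sigma>)))"
proof -
  define \<alpha> where "\<alpha> n = alpha \<sigma> (lam n)" for n
  define W where "W n x = h_weight (\<epsilon> n) x powr (2 * \<alpha> n)" for n x
  define f where "f n x = W n x * K n x * exp (v n x)" for n x
  define \<mu> where "\<mu> n = density_on (ball 0 1) (f n)" for n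
  have f_eq: "(\<lambda>x. H_weight \<sigma> (\<epsilon> n) (lam n) (K n) x * exp (v n x)) = f n" for n
    by (rule ext) (simp add: H_weight_def f_def W_def \<alpha>_def)
  have Wc: "continuous_on A (W n)" for A n
    unfolding W_def[abs_def] by (rule h_weight_powr_continuous[OF eps_pos])
  have W_nonneg: "W n x \<ge> 0" for n x by (simp add: W_def)
  have dp: "disc_poisson (v n) (f n)" for n
  proof
    show "continuous_on (cball 0 1) (f n)"
      unfolding f_def[abs_def] by (intro continuous_on_mult Wc K_cont continuous_on_exp v_cont)
    show "f n x \<ge> 0" if "x \<in> cball 0 1" for x
      unfolding f_def using K_nonneg[OF that] W_nonneg by simp
    show "poisson_solution_on (ball 0 1) (v n) (f n)" using v_sol[of n] unfolding f_eq .
  qed (rule v_cont)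
  have \<mu>_eq: "disc_poisson.\<mu> (f n) = \<mu> n" for n
    by (simp add: \<mu>_def disc_poisson.\<mu>_def[OF dp] density_on_def disc_poisson.F_def[OF dp])
  define F where "F n x = indicator (ball 0 1) x * f n x" for n x
  have F_eq: "disc_poisson.F (f n) = F n" for n by (rule ext) (simp add: F_def disc_poisson.F_def[OF dp])
  have F_int: "integrable lborel (F n)" and F_nonneg: "F n x \<ge> 0" and F_out: "norm x \<ge> 1 \<Longrightarrow> F n x = 0" for n x
    using disc_poisson.F_integrable[OF dp, of n] disc_poisson.F_nonneg[OF dp, of n x] disc_poisson.F_out[OF dp, of x n]
    unfolding F_eq by auto
  have int\<mu>: "integral\<^sup>L (\<mu> n) h = (\<integral>x. F n x * h x \<partial>lborel)" if "continuous_on UNIV h" for h :: "real^2 \<Rightarrow> real" and n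
    using disc_poisson.integral_\<mu>[OF dp, of h n] borel_measurable_continuous_onI[OF that] unfolding \<mu>_eq F_eq by simp
  have F_mult_int: "integrable lborel (\<lambda>x. F n x * h x)" if "continuous_on UNIV h" for h n
    by (rule disc_poisson.integrable_mult_continuous[OF dp F_int _ that]) (rule F_out)
  have lam_F: "lam n = integral\<^sup>L lborel (F n)" for n
    using lam_def[of n] unfolding f_eq[of n, THEN fun_cong] set_lebesgue_integral_def by (simp add: F_def[abs_def])
  have lam_\<mu>: "lam n = measure (\<mu> n) UNIV" for n
    using disc_poisson.measure_\<mu>[OF dp, of UNIV n] unfolding \<mu>_eq F_eq lam_F by simp
  have lam_nonneg: "lam n \<ge> 0" for n unfolding lam_\<mu> by simp

  have weak: "(\<lambda>i. integral\<^sup>L (\<mu> (s i)) \<psi>) \<longlonglongrightarrow> \<beta> * \<psi> 0"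
    if "continuous_on UNIV \<psi>" "r < 1" "\<And>x. norm x > r \<Longrightarrow> \<psi> x = 0" for \<psi> r
    using beta[unfolded weakly_converges_in_def f_eq, folded \<mu>_def, rule_format, OF conjI,
        OF that(1) compactly_supported_in_ball[OF that(2,3)]]
    by (simp add: integral_scaled_dirac[OF beta_pos that(1)])
  have lam_s: "(\<lambda>i. lam (s i)) \<longlonglongrightarrow> lam_inf"
    using LIMSEQ_subseq_LIMSEQ[OF lam_lim subseq] by (simp add: comp_def)
  have \<alpha>_lim: "\<alpha> \<longlonglongrightarrow> alpha \<sigma> lam_inf"
    unfolding \<alpha>_def[abs_def] alpha_def by (intro tendsto_intros lam_lim) simp
  have \<alpha>_s: "(\<lambda>i. \<alpha> (s i)) \<longlonglongrightarrow> alpha \<sigma> lam_inf"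
    using LIMSEQ_subseq_LIMSEQ[OF \<alpha>_lim subseq] by (simp add: comp_def)

  have K_inf_cont: "continuous_on (cball 0 1) K_inf"
    by (rule uniform_limit_theorem[OF _ K_unif]) (simp_all add: K_cont)
  have K_close: "\<forall>\<^sub>F i in sequentially. \<forall>x\<in>cball 0 1. \<bar>K (s i) x - K_inf x\<bar> < e" if "e > 0" for e
  proof -
    have "\<forall>\<^sub>F n in sequentially. \<forall>x\<in>cball 0 1. \<bar>K n x - K_inf x\<bar> < e"
      using uniform_limitD[OF K_unif that] by (simp add: dist_real_def)
    then show ?thesis by (rule eventually_subseq[OF subseq])
  qed
  \<comment> \<open>away from the origin \<open>v\<close>, \<open>K\<close> and the powers of \<open>h\<close> are bounded, hence so is the density\<close>
  have "\<exists>Bd\<ge>0. \<forall>\<^sub>F i in sequentially. \<forall>x. 1/2 \<le> norm x \<longrightarrow> norm x < 1 \<longrightarrow> f (s i) x \<le> Bd"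
  proof -
    obtain A where A: "\<And>n. \<bar>\<alpha> n\<bar> \<le> A"
      using convergent_imp_Bseq[OF convergentI[OF \<alpha>_lim]] unfolding Bseq_def by auto
    obtain E0 where E0: "\<And>n. \<bar>\<epsilon> n\<bar> \<le> E0"
      using convergent_imp_Bseq[OF convergentI[OF eps_lim]] unfolding Bseq_def by auto
    define E where "E = E0\<^sup>2 + 1"
    obtain Cr where Cr: "\<And>n. (SUP x\<in>closure (ball 0 1 - ball 0 (1/2)). v n x) \<le> Cr"
      using v_bdd[of "1/2"] by auto
    have v_le: "v n x \<le> Cr" if "1/2 \<le> norm x" "norm x < 1" for n x
    proof -
      let ?S = "closure (ball 0 1 - ball 0 (1/2)) :: (real^2) set"
      have sub: "?S \<subseteq> cball 0 1" by (rule closure_minimal) auto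
      have "compact ?S" using compact_eq_bounded_closed bounded_subset[OF bounded_cball sub] by blast
      then have "compact (v n ` ?S)" by (intro compact_continuous_image continuous_on_subset[OF v_cont sub])
      then have "bdd_above (v n ` ?S)" 
        by (rule bounded_imp_bdd_above[OF compact_imp_bounded])
      moreover have "x \<in> ?S" using that closure_subset[of "ball 0 1 - ball 0 (1/2) :: (real^2) set"] by auto
      ultimately have "v n x \<le> (SUP x\<in>?S. v n x)" by (intro cSUP_upper)
      then show ?thesis using Cr[of n] by linarith
    qed
    have "compact (K_inf ` cball 0 1)" by (intro compact_continuous_image K_inf_cont) simp
    then obtain KM where KM: "\<And>x. x \<in> cball 0 1 \<Longrightarrow> \<bar>K_inf x\<bar> \<le> KM"
      using compact_imp_bounded bounded_iff by (metis imageI real_norm_def)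
    define Wm where "Wm = exp (A * ln (4 * E))"
    have W_le: "W n x \<le> Wm" if "1/2 \<le> norm x" "norm x < 1" for n x
      unfolding W_def h_weight_powr Wm_def
    proof (rule powr_le_exp_bound)
      have "(1/2)\<^sup>2 \<le> (norm x)\<^sup>2" using that by (intro power_mono) auto
      then have "1/4 \<le> (norm x)\<^sup>2" by (simp add: power_divide)
      then show "1/4 \<le> (\<epsilon> n)\<^sup>2 + (norm x)\<^sup>2" using zero_le_power2[of "\<epsilon> n"] by linarith
      have "(\<epsilon> n)\<^sup>2 \<le> E0\<^sup>2" using E0[of n] eps_pos[of n] by (intro power_mono) auto
      moreover have "(norm x)\<^sup>2 \<le> 1" using that by (simp add: power_le_one)
      ultimately show "(\<epsilon> n)\<^sup>2 + (norm x)\<^sup>2 \<le> E" by (simp add: E_def)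
      show "E \<ge> 1" by (simp add: E_def)
    qed (rule A)
    have KM0: "KM \<ge> 0" using order_trans[OF abs_ge_zero KM[of 0]] by simp
    have "\<forall>\<^sub>F i in sequentially. \<forall>x. 1/2 \<le> norm x \<longrightarrow> norm x < 1 \<longrightarrow> f (s i) x \<le> Wm * (KM + 1) * exp Cr"
      using K_close[of 1, OF zero_less_one]
    proof eventually_elim
      case (elim i)
      show ?case
      proof (intro allI impI)
        fix x :: "real^2" assume x: "1/2 \<le> norm x" "norm x < 1"
        have "K (s i) x \<le> KM + 1" using elim[rule_format, of x] KM[of x] x by (simp add: abs_less_iff abs_le_iff) 
        then show "f (s i) x \<le> Wm * (KM + 1) * exp Cr"
          unfolding f_def using W_le[OF x] v_le[OF x] W_nonneg K_nonneg[of x "s i"] x KM0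
          by (intro mult_mono mult_nonneg_nonneg) (auto simp: Wm_def)
      qed
    qed
    moreover have "Wm * (KM + 1) * exp Cr \<ge> 0" using KM0 by (simp add: Wm_def)
    ultimately show ?thesis by blast
  qed
  then obtain Bd where Bd: "Bd \<ge> 0"
    "\<forall>\<^sub>F i in sequentially. \<forall>x. 1/2 \<le> norm x \<longrightarrow> norm x < 1 \<longrightarrow> f (s i) x \<le> Bd" by blast

  \<comment> \<open>a continuous cutoff that is 1 for \<open>|x| \<le> 1 - d\<close> misses only the mass of a shell of area at most
    \<open>2\<pi>d\<close>, where the density is bounded\<close>
  have \<beta>_eq: "\<beta> = lam_inf"
  proof -
    have close: "\<bar>lam_inf - \<beta>\<bar> \<le> Bd * (2 * pi * d)" if d: "0 < d" "d < 1/2" for d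
    proof -
      define \<eta> where "\<eta> x = max 0 (min 1 (2 * (1 - norm x) / d - 1))" for x :: "real^2"
      have \<eta>c: "continuous_on UNIV \<eta>" unfolding \<eta>_def[abs_def] by (intro continuous_intros) (use d in auto)
      have \<eta>0: "\<eta> x = 0" if "norm x > 1 - d / 2" for x
        using that d by (auto simp: \<eta>_def field_simps)
      have \<eta>1: "\<eta> x = 1" if "norm x \<le> 1 - d" for x
        using that d by (auto simp: \<eta>_def field_simps)
      have \<eta>01: "0 \<le> \<eta> x" "\<eta> x \<le> 1" for x by (auto simp: \<eta>_def)
      have \<eta>at0: "\<eta> 0 = 1" using \<eta>1[of 0] d by simp
      have "(\<lambda>i. integral\<^sup>L (\<mu> (s i)) \<eta>) \<longlonglongrightarrow> \<beta> * \<eta> 0"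
        by (rule weak[OF \<eta>c _ \<eta>0]) (use d in auto)
      then have lim: "(\<lambda>i. \<bar>lam (s i) - integral\<^sup>L (\<mu> (s i)) \<eta>\<bar>) \<longlonglongrightarrow> \<bar>lam_inf - \<beta>\<bar>"
        using \<eta>at0 by (auto intro!: tendsto_intros lam_s)
      have "\<forall>\<^sub>F i in sequentially. \<bar>lam (s i) - integral\<^sup>L (\<mu> (s i)) \<eta>\<bar> \<le> Bd * (2 * pi * d)"
        using Bd(2)
      proof eventually_elim
        case (elim i)
        define N where "N = s i"
        define A where "A = (cball 0 1 - cball 0 (1 - d) :: (real^2) set)"
        have finA: "emeasure lborel A < \<infinity>"
          by (rule emeasure_bounded_finite[OF bounded_subset[OF bounded_cball[of 0 1]]]) (auto simp: A_def)
        have Ab: "A \<in> sets borel" by (simp add: A_def)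
        have mA: "measure lborel A = pi - pi * (1 - d)\<^sup>2"
          unfolding A_def using d
          by (subst measure_Diff) (auto simp: measure_cball_plane emeasure_cball)
        have iA: "integrable lborel (\<lambda>x. Bd * indicat_real A x)" using finA Ab by simp
        have "lam N - integral\<^sup>L (\<mu> N) \<eta> = (\<integral>x. F N x - F N x * \<eta> x \<partial>lborel)"
          unfolding lam_F int\<mu>[OF \<eta>c] by (rule Bochner_Integration.integral_diff[symmetric, OF F_int F_mult_int[OF \<eta>c]])
        also have "norm \<dots> \<le> (\<integral>x. Bd * indicat_real A x \<partial>lborel)"
        proof (rule Bochner_Integration.integral_norm_bound_integral)
          show "integrable lborel (\<lambda>x. F N x - F N x * \<eta> x)"
            by (rule Bochner_Integration.integrable_diff[OF F_int F_mult_int[OF \<eta>c]])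
          fix x
          show "norm (F N x - F N x * \<eta> x) \<le> Bd * indicat_real A x"
          proof (cases "norm x < 1 \<and> norm x > 1 - d")
            case True
            then have "x \<in> A" by (simp add: A_def)
            have "F N x \<le> Bd" using elim[rule_format, of x] True d by (simp add: F_def N_def)
            moreover have "norm (F N x - F N x * \<eta> x) \<le> F N x"
              using mult_left_mono[OF \<eta>01(2) F_nonneg, of N x x] mult_nonneg_nonneg[OF F_nonneg \<eta>01(1), of N x x]
              by simp
            ultimately show ?thesis using \<open>x \<in> A\<close> by simp
          next
            case False
            then have "F N x - F N x * \<eta> x = 0" using \<eta>1[of x] F_out[of x N] by (cases "norm x < 1") auto
            then show ?thesis using Bd(1) by (simp only:) simp
          qed
        qed (rule iA)
        also have "\<dots> = Bd * (pi - pi * (1 - d)\<^sup>2)" using mA by simp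
        also have "\<dots> \<le> Bd * (2 * pi * d)"
          using Bd(1) by (intro mult_left_mono) (simp_all add: power2_eq_square algebra_simps)
        finally show ?case by (simp add: N_def)
      qed
      then show ?thesis by (rule tendsto_upperbound[OF lim]) simp
    qed
    have "\<bar>lam_inf - \<beta>\<bar> \<le> 0"
    proof (rule field_le_epsilon)
      fix e :: real assume e: "e > 0"
      define d where "d = min (1/4) (e / (Bd * (2 * pi) + 1))"
      have p: "Bd * (2 * pi) + 1 > 0" using Bd(1) by (intro add_nonneg_pos) auto
      have d: "0 < d" "d < 1/2" using e p by (auto simp: d_def)
      have "d \<le> e / (Bd * (2 * pi) + 1)" by (simp add: d_def)
      then have "d * (Bd * (2 * pi) + 1) \<le> e" using p by (simp add: field_simps)
      then have "Bd * (2 * pi * d) \<le> e" using d by (simp add: algebra_simps)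
      then show "\<bar>lam_inf - \<beta>\<bar> \<le> 0 + e" using close[OF d] by linarith
    qed
    then show ?thesis by simp
  qed

  \<comment> \<open>the total mass converges to \<open>\<beta>\<close>, and any neighbourhood of the origin already captures \<open>\<beta>\<close>\<close>
  have far: "(\<lambda>i. measure (\<mu> (s i)) {x. norm x > r}) \<longlonglongrightarrow> 0" if r: "0 < r" "r < 1" for r
  proof (rule tendsto_sandwich[OF _ _ tendsto_const])
    have "(\<lambda>i. integral\<^sup>L (\<mu> (s i)) (cutoff r)) \<longlonglongrightarrow> \<beta> * cutoff r 0"
      by (rule weak[OF cutoff_continuous r(2)]) (use r cutoff_eq_0 in auto)
    then have "(\<lambda>i. lam (s i) - integral\<^sup>L (\<mu> (s i)) (cutoff r)) \<longlonglongrightarrow> lam_inf - \<beta> * cutoff r 0"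
      by (intro tendsto_intros lam_s)
    then show "(\<lambda>i. lam (s i) - integral\<^sup>L (\<mu> (s i)) (cutoff r)) \<longlonglongrightarrow> 0"
      using r by (simp add: cutoff_eq_1 \<beta>_eq)
    show "\<forall>\<^sub>F i in sequentially. 0 \<le> measure (\<mu> (s i)) {x. norm x > r}" by simp
    have "measure (\<mu> n) {x. norm x > r} \<le> lam n - integral\<^sup>L (\<mu> n) (cutoff r)" for n
    proof -
      have S: "{x::real^2. norm x > r} \<in> sets borel" by measurable
      have "measure (\<mu> n) {x. norm x > r} = (\<integral>x. indicator {x. norm x > r} x * F n x \<partial>lborel)"
        using disc_poisson.measure_\<mu>[OF dp S, of n] unfolding \<mu>_eq F_eq .
      also have "\<dots> \<le> (\<integral>x. F n x - F n x * cutoff r x \<partial>lborel)"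
      proof (rule integral_mono)
        show "integrable lborel (\<lambda>x. indicator {x. norm x > r} x * F n x)"
          using integrable_mult_indicator[OF _ F_int, of "{x. norm x > r}" n] S by simp
        show "integrable lborel (\<lambda>x. F n x - F n x * cutoff r x)"
          by (rule Bochner_Integration.integrable_diff[OF F_int F_mult_int[OF cutoff_continuous]])
        fix x
        show "indicator {x. norm x > r} x * F n x \<le> F n x - F n x * cutoff r x"
          using mult_left_mono[OF cutoff_le_1[of r x] F_nonneg[of n x]] r cutoff_eq_0[of r x]
          by (auto simp: indicator_def)
      qed
      also have "\<dots> = lam n - integral\<^sup>L (\<mu> n) (cutoff r)"
        unfolding lam_F int\<mu>[OF cutoff_continuous]
        by (rule Bochner_Integration.integral_diff[OF F_int F_mult_int[OF cutoff_continuous]])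
      finally show ?thesis .
    qed
    then show "\<forall>\<^sub>F i in sequentially. measure (\<mu> (s i)) {x. norm x > r} \<le> lam (s i) - integral\<^sup>L (\<mu> (s i)) (cutoff r)"
      by simp
  qed

  have K_inf_near: "\<exists>\<rho>. 0 < \<rho> \<and> \<rho> \<le> 1/2 \<and> (\<forall>x. norm x \<le> \<rho> \<longrightarrow> \<bar>K_inf x - K_inf 0\<bar> < e)" if e: "e > 0" for e
  proof -
    have "(0::real^2) \<in> cball 0 1" by simp
    then obtain d where d: "d > 0" "\<And>x. x \<in> cball 0 1 \<Longrightarrow> dist x 0 < d \<Longrightarrow> dist (K_inf x) (K_inf 0) < e"
      using K_inf_cont e unfolding continuous_on_iff by metis
    define \<rho> where "\<rho> = min (d / 2) (1/2)"
    have \<rho>: "0 < \<rho>" "\<rho> \<le> 1/2" "\<rho> < d" using d(1) by (auto simp: \<rho>_def min_def)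
    have "\<bar>K_inf x - K_inf 0\<bar> < e" if "norm x \<le> \<rho>" for x
      using d(2)[of x] that \<rho> by (simp add: dist_real_def)
    then show ?thesis using \<rho> by blast
  qed

  have weight_exp_int: "integrable lborel (\<lambda>x. indicator (ball 0 1) x * (W n x * exp (v n x)))"
    and weight_exp_le: "(\<integral>x. indicator (ball 0 1) x * (W n x * exp (v n x)) \<partial>lborel) \<le> C" for n
  proof -
    have c: "continuous_on (cball 0 1) (\<lambda>x. W n x * exp (v n x))"
      by (intro continuous_on_mult Wc continuous_on_exp v_cont)
    obtain Mb where Mb: "\<And>x. \<bar>indicator (ball 0 1) x * (W n x * exp (v n x))\<bar> \<le> Mb"
      using disc_poisson.indicator_disc_continuous(2)[OF dp c] by blast
    show "integrable lborel (\<lambda>x. indicator (ball 0 1) x * (W n x * exp (v n x)))"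
      by (rule integrable_bounded_support[OF disc_poisson.indicator_disc_continuous(1)[OF dp c], of Mb 1])
         (use Mb in auto)
    show "(\<integral>x. indicator (ball 0 1) x * (W n x * exp (v n x)) \<partial>lborel) \<le> C"
      using v_int[of n] by (simp add: set_lebesgue_integral_def W_def \<alpha>_def)
  qed
  have C_nonneg: "C \<ge> 0"
    using order_trans[OF integral_nonneg_AE weight_exp_le[of 0]] W_nonneg by simp

  \<comment> \<open>otherwise \<open>K\<close> is small near the origin, and there the density is a small multiple of
    \<open>h\<^sup>2\<^sup>\<alpha> e\<^sup>v\<close>, whose integral is at most \<open>C\<close>; but the mass near the origin tends to \<open>\<beta> > 0\<close>\<close>
  have K0_pos: "K_inf 0 > 0"
  proof (rule ccontr)
    assume "\<not> K_inf 0 > 0"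
    then have K0: "K_inf 0 \<le> 0" by simp
    define e where "e = \<beta> / (2 * (C + 1))"
    have e: "e > 0" using beta_pos C_nonneg by (simp add: e_def)
    obtain \<rho> where \<rho>: "0 < \<rho>" "\<rho> \<le> 1/2" "\<And>x. norm x \<le> \<rho> \<Longrightarrow> \<bar>K_inf x - K_inf 0\<bar> < e"
      using K_inf_near[OF e] by blast
    have lim: "(\<lambda>i. integral\<^sup>L (\<mu> (s i)) (cutoff \<rho>)) \<longlonglongrightarrow> \<beta> * cutoff \<rho> 0"
      by (rule weak[OF cutoff_continuous, of \<rho>]) (use \<rho> cutoff_eq_0 in auto)
    have "\<forall>\<^sub>F i in sequentially. integral\<^sup>L (\<mu> (s i)) (cutoff \<rho>) \<le> 2 * e * C"
      using K_close[OF e]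
    proof eventually_elim
      case (elim i)
      have "integral\<^sup>L (\<mu> (s i)) (cutoff \<rho>) \<le> (\<integral>x. 2 * e * (indicator (ball 0 1) x * (W (s i) x * exp (v (s i) x))) \<partial>lborel)"
        unfolding int\<mu>[OF cutoff_continuous]
      proof (rule integral_mono[OF F_mult_int[OF cutoff_continuous]])
        show "integrable lborel (\<lambda>x. 2 * e * (indicator (ball 0 1) x * (W (s i) x * exp (v (s i) x))))"
          using weight_exp_int[of "s i"] by (rule integrable_mult_right)
        fix x
        show "F (s i) x * cutoff \<rho> x \<le> 2 * e * (indicator (ball 0 1) x * (W (s i) x * exp (v (s i) x)))"
        proof (cases "norm x < \<rho>")
          case True
          have x1: "norm x < 1" using True \<rho> by simp
          have "K (s i) x \<le> 2 * e"
            using elim[rule_format, of x] \<rho>(3)[of x] True x1 K0 by (simp add: abs_less_iff)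
          have "F (s i) x * cutoff \<rho> x \<le> F (s i) x * 1"
            by (intro mult_left_mono cutoff_le_1 F_nonneg)
          also have "\<dots> = W (s i) x * exp (v (s i) x) * K (s i) x" using x1 by (simp add: F_def f_def)
          also have "\<dots> \<le> W (s i) x * exp (v (s i) x) * (2 * e)"
            using \<open>K (s i) x \<le> 2 * e\<close> W_nonneg by (intro mult_left_mono) auto
          finally show ?thesis using x1 by (simp add: mult.commute mult.left_commute)
        next
          case False
          then show ?thesis using \<rho> e W_nonneg by (simp add: cutoff_eq_0)
        qed
      qed
      also have "\<dots> \<le> 2 * e * C" using weight_exp_le[of "s i"] e by simp
      finally show ?case .
    qed
    then have "\<beta> * cutoff \<rho> 0 \<le> 2 * e * C" by (rule tendsto_upperbound[OF lim]) simp
    then have "\<beta> \<le> 2 * e * C" using \<rho> by (simp add: cutoff_eq_1)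
    also have "\<dots> = \<beta> * (C / (C + 1))" using C_nonneg by (simp add: e_def field_simps)
    also have "\<dots> < \<beta> * 1" using beta_pos C_nonneg by (intro mult_strict_left_mono) auto
    finally show False by simp
  qed

  define k0 where "k0 = K_inf 0 / 4"
  have k0: "k0 > 0" using K0_pos by (simp add: k0_def)
  obtain \<rho> where \<rho>: "0 < \<rho>" "\<rho> \<le> 1/2" "\<And>x. norm x \<le> \<rho> \<Longrightarrow> \<bar>K_inf x - K_inf 0\<bar> < 2 * k0"
    using K_inf_near[of "2 * k0"] k0 by auto
  have K_lower: "\<forall>\<^sub>F i in sequentially. \<forall>x. norm x \<le> \<rho> \<longrightarrow> k0 \<le> K (s i) x"
    using K_close[OF k0]
  proof eventually_elim
    case (elim i)
    show ?case
    proof (intro allI impI)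
      fix x :: "real^2" assume x: "norm x \<le> \<rho>"
      then have "\<bar>K (s i) x - K_inf x\<bar> < k0" using elim \<rho> by simp
      then show "k0 \<le> K (s i) x" using \<rho>(3)[OF x] unfolding k0_def by linarith
    qed
  qed
  have "\<exists>B. \<forall>\<^sub>F i in sequentially. \<forall>x. norm x \<le> \<rho> \<longrightarrow> norm (gradient (K (s i)) x) \<le> B"
  proof -
    have C1: "Ck_on 1 (ball 0 1) K_inf"
      "\<And>b. b \<in> Basis \<Longrightarrow> uniform_limit (cball 0 (1/2)) (\<lambda>n. partial_deriv b (K n)) (partial_deriv b K_inf) sequentially"
      using K_C1 unfolding C1_loc_converges_def by (auto dest!: spec[of _ "cball 0 (1/2)"])
    have "\<exists>P. \<forall>x\<in>cball 0 (1/2). \<bar>partial_deriv b K_inf x\<bar> \<le> P" if "b \<in> Basis" for b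
    proof -
      have "continuous_on (ball 0 1) (partial_deriv b K_inf)" using C1(1) that by simp
      then have "compact (partial_deriv b K_inf ` cball 0 (1/2))"
        by (intro compact_continuous_image) (auto elim: continuous_on_subset)
      then show ?thesis using compact_imp_bounded bounded_iff by (metis imageI real_norm_def)
    qed
    then obtain P where P: "\<And>b x. b \<in> Basis \<Longrightarrow> x \<in> cball 0 (1/2) \<Longrightarrow> \<bar>partial_deriv b K_inf x\<bar> \<le> P b" by metis
    define Pm where "Pm = (\<Sum>b\<in>Basis. P b)"
    have P0: "P b \<ge> 0" if "b \<in> Basis" for b using order_trans[OF abs_ge_zero P[OF that, of 0]] by simp
    have Pm: "P b \<le> Pm" if "b \<in> Basis" for b
      unfolding Pm_def by (rule member_le_sum) (use that P0 in auto)
    have "\<forall>\<^sub>F n in sequentially. \<forall>b\<in>Basis. \<forall>x\<in>cball 0 (1/2). dist (partial_deriv b (K n) x) (partial_deriv b K_inf x) < 1"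
      by (intro eventually_ball_finite ballI uniform_limitD[OF C1(2)]) auto
    then have "\<forall>\<^sub>F i in sequentially. \<forall>b\<in>Basis. \<forall>x\<in>cball 0 (1/2). dist (partial_deriv b (K (s i)) x) (partial_deriv b K_inf x) < 1"
      by (rule eventually_subseq[OF subseq])
    then have "\<forall>\<^sub>F i in sequentially. \<forall>x. norm x \<le> \<rho> \<longrightarrow> norm (gradient (K (s i)) x) \<le> real DIM(real^2) * (Pm + 1)"
    proof eventually_elim
      case (elim i)
      show ?case
      proof (intro allI impI norm_gradient_le)
        fix x b :: "real^2" assume x: "norm x \<le> \<rho>" and b: "b \<in> Basis"
        have xb: "x \<in> cball 0 (1/2)" using x \<rho> by simp
        have "\<bar>partial_deriv b (K (s i)) x - partial_deriv b K_inf x\<bar> < 1"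
          using elim b xb by (simp add: dist_real_def)
        then show "\<bar>partial_deriv b (K (s i)) x\<bar> \<le> Pm + 1" using P[OF b xb] Pm[OF b] by linarith
      qed
    qed
    then show ?thesis by blast
  qed
  then obtain B where B: "\<forall>\<^sub>F i in sequentially. \<forall>x. norm x \<le> \<rho> \<longrightarrow> norm (gradient (K (s i)) x) \<le> B" by blast
  obtain M where M: "\<And>x. norm (mollifier_grad (1/4) x) \<le> M" using mollifier_grad_bounded[of "1/4"] by auto
  obtain L where L: "L \<ge> 0" "\<And>x y. norm (cutoff \<rho> x *\<^sub>R x - cutoff \<rho> y *\<^sub>R y) \<le> L * norm (x - y)"
    using cutoff_identity_Lipschitz[OF \<rho>(1)] by blast

  \<comment> \<open>the oscillation condition, with the boundary minimum as reference level\<close>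
  define c where "c n = (INF x\<in>sphere 0 1. v n x)" for n
  have bdry: "c n \<le> v n x" "v n x \<le> c n + C" if "norm x = 1" for n x
  proof -
    have cs: "continuous_on (sphere 0 1) (v n)" by (rule continuous_on_subset[OF v_cont]) auto
    have "bounded (v n ` sphere 0 1)"
      by (intro compact_imp_bounded compact_continuous_image cs) simp
    then have bd: "bdd_below (v n ` sphere 0 1)" "bdd_above (v n ` sphere 0 1)"
      using bounded_imp_bdd_below bounded_imp_bdd_above by auto
    show "c n \<le> v n x" unfolding c_def by (rule cINF_lower[OF bd(1)]) (use that in simp)
    have "v n x \<le> (SUP x\<in>sphere 0 1. v n x)" by (rule cSUP_upper[OF _ bd(2)]) (use that in simp)
    then show "v n x \<le> c n + C" using v_osc[of n] by (simp add: c_def)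
  qed

  define a where "a i = integral\<^sup>L (\<mu> (s i)) (cutoff \<rho>)" for i
  define N where "N i = (\<integral>x. cutoff \<rho> x * norm x \<partial>\<mu> (s i))" for i
  define J where "J i = (\<integral>x. x \<bullet> cutoff_grad \<rho> x \<partial>\<mu> (s i))" for i
  define err where "err i = 4 * pi * \<bar>J i\<bar>
        + 4 * pi * (B / k0 + M * (lam (s i) / 4 + (C + 1) * pi) + 8 * lam (s i)) * N i
        + 2 * (L + 1) * lam (s i) * measure (\<mu> (s i)) {x. norm x > \<rho> / 2}" for i
  have \<rho>1: "\<rho> < 1" using \<rho> by simp
  have a_lim: "a \<longlonglongrightarrow> \<beta>"
  proof -
    have "a \<longlonglongrightarrow> \<beta> * cutoff \<rho> 0"
      unfolding a_def[abs_def] by (rule weak[OF cutoff_continuous \<rho>1]) (use \<rho> cutoff_eq_0 in auto)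
    then show ?thesis using \<rho> by (simp add: cutoff_eq_1)
  qed
  have N_lim: "N \<longlonglongrightarrow> 0"
  proof -
    have "N \<longlonglongrightarrow> \<beta> * (cutoff \<rho> 0 * norm (0::real^2))"
      unfolding N_def[abs_def]
      by (rule weak[OF _ \<rho>1])
         (use \<rho> cutoff_eq_0 in \<open>auto intro!: continuous_on_mult cutoff_continuous continuous_on_norm continuous_on_id\<close>)
    then show ?thesis by simp
  qed
  have J_lim: "J \<longlonglongrightarrow> 0"
  proof -
    have "J \<longlonglongrightarrow> \<beta> * ((0::real^2) \<bullet> cutoff_grad \<rho> 0)"
      unfolding J_def[abs_def]
      by (rule weak[OF _ \<rho>1])
         (use \<rho> cutoff_grad_eq_0 in \<open>auto intro!: continuous_on_inner cutoff_grad_continuous continuous_on_id\<close>)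
    then show ?thesis by simp
  qed
  have m_lim: "(\<lambda>i. measure (\<mu> (s i)) {x. norm x > \<rho> / 2}) \<longlonglongrightarrow> 0"
    by (rule far) (use \<rho> in auto)
  have err_lim: "err \<longlonglongrightarrow> 0"
  proof -
    have "err \<longlonglongrightarrow> 4 * pi * \<bar>0\<bar> + 4 * pi * (B / k0 + M * (lam_inf / 4 + (C + 1) * pi) + 8 * lam_inf) * 0
        + 2 * (L + 1) * lam_inf * 0"
      unfolding err_def[abs_def] by (intro tendsto_intros J_lim N_lim m_lim lam_s) auto
    then show ?thesis by simp
  qed
  have poh: "\<forall>\<^sub>F i in sequentially. \<exists>I. 0 \<le> I \<and> I \<le> a i \<and> \<bar>4 * pi * (2 * a i + 2 * \<alpha> (s i) * I) - (lam (s i))\<^sup>2\<bar> \<le> err i"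
    using K_lower B
  proof eventually_elim
    case (elim i)
    let ?n = "s i"
    have f_n: "(\<lambda>x. h_weight (\<epsilon> ?n) x powr (2 * \<alpha> ?n) * K ?n x * exp (v ?n x)) = f ?n"
      by (rule ext) (simp add: f_def W_def)
    have "Ck_on 1 (ball 0 1) (K ?n)" using K_C1 unfolding C1_loc_converges_def by blast
    moreover have "poisson_solution_on (ball 0 1) (v ?n) (f ?n)" using v_sol[of ?n] unfolding f_eq .
    ultimately show ?case
      using weighted_pohozaev[of "\<epsilon> ?n" "K ?n" "v ?n" "\<alpha> ?n" "c ?n" C M \<rho> k0 B L, unfolded f_n, folded \<mu>_def,
          OF eps_pos K_cont K_nonneg _ v_cont _ bdry C_nonneg M \<rho>(1,2) k0 _ _ L] elim
      unfolding a_def err_def J_def N_def lam_\<mu> by blast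
  qed

  \<comment> \<open>\<open>I\<close> is only known to lie in the interval from 0 to \<open>a i\<close>; the sign of \<open>\<sigma>\<close>, which is that of
    \<open>\<alpha>\<close>, decides which end gives the upper and which the lower bound\<close>
  have lim1: "(\<lambda>i. 8 * pi * a i - (lam (s i))\<^sup>2) \<longlonglongrightarrow> 8 * pi * \<beta> - \<beta>\<^sup>2"
    using a_lim lam_s unfolding \<beta>_eq by (intro tendsto_intros)
  have lim2: "(\<lambda>i. 8 * pi * (1 + \<alpha> (s i)) * a i - (lam (s i))\<^sup>2) \<longlonglongrightarrow> 8 * pi * (1 + alpha \<sigma> lam_inf) * \<beta> - \<beta>\<^sup>2"
    using a_lim lam_s \<alpha>_s unfolding \<beta>_eq by (intro tendsto_intros)
  have nerr_lim: "(\<lambda>i. - err i) \<longlonglongrightarrow> 0" using tendsto_minus[OF err_lim] by simp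
  have divide_\<beta>: "x \<le> \<beta>" if "x * \<beta> - \<beta>\<^sup>2 \<le> 0" for x
    using that beta_pos by (simp add: power2_eq_square)
  have divide_\<beta>': "\<beta> \<le> x" if "0 \<le> x * \<beta> - \<beta>\<^sup>2" for x
    using that beta_pos by (simp add: power2_eq_square)
  have alpha_eq: "8 * pi * (1 + alpha \<sigma> lam_inf) = 8 * pi + 2 * \<sigma> * lam_inf"
    by (simp add: alpha_def field_simps)
  have neg: "8 * pi * (1 + alpha \<sigma> lam_inf) \<le> \<beta> \<and> \<beta> \<le> 8 * pi" if \<sigma>: "\<sigma> < 0"
  proof
    have \<alpha>: "\<alpha> n \<le> 0" for n
      unfolding \<alpha>_def alpha_def using \<sigma> lam_nonneg[of n] by (intro mult_nonneg_nonpos) auto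
    have ev: "\<forall>\<^sub>F i in sequentially. 8 * pi * (1 + \<alpha> (s i)) * a i - (lam (s i))\<^sup>2 \<le> err i \<and> - err i \<le> 8 * pi * a i - (lam (s i))\<^sup>2"
      using poh
    proof eventually_elim
      case (elim i)
      then obtain I where I: "0 \<le> I" "I \<le> a i" "\<bar>4 * pi * (2 * a i + 2 * \<alpha> (s i) * I) - (lam (s i))\<^sup>2\<bar> \<le> err i" by blast
      have "\<alpha> (s i) * a i \<le> \<alpha> (s i) * I" "\<alpha> (s i) * I \<le> 0"
        using \<alpha>[of "s i"] I by (auto intro: mult_left_mono_neg simp: mult_nonpos_nonneg)
      then have "8 * pi * (\<alpha> (s i) * a i) \<le> 8 * pi * (\<alpha> (s i) * I)" "8 * pi * (\<alpha> (s i) * I) \<le> 0"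
        by (auto simp: mult_le_0_iff)
      moreover have "4 * pi * (2 * a i + 2 * \<alpha> (s i) * I) = 8 * pi * a i + 8 * pi * (\<alpha> (s i) * I)"
        "8 * pi * (1 + \<alpha> (s i)) * a i = 8 * pi * a i + 8 * pi * (\<alpha> (s i) * a i)"
        by (simp_all add: algebra_simps)
      ultimately show ?case using I(3) by linarith
    qed
    have "8 * pi * (1 + alpha \<sigma> lam_inf) * \<beta> - \<beta>\<^sup>2 \<le> 0"
      by (rule tendsto_le[OF _ err_lim lim2]) (use ev in \<open>auto elim: eventually_mono\<close>)
    then show "8 * pi * (1 + alpha \<sigma> lam_inf) \<le> \<beta>" by (rule divide_\<beta>)
    have "0 \<le> 8 * pi * \<beta> - \<beta>\<^sup>2"
      by (rule tendsto_le[OF _ lim1 nerr_lim]) (use ev in \<open>auto elim: eventually_mono\<close>)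
    then show "\<beta> \<le> 8 * pi" by (rule divide_\<beta>')
  qed
  have pos: "8 * pi \<le> \<beta> \<and> \<beta> \<le> 8 * pi * (1 + alpha \<sigma> lam_inf)" if \<sigma>: "\<sigma> > 0"
  proof
    have \<alpha>: "\<alpha> n \<ge> 0" for n
      unfolding \<alpha>_def alpha_def using \<sigma> lam_nonneg[of n] by simp
    have ev: "\<forall>\<^sub>F i in sequentially. 8 * pi * a i - (lam (s i))\<^sup>2 \<le> err i \<and> - err i \<le> 8 * pi * (1 + \<alpha> (s i)) * a i - (lam (s i))\<^sup>2"
      using poh
    proof eventually_elim
      case (elim i)
      then obtain I where I: "0 \<le> I" "I \<le> a i" "\<bar>4 * pi * (2 * a i + 2 * \<alpha> (s i) * I) - (lam (s i))\<^sup>2\<bar> \<le> err i" by blast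
      have "\<alpha> (s i) * I \<le> \<alpha> (s i) * a i" "0 \<le> \<alpha> (s i) * I"
        using \<alpha>[of "s i"] I by (auto intro: mult_left_mono)
      then have "8 * pi * (\<alpha> (s i) * I) \<le> 8 * pi * (\<alpha> (s i) * a i)" "0 \<le> 8 * pi * (\<alpha> (s i) * I)"
        by auto
      moreover have "4 * pi * (2 * a i + 2 * \<alpha> (s i) * I) = 8 * pi * a i + 8 * pi * (\<alpha> (s i) * I)"
        "8 * pi * (1 + \<alpha> (s i)) * a i = 8 * pi * a i + 8 * pi * (\<alpha> (s i) * a i)"
        by (simp_all add: algebra_simps)
      ultimately show ?case using I(3) by linarith
    qed
    have "8 * pi * \<beta> - \<beta>\<^sup>2 \<le> 0"
      by (rule tendsto_le[OF _ err_lim lim1]) (use ev in \<open>auto elim: eventually_mono\<close>)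
    then show "8 * pi \<le> \<beta>" by (rule divide_\<beta>)
    have "0 \<le> 8 * pi * (1 + alpha \<sigma> lam_inf) * \<beta> - \<beta>\<^sup>2"
      by (rule tendsto_le[OF _ lim2 nerr_lim]) (use ev in \<open>auto elim: eventually_mono\<close>)
    then show "\<beta> \<le> 8 * pi * (1 + alpha \<sigma> lam_inf)" by (rule divide_\<beta>')
  qed
  have neg': "8 * pi / (1 + 2 * \<bar>\<sigma>\<bar>) \<le> lam_inf" if "\<sigma> < 0"
  proof -
    have "8 * pi + 2 * \<sigma> * lam_inf \<le> lam_inf" using neg[OF that] alpha_eq \<beta>_eq by simp
    then show ?thesis using that by (simp add: field_simps)
  qed
  have pos': "\<sigma> \<le> 1/2 \<and> lam_inf \<le> 4 * pi / \<sigma> \<and> (\<sigma> \<noteq> 1/2 \<longrightarrow> lam_inf \<le> 8 * pi / (1 - 2 * \<sigma>))" if "\<sigma> > 0"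
  proof -
    have l: "lam_inf \<le> 4 * pi / \<sigma>" using sigma that by auto
    have "8 * pi \<le> 4 * pi / \<sigma>" using l pos[OF that] \<beta>_eq by simp
    then have "8 * pi * \<sigma> \<le> 4 * pi" using that by (simp add: field_simps)
    then have "pi * (2 * \<sigma>) \<le> pi * 1" by simp
    then have h: "\<sigma> \<le> 1/2" using mult_le_cancel_left_pos[OF pi_gt_zero] by simp
    have "lam_inf \<le> 8 * pi + 2 * \<sigma> * lam_inf" using pos[OF that] alpha_eq \<beta>_eq by simp
    then have "lam_inf \<le> 8 * pi / (1 - 2 * \<sigma>)" if "\<sigma> \<noteq> 1/2"
      using h that by (simp add: field_simps)
    then show ?thesis using h l by blast
  qed
  show ?thesis
    using \<beta>_eq neg pos neg' pos' alpha_eq by auto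
qed

end
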